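(* Let $I=[0,T]$ with $T>0$, let $F\colon I\times\mathbb{R}^N\multimap\mathbb{R}^N$ be a Carathéodory map, and suppose there exists a monotone coercive weakly negatively guiding potential $V\colon\mathbb{R}^N\to\mathbb{R}$ for $F$. Let $R>0$ be such that for all $|x|\geqslant R$ one has $\nabla V(x)\neq 0$ and, for every $t\in I$, there exists $y\in F(t,x)$ with $\langle\nabla V(x),y\rangle\leqslant 0$; and let $r>\max\{V(x)\colon|x|\leqslant R\}$. Let $g\colon C(I,\mathbb{R}^N)\to\mathbb{R}^N$ be a continuous function which maps bounded sets into bounded sets and satisfies: (i) for every $x\in AC(I,\mathbb{R}^N)$ with $x(I)\subset V^{-1}((-\infty,r])$: if $x(0)=g(x)$, then there exists $t\in(0,T]$ such that $|g(x)|\leqslant|x(t)|$; (ii) $|g(i(x))|\leqslant|x|$ for all $x\in V^{-1}(\{r\})$; (iii) $g(i(x))\neq x$ for all $x\in V^{-1}(\{r\})$. Then the nonlocal Cauchy problem $$\dot{x}(t)\in F(t,x(t))\ \text{ for a.e. } t\in I,\qquad x(0)=g(x)$$ possesses at least one solution $x\in AC(I,\mathbb{R}^N)$.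
   Context: $C(I,\mathbb{R}^N)$ is the Banach space of continuous maps with the maximum norm $\|\cdot\|$; $AC(I,\mathbb{R}^N)$ is its subspace of absolutely continuous functions; solutions are absolutely continuous functions. $|\cdot|$ and $\langle\cdot,\cdot\rangle$ are the Euclidean norm and inner product in $\mathbb{R}^N$. The map $i\colon\mathbb{R}^N\to C(I,\mathbb{R}^N)$ sends $x_0$ to the constant function $i(x_0)(t)=x_0$. A multivalued map $F\colon X\multimap Z$ assigns to each $x\in X$ a nonempty subset $F(x)\subset Z$. Carathéodory map: $F\colon I\times\mathbb{R}^N\multimap\mathbb{R}^N$ with nonempty convex compact values such that ($F_1$) for every fixed $x\in\mathbb{R}^N$ the multimap $t\mapsto F(t,x)$ is measurable, i.e. $\{t\in I\colon F(t,x)\subset A\}$ is Lebesgue measurable for every closed $A\subset\mathbb{R}^N$; ($F_2$) for a.e. $t\in I$ the multimap $x\mapsto F(t,x)$ is upper semicontinuous; ($F_3$) there is $\mu\in L^1(I,\mathbb{R})$ with $\sup\{|y|\colon y\in F(t,x)\}\leqslant\mu(t)(1+|x|)$ for every $(t,x)\in I\times\mathbb{R}^N$. $V$ is monotone if $|x|\leqslant|y|$ implies $V(x)\leqslant V(y)$ for all $x,y\in\mathbb{R}^N$. $V$ is coercive if $V(x)\to+\infty$ as $|x|\to+\infty$. Weakly negatively guiding potential for $F$: $V\in C^1(\mathbb{R}^N,\mathbb{R})$ which is nonsingular, i.e. there is $R>0$ with $\nabla V(x)\neq 0$ for all $|x|\geqslant R$, and such that there is $R>0$ such that for all $|x|\geqslant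 R$ and all $t\in I$ there exists $y\in F(t,x)$ with $\langle\nabla V(x),y\rangle\leqslant 0$. *)

theory Defs
  imports "HOL-Analysis.Analysis"
begin

text \<open>
  The points of \<^term>\<open>cfunspace (top_of_set I) euclidean_metric\<close> are the continuous functions
  on \<open>I\<close> (bounded, which is automatic for compact \<open>I\<close>), normalised to be \<^term>\<open>undefined\<close>
  outside \<open>I\<close>, so that equality of functions is equality on \<open>I\<close>. The distance is the supremum
  over \<open>I\<close>.
\<close>

definition C_space :: "real set \<Rightarrow> (real \<Rightarrow> 'a::euclidean_space) metric" where
  "C_space I = cfunspace (top_of_set I) euclidean_metric"

definition absolutely_continuous_on :: "real set \<Rightarrow> (real \<Rightarrow> 'a::real_normed_vector) \<Rightarrow> bool" where
  "absolutely_continuous_on S f \<longleftrightarrow>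
     (\<forall>\<epsilon>>0. \<exists>\<delta>>0. \<forall>(n::nat) a b.
        (\<forall>k<n. a k \<le> b k \<and> {a k..b k} \<subseteq> S) \<longrightarrow>
        disjoint_family_on (\<lambda>k. {a k<..<b k}) {..<n} \<longrightarrow>
        (\<Sum>k<n. b k - a k) < \<delta> \<longrightarrow>
        (\<Sum>k<n. norm (f (b k) - f (a k))) < \<epsilon>)"

definition AC_space :: "real set \<Rightarrow> (real \<Rightarrow> 'a::euclidean_space) set" where
  "AC_space I = {x \<in> mspace (C_space I). absolutely_continuous_on I x}"

definition const_fun :: "real set \<Rightarrow> 'a \<Rightarrow> real \<Rightarrow> 'a" where
  "const_fun I x0 = restrict (\<lambda>t. x0) I"

definition upper_semicontinuous :: "('a::topological_space \<Rightarrow> 'b::topological_space set) \<Rightarrow> bool" where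
  "upper_semicontinuous \<Phi> \<longleftrightarrow> (\<forall>U. open U \<longrightarrow> open {x. \<Phi> x \<subseteq> U})"

definition measurable_multimap :: "real set \<Rightarrow> (real \<Rightarrow> 'a::topological_space set) \<Rightarrow> bool" where
  "measurable_multimap I \<Phi> \<longleftrightarrow> (\<forall>A. closed A \<longrightarrow> {t \<in> I. \<Phi> t \<subseteq> A} \<in> sets lebesgue)"

text \<open>
  The values of \<open>F\<close> at times outside \<open>I\<close> are irrelevant. The supremum in the growth condition is
  over a nonempty compact set.
\<close>

definition caratheodory_map ::
    "real set \<Rightarrow> (real \<Rightarrow> 'a::euclidean_space \<Rightarrow> 'a set) \<Rightarrow> bool" where
  "caratheodory_map I F \<longleftrightarrow>
     (\<forall>t\<in>I. \<forall>x. F t x \<noteq> {} \<and> convex (F t x) \<and> compact (F t x)) \<and>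
     (\<forall>x. measurable_multimap I (\<lambda>t. F t x)) \<and>
     (AE t in lebesgue_on I. upper_semicontinuous (F t)) \<and>
     (\<exists>\<mu>. integrable (lebesgue_on I) \<mu> \<and>
          (\<forall>t\<in>I. \<forall>x. (SUP y\<in>F t x. norm y) \<le> \<mu> t * (1 + norm x)))"

text \<open>Meaningful only at points where \<open>V\<close> is differentiable; the gradient is then unique.\<close>

definition gradient :: "('a::euclidean_space \<Rightarrow> real) \<Rightarrow> 'a \<Rightarrow> 'a" where
  "gradient V x = (THE D. GDERIV V x :> D)"

definition C1_function :: "('a::euclidean_space \<Rightarrow> real) \<Rightarrow> bool" where
  "C1_function V \<longleftrightarrow> (\<forall>x. V differentiable (at x)) \<and> continuous_on UNIV (gradient V)"

definition norm_monotone :: "('a::real_normed_vector \<Rightarrow> real) \<Rightarrow> bool" where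
  "norm_monotone V \<longleftrightarrow> (\<forall>x y. norm x \<le> norm y \<longrightarrow> V x \<le> V y)"

definition coercive :: "('a::real_normed_vector \<Rightarrow> real) \<Rightarrow> bool" where
  "coercive V \<longleftrightarrow> filterlim V at_top at_infinity"

definition nonsingular_potential :: "('a::euclidean_space \<Rightarrow> real) \<Rightarrow> bool" where
  "nonsingular_potential V \<longleftrightarrow> (\<exists>R>0. \<forall>x. norm x \<ge> R \<longrightarrow> gradient V x \<noteq> 0)"

definition weakly_negatively_guiding ::
    "real set \<Rightarrow> (real \<Rightarrow> 'a::euclidean_space \<Rightarrow> 'a set) \<Rightarrow> ('a \<Rightarrow> real) \<Rightarrow> bool" where
  "weakly_negatively_guiding I F V \<longleftrightarrow>
     C1_function V \<and> nonsingular_potential V \<and>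
     (\<exists>R>0. \<forall>x. norm x \<ge> R \<longrightarrow> (\<forall>t\<in>I. \<exists>y\<in>F t x. inner (gradient V x) y \<le> 0))"

text \<open>The derivative at an endpoint of \<open>I\<close> is one-sided; these points form a null set.\<close>

definition nonlocal_solution ::
    "real \<Rightarrow> (real \<Rightarrow> 'a::euclidean_space \<Rightarrow> 'a set) \<Rightarrow> ((real \<Rightarrow> 'a) \<Rightarrow> 'a) \<Rightarrow> (real \<Rightarrow> 'a) \<Rightarrow> bool" where
  "nonlocal_solution T F g x \<longleftrightarrow>
     x \<in> AC_space {0..T} \<and>
     (AE t in lebesgue_on {0..T}.
        \<exists>v\<in>F t (x t). (x has_vector_derivative v) (at t within {0..T})) \<and>
     x 0 = g x"

end

theory Submission
  imports Defs "HOL-Complex_Analysis.Great_Picard"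
begin

text \<open>
  A monotone potential is radial, so its sublevel set \<open>V \<le> r\<close> contains a ball of some radius
  \<open>\<rho> > R\<close> whose boundary lies on the level \<open>r\<close>, and \<open>\<langle>\<nabla>V(x), y\<rangle> \<le> 0\<close> implies \<open>\<langle>x, y\<rangle> \<le> 0\<close> for
  \<open>|x| \<ge> R\<close>. Hence \<open>\<Gamma>\<^sub>e(t, x) = {y - e x | y \<in> F(t, x), |x| > R \<longrightarrow> \<langle>x, y\<rangle> \<le> 0}\<close> is again a
  Caratheodory map, and for \<open>e > 0\<close> it points strictly inward for \<open>R < |x| \<le> \<rho>\<close>.

  For fixed \<open>e > 0\<close> the inclusions \<open>x' \<in> l \<Gamma>\<^sub>e(t, x)\<close>, \<open>0 \<le> l \<le> 1\<close>, are approximated by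
  differential equations with delay, whose solutions \<open>P\<^sub>n(l, z)\<close> depend continuously on \<open>l\<close> and on
  the initial value \<open>z\<close>. A fixed point of \<open>z \<mapsto> g(P\<^sub>n(l, z))\<close> with \<open>|z| = \<rho>\<close> for arbitrarily large
  \<open>n\<close> would in the limit give a solution \<open>x\<close> of the inclusion with \<open>x(0) = g(x)\<close> and
  \<open>|x(0)| = \<rho>\<close>. For \<open>l > 0\<close> such an \<open>x\<close> satisfies \<open>|x(t)| < |x(0)|\<close> for all \<open>t > 0\<close>, against (i);
  for \<open>l = 0\<close> it is constant, against (iii). As \<open>z \<mapsto> g(i(z))\<close> maps the sphere into the ball by
  (ii), the homotopy in \<open>l\<close> together with Brouwer's theorem yields a fixed point for \<open>l = 1\<close>. It
  remains to let \<open>n \<rightarrow> \<infinity>\<close> and then \<open>e \<rightarrow> 0\<close>.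
\<close>

subsection \<open>Indefinite integrals\<close>

text \<open>The inclusion has no unique solutions, so the map from initial values to solutions is
  multivalued, in general with nonconvex values, and Brouwer's theorem does not apply to it
  directly. Continuous single-valued approximations alone do not cure this, as they need not be
  Lipschitz. The delay does: each time step uses only the part of the solution that is already
  known. The price is that approximate trajectories may leave the ball and need not have decreasing
  norm, so (i) contradicts nothing at a fixed n. The sphere can be freed of fixed points only
  through the limit, by compactness, and only for large n. Moreover (i) is violated only by
  trajectories with |x(t)| < |x(0)| for all t > 0. Under the mere inequality <x, y> \<le> 0 the norm
  could stay constant, which is the reason for the term - e x and for removing it last. In both
  limits the trajectories converge uniformly, but their velocities converge only weakly. Convexity
  of the values is what lets the inclusion survive.\<close>

lemma AE_lebesgue_on_iff_negligible:
  assumes "S \<in> sets lebesgue"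
  shows "(AE s in lebesgue_on S. P s) \<longleftrightarrow> negligible {s \<in> S. \<not> P s}"
proof -
  have "(AE s in lebesgue_on S. P s) \<longleftrightarrow> (AE s in lebesgue. s \<in> S \<longrightarrow> P s)"
    using assms by (subst AE_restrict_space_iff) auto
  also have "\<dots> \<longleftrightarrow> {s \<in> S. \<not> P s} \<in> null_sets lebesgue"
    by (subst AE_iff_null_sets[symmetric] completion.complete_sets_sandwich | simp add: completion.null_sets_iff_AE)+
  finally show ?thesis by (simp add: negligible_iff_null_sets)
qed

text \<open>\<open>integrable_ccontinuous_explicit\<close> controls the difference quotients to the
  right of a point off a null set. Applied to the reflected function it controls those to the left,
  so the derivative exists off the union of the first null set and the mirror image of the second.
  Extension by zero makes the function integrable on every interval, as that theorem asks.\<close>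

lemma AE_has_vector_derivative_integral:
  fixes w :: "real \<Rightarrow> 'a::euclidean_space"
  assumes w: "w integrable_on {a..b}"
  shows "AE t in lebesgue_on {a..b}.
    ((\<lambda>t. integral {a..t} w) has_vector_derivative w t) (at t within {a..b})"
proof -
  define f where "f t = (if t \<in> {a..b} then w t else 0)" for t
  have fU: "f integrable_on UNIV"
    unfolding f_def using w by (simp only: integrable_restrict_UNIV)
  have f: "f integrable_on cbox c d" for c d :: real
    using integrable_on_subcbox[OF fU] by auto
  have f2: "(\<lambda>s. f (- s)) integrable_on cbox c d" for c d :: real
    using f[of "-d" "-c"] Henstock_Kurzweil_Integration.integrable_reflect_real[where f=f and a="-d" and b="-c"] by (simp only: box_real minus_minus)
  obtain N1 where N1: "negligible N1"
    "\<And>x e. \<lbrakk>x \<notin> N1; 0 < e\<rbrakk> \<Longrightarrow> \<exists>d>0. \<forall>h. 0 < h \<and> h < d \<longrightarrow> norm (integral {x..x+h} f /\<^sub>R h - f x) < e"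
    using integrable_ccontinuous_explicit[of f] f by auto
  obtain N2 where N2: "negligible N2"
    "\<And>x e. \<lbrakk>x \<notin> N2; 0 < e\<rbrakk> \<Longrightarrow> \<exists>d>0. \<forall>h. 0 < h \<and> h < d \<longrightarrow> norm (integral {x..x+h} (\<lambda>s. f (- s)) /\<^sub>R h - f (- x)) < e"
    using integrable_ccontinuous_explicit[of "\<lambda>s. f (- s)"] f2 by auto
  have neg: "negligible (N1 \<union> uminus ` N2)"
    using N1 negligible_differentiable_image_negligible[OF _ N2(1), of uminus]
    by (auto intro!: negligible_Un linear_imp_differentiable_on linear_uminus)
  have "((\<lambda>t. integral {a..t} w) has_vector_derivative w t) (at t within {a..b})"
    if t: "t \<in> {a..b}" "t \<notin> N1" "t \<notin> uminus ` N2" for t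
    unfolding has_vector_derivative_def has_derivative_within_alt
  proof (intro conjI allI impI)
    show "bounded_linear (\<lambda>h. h *\<^sub>R w t)" by (rule bounded_linear_scaleR_left)
    fix e :: real assume e: "e > 0"
    have "- t \<notin> N2" using t(3) by (metis image_eqI minus_minus)
    then obtain d1 d2 where d: "d1 > 0" "d2 > 0"
      and d1: "\<And>h. 0 < h \<Longrightarrow> h < d1 \<Longrightarrow> norm (integral {t..t+h} f /\<^sub>R h - f t) < e"
      and d2: "\<And>h. 0 < h \<Longrightarrow> h < d2 \<Longrightarrow> norm (integral {-t..-t+h} (\<lambda>s. f (- s)) /\<^sub>R h - f t) < e"
      using N1(2)[OF t(2) e] N2(2)[OF _ e, of "-t"] by (metis minus_minus)
    show "\<exists>d>0. \<forall>y\<in>{a..b}. norm (y - t) < d \<longrightarrow>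
      norm (integral {a..y} w - integral {a..t} w - (y - t) *\<^sub>R w t) \<le> e * norm (y - t)"
    proof (intro exI conjI ballI impI)
      show "min d1 d2 > 0" using d by simp
      fix y assume y: "y \<in> {a..b}" and yd: "norm (y - t) < min d1 d2"
      have wf: "integral {c..d} w = integral {c..d} f" if "{c..d} \<subseteq> {a..b}" for c d
        by (rule integral_cong) (use that in \<open>auto simp: f_def\<close>)
      have wt: "w t = f t" using t by (simp add: f_def)
      have wi: "w integrable_on {a..c}" if "c \<in> {a..b}" for c
        using integrable_subinterval_real[OF w] that by auto
      have scale: "norm (v - h *\<^sub>R u) \<le> e * h" if "h > 0" "norm (v /\<^sub>R h - u) < e" for h v and u :: 'a
      proof -
        have "v - h *\<^sub>R u = h *\<^sub>R (v /\<^sub>R h - u)" using that by (simp add: algebra_simps)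
        then have "norm (v - h *\<^sub>R u) = h * norm (v /\<^sub>R h - u)" using that by simp
        then show ?thesis using that by (simp add: mult.commute)
      qed
      consider "y = t" | "y > t" | "y < t" by linarith
      then show "norm (integral {a..y} w - integral {a..t} w - (y - t) *\<^sub>R w t) \<le> e * norm (y - t)"
      proof cases
        case 1 then show ?thesis by simp
      next
        case 2
        have "integral {a..t} w + integral {t..y} w = integral {a..y} w"
          using t y 2 by (intro Henstock_Kurzweil_Integration.integral_combine wi) auto
        moreover have "integral {t..y} w = integral {t..t+(y-t)} f"
          using wf[of t y] t y by auto
        ultimately have "integral {a..y} w - integral {a..t} w = integral {t..t+(y-t)} f"
          by (metis add_diff_cancel_left')
        then show ?thesis
          using scale[OF _ d1[of "y - t"]] 2 yd wt by auto
      next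
        case 3
        have "integral {a..y} w + integral {y..t} w = integral {a..t} w"
          using t y 3 by (intro Henstock_Kurzweil_Integration.integral_combine wi) auto
        moreover have "integral {y..t} w = integral {-t..-t+(t-y)} (\<lambda>s. f (- s))"
          using wf[of y t] t y integral_reflect_real[of t y f] by auto
        ultimately have eq: "integral {a..t} w - integral {a..y} w = integral {-t..-t+(t-y)} (\<lambda>s. f (- s))"
          by (metis add_diff_cancel_left')
        have "norm (integral {a..t} w - integral {a..y} w - (t - y) *\<^sub>R w t) \<le> e * (t - y)"
          unfolding eq wt using 3 yd by (intro scale d2) auto
        moreover have "integral {a..y} w - integral {a..t} w - (y - t) *\<^sub>R w t
          = - (integral {a..t} w - integral {a..y} w - (t - y) *\<^sub>R w t)"
          by (simp add: algebra_simps)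
        ultimately show ?thesis using 3 by (metis abs_minus_commute abs_of_pos diff_gt_0_iff_gt norm_minus_cancel real_norm_def)
      qed
    qed
  qed
  then have "{t \<in> {a..b}. \<not> ((\<lambda>t. integral {a..t} w) has_vector_derivative w t) (at t within {a..b})}
     \<subseteq> N1 \<union> uminus ` N2" by blast
  then show ?thesis
    using negligible_subset[OF neg] by (simp add: AE_lebesgue_on_iff_negligible)
qed


text \<open>Truncate the norm at height k. The excess \<open>h k\<close> has integral below e/2 for
  large k by dominated convergence, and the part below k contributes at most k times the total
  length of the intervals.\<close>

lemma absolutely_continuous_on_integral:
  fixes w :: "real \<Rightarrow> 'a::euclidean_space"
  assumes w: "w absolutely_integrable_on {a..b}"
  shows "absolutely_continuous_on {a..b} (\<lambda>t. integral {a..t} w)"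
  unfolding absolutely_continuous_on_def
proof (intro allI impI)
  fix e :: real assume e: "e > 0"
  define h where "h k s = norm (w s) - min (norm (w s)) (real k)" for k :: nat and s
  have n: "(\<lambda>s. norm (w s)) absolutely_integrable_on {a..b}"
    using absolutely_integrable_norm[OF w] by (simp add: o_def)
  have mn: "(\<lambda>s. min (norm (w s)) (real k)) absolutely_integrable_on {a..b}" for k
    using n by (intro absolutely_integrable_min_1) auto
  have h: "h k absolutely_integrable_on {a..b}" for k
    unfolding h_def using n mn by (rule set_integral_diff)
  have h0: "0 \<le> h k s" for k s by (simp add: h_def)
  have "(\<lambda>k. integral {a..b} (h k)) \<longlonglongrightarrow> integral {a..b} (\<lambda>s. 0)"
  proof (rule dominated_convergence(2))
    show "h k integrable_on {a..b}" for k using h by (rule set_lebesgue_integral_eq_integral)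
    show "(\<lambda>s. norm (w s)) integrable_on {a..b}" using n by (rule set_lebesgue_integral_eq_integral)
    show "norm (h k s) \<le> norm (w s)" for k s by (auto simp: h_def)
    show "(\<lambda>k. h k s) \<longlonglongrightarrow> 0" for s
    proof (rule tendsto_eventually)
      obtain N :: nat where "norm (w s) \<le> real N" using real_arch_simple by blast
      then show "\<forall>\<^sub>F k in sequentially. h k s = 0"
        by (intro eventually_sequentiallyI[of N]) (auto simp: h_def)
    qed
  qed
  then have "eventually (\<lambda>k. integral {a..b} (h k) < e / 2) sequentially"
    using e by (intro order_tendstoD(2)) auto
  then obtain k where k: "integral {a..b} (h k) < e / 2"
    by (auto simp: eventually_sequentially)
  show "\<exists>\<delta>>0. \<forall>(n::nat) p q.
        (\<forall>k<n. p k \<le> q k \<and> {p k..q k} \<subseteq> {a..b}) \<longrightarrow>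
        disjoint_family_on (\<lambda>k. {p k<..<q k}) {..<n} \<longrightarrow>
        (\<Sum>k<n. q k - p k) < \<delta> \<longrightarrow>
        (\<Sum>k<n. norm (integral {a..q k} w - integral {a..p k} w)) < e"
  proof (intro exI conjI allI impI)
    \<comment> \<open>With this length the bounded part costs at most k e / (2 (k + 1)) \<le> e/2;
      adding 1 covers k = 0.\<close>
    show "e / (2 * (real k + 1)) > 0" using e by simp
    fix n and p q :: "nat \<Rightarrow> real"
    assume pq: "\<forall>k<n. p k \<le> q k \<and> {p k..q k} \<subseteq> {a..b}"
      and dj: "disjoint_family_on (\<lambda>k. {p k<..<q k}) {..<n}"
      and small: "(\<Sum>k<n. q k - p k) < e / (2 * (real k + 1))"
    \<comment> \<open>Open intervals, because only these are assumed disjoint: adjacent closed ones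
      may share an endpoint. At every s at most one \<open>H i\<close> is nonzero, so their sum
      stays below \<open>h k\<close>.\<close>
    define H where "H i s = (if s \<in> {p i<..<q i} then h k s else 0)" for i s
    have Hi: "H i integrable_on {a..b}" and HI: "integral {a..b} (H i) = integral {p i..q i} (h k)" if "i < n" for i
    proof -
      have sub: "{p i..q i} \<subseteq> {a..b}" using pq that by blast
      have "h k integrable_on {p i..q i}"
        using set_lebesgue_integral_eq_integral(1)[OF h] integrable_subinterval_real sub by blast
      then have o: "h k integrable_on {p i<..<q i}" by (simp add: integrable_on_open_interval_real)
      have sub': "{p i<..<q i} \<subseteq> {a..b}" using sub greaterThanLessThan_subseteq_atLeastAtMost_iff by fastforce
      show "H i integrable_on {a..b}" 
        unfolding H_def using integrable_restrict_Int[of "{p i<..<q i}" "h k" "{a..b}"] o sub'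
        by (simp add: Int_absorb2)
      show "integral {a..b} (H i) = integral {p i..q i} (h k)"
        unfolding H_def using integral_restrict_Int[of "{a..b}" "{p i<..<q i}" "h k"] sub'
        by (simp add: Int_absorb2 integral_open_interval_real)
    qed
    have piece: "norm (integral {a..q i} w - integral {a..p i} w)
        \<le> integral {a..b} (H i) + real k * (q i - p i)" if "i < n" for i
    proof -
      have sub: "{p i..q i} \<subseteq> {a..b}" "p i \<le> q i" using pq that by blast+
      then have ab: "a \<le> p i" "q i \<le> b" by auto
      have wi: "w integrable_on {a..b}" using w by (rule set_lebesgue_integral_eq_integral)
      have "integral {a..p i} w + integral {p i..q i} w = integral {a..q i} w"
        using sub ab integrable_subinterval_real[OF wi] by (intro Henstock_Kurzweil_Integration.integral_combine) auto
      then have "norm (integral {a..q i} w - integral {a..p i} w) = norm (integral {p i..q i} w)"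
        by (metis add_diff_cancel_left')
      also have "\<dots> \<le> integral {p i..q i} (\<lambda>s. h k s + real k)"
      proof (rule integral_norm_bound_integral)
        show "w integrable_on {p i..q i}" using integrable_subinterval_real[OF wi sub(1)] .
        show "(\<lambda>s. h k s + real k) integrable_on {p i..q i}"
          using integrable_subinterval_real[OF set_lebesgue_integral_eq_integral(1)[OF h] sub(1)]
          by (intro integrable_add) auto
        show "norm (w s) \<le> h k s + real k" for s by (auto simp: h_def)
      qed
      also have "\<dots> = integral {p i..q i} (h k) + real k * (q i - p i)"
        using integrable_subinterval_real[OF set_lebesgue_integral_eq_integral(1)[OF h] sub(1)] sub(2)
        by (subst integral_add) (auto simp: mult.commute)
      finally show ?thesis using HI[OF that] by simp
    qed
    have "(\<Sum>i<n. norm (integral {a..q i} w - integral {a..p i} w))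
        \<le> (\<Sum>i<n. integral {a..b} (H i) + real k * (q i - p i))"
      by (intro sum_mono piece) simp
    also have "\<dots> = integral {a..b} (\<lambda>s. \<Sum>i<n. H i s) + real k * (\<Sum>i<n. q i - p i)"
      using Hi by (subst integral_sum) (auto simp: sum.distrib sum_distrib_left)
    also have "integral {a..b} (\<lambda>s. \<Sum>i<n. H i s) \<le> integral {a..b} (h k)"
    proof (rule integral_le)
      show "(\<lambda>s. \<Sum>i<n. H i s) integrable_on {a..b}" using Hi by (intro integrable_sum) auto
      show "h k integrable_on {a..b}" using h by (rule set_lebesgue_integral_eq_integral)
      fix s
      show "(\<Sum>i<n. H i s) \<le> h k s"
      proof (cases "\<exists>i<n. s \<in> {p i<..<q i}")
        case True
        then obtain i where i: "i < n" "s \<in> {p i<..<q i}" by blast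
        have "H j s = 0" if "j \<in> {..<n} - {i}" for j
        proof -
          have "s \<notin> {p j<..<q j}"
            using disjoint_family_onD[OF dj, of i j] i that by auto
          then show ?thesis unfolding H_def by (rule if_not_P)
        qed
        then have "(\<Sum>i<n. H i s) = H i s"
          using i by (subst sum.remove[of _ i]) auto
        then show ?thesis using i h0 by (simp add: H_def)
      next
        case False
        then have "(\<Sum>i<n. H i s) = 0" by (intro sum.neutral ballI) (auto simp: H_def)
        then show ?thesis using h0 by simp
      qed
    qed
    also have "real k * (\<Sum>i<n. q i - p i) \<le> real k * (e / (2 * (real k + 1)))"
      using small by (intro mult_left_mono) auto
    also have "\<dots> \<le> e / 2" using e by (simp add: field_simps)
    finally show "(\<Sum>k<n. norm (integral {a..q k} w - integral {a..p k} w)) < e"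
      using k by simp
  qed
qed

lemma absolutely_continuous_on_add_const:
  "absolutely_continuous_on S f \<Longrightarrow> absolutely_continuous_on S (\<lambda>t. c + f t)"
  by (simp add: absolutely_continuous_on_def)

section \<open>Decrease of the norm along a trajectory\<close>

lemma nonincreasing_if_uniformly_locally:
  fixes f :: "real \<Rightarrow> real"
  assumes "d > 0" "a \<le> b"
    and loc: "\<And>s t. a \<le> s \<Longrightarrow> s \<le> t \<Longrightarrow> t \<le> b \<Longrightarrow> t - s < d \<Longrightarrow> f t \<le> f s"
  shows "f b \<le> f a"
proof -
  have *: "a \<le> t \<Longrightarrow> t \<le> b \<Longrightarrow> t - a \<le> real n * (d / 2) \<Longrightarrow> f t \<le> f a" for n t
  proof (induction n arbitrary: t)
    case 0 then show ?case by simp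
  next
    case (Suc n)
    \<comment> \<open>Backward steps of length d/2 stay strictly below the threshold d; the maximum
      stops the last one at a.\<close>
    define u where "u = max a (t - d / 2)"
    have u: "a \<le> u" "u \<le> t" using Suc.prems \<open>d > 0\<close> by (auto simp: u_def)
    moreover have "f u \<le> f a"
      using Suc.prems u \<open>d > 0\<close> by (intro Suc.IH) (auto simp: u_def max_def algebra_simps)
    moreover have "f t \<le> f u"
      using Suc.prems u \<open>d > 0\<close> by (intro loc) (auto simp: u_def max_def)
    ultimately show ?case by linarith
  qed
  obtain n :: nat where "(b - a) / (d / 2) \<le> real n" using real_arch_simple by blast
  then show ?thesis using *[of b n] assms(1,2) by (simp add: field_simps)
qed

text \<open>The chain rule for \<open>|x|\<^sup>2\<close> is replaced by
  \<open>|x(t)|\<^sup>2 - |x(s)|\<^sup>2 \<le> 2 \<langle>x(t), x(t) - x(s)\<rangle>\<close> on a fine partition.\<close>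

lemma norm_square_decrease:
  fixes w :: "real \<Rightarrow> 'a::euclidean_space"
  assumes w: "w absolutely_integrable_on {a..b}" and "a \<le> b"
    and x: "\<And>t. t \<in> {a..b} \<Longrightarrow> x t = x a + integral {a..t} w"
    and le: "AE s in lebesgue_on {a..b}. inner (x s) (w s) \<le> - c"
  shows "(norm (x b))\<^sup>2 \<le> (norm (x a))\<^sup>2 - 2 * c * (b - a)"
proof -
  have wi: "w integrable_on {a..b}" using w by (rule set_lebesgue_integral_eq_integral)
  have ni: "(\<lambda>s. norm (w s)) integrable_on {a..b}"
    using absolutely_integrable_norm[OF w] by (simp add: o_def absolutely_integrable_on_def)
  have cont: "continuous_on {a..b} x"
    using indefinite_integral_continuous_1[OF wi]
    by (subst continuous_on_cong[OF refl x]) (auto intro!: continuous_intros)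
  define N where "N = {s \<in> {a..b}. \<not> inner (x s) (w s) \<le> - c}"
  have N: "negligible N" using le by (simp add: AE_lebesgue_on_iff_negligible N_def)
  define B where "B = integral {a..b} (\<lambda>s. norm (w s))"
  have main: "(norm (x b))\<^sup>2 + 2 * c * (b - a) \<le> (norm (x a))\<^sup>2 + e * (2 * B)" if e: "e > 0" for e
  proof -
    have "uniformly_continuous_on {a..b} x" using cont by (intro compact_uniformly_continuous) auto
    then obtain d where d: "d > 0"
      "\<And>s t. s \<in> {a..b} \<Longrightarrow> t \<in> {a..b} \<Longrightarrow> dist s t < d \<Longrightarrow> dist (x s) (x t) < e"
      using e unfolding uniformly_continuous_on_def by metis
    \<comment> \<open>The hypothesis pairs the velocity with x at the same time, while the estimate
      for the square has x at the right end of the step. Uniform continuity makes the discrepancy at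
      most e |w|, and the last term of \<open>\<Psi>\<close> collects this error.\<close>
    define \<Psi> where "\<Psi> t = (norm (x t))\<^sup>2 + 2 * c * t - 2 * e * integral {a..t} (\<lambda>s. norm (w s))" for t
    have "\<Psi> b \<le> \<Psi> a"
    proof (rule nonincreasing_if_uniformly_locally[OF d(1) \<open>a \<le> b\<close>])
      fix s t assume st: "a \<le> s" "s \<le> t" "t \<le> b" "t - s < d"
      have wst: "w integrable_on {s..t}" and nst: "(\<lambda>s. norm (w s)) integrable_on {s..t}"
        using integrable_subinterval_real[OF wi, of s t] integrable_subinterval_real[OF ni, of s t] st by auto
      have "integral {a..s} w + integral {s..t} w = integral {a..t} w"
        using st integrable_subinterval_real[OF wi] by (intro Henstock_Kurzweil_Integration.integral_combine) auto
      then have xst: "x t - x s = integral {s..t} w" using x[of s] x[of t] st by (simp add: algebra_simps)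
      have nadd: "integral {a..s} (\<lambda>s. norm (w s)) + integral {s..t} (\<lambda>s. norm (w s)) = integral {a..t} (\<lambda>s. norm (w s))"
        using st integrable_subinterval_real[OF ni] by (intro Henstock_Kurzweil_Integration.integral_combine) auto
      have "inner (x t) (x t - x s) = integral {s..t} (\<lambda>\<tau>. inner (x t) (w \<tau>))"
        unfolding xst by (rule integral_linear[OF wst bounded_linear_inner_right, unfolded o_def, symmetric])
      \<comment> \<open>On the null set N the integrand is replaced by the bound itself, so that the
        comparison holds at every point, as \<open>integral_le\<close> demands.\<close>
      also have "\<dots> = integral {s..t} (\<lambda>\<tau>. if \<tau> \<in> N then - c + e * norm (w \<tau>) else inner (x t) (w \<tau>))"
        by (rule integral_spike[OF N]) auto
      also have "\<dots> \<le> integral {s..t} (\<lambda>\<tau>. - c + e * norm (w \<tau>))"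
      proof (rule integral_le)
        show "(\<lambda>\<tau>. if \<tau> \<in> N then - c + e * norm (w \<tau>) else inner (x t) (w \<tau>)) integrable_on {s..t}"
          using integrable_linear[OF wst bounded_linear_inner_right, unfolded o_def, of "x t"]
          by (rule integrable_spike[OF _ N]) auto
        show "(\<lambda>\<tau>. - c + e * norm (w \<tau>)) integrable_on {s..t}"
          using integrable_cmul[OF nst, of e] by (intro integrable_add) auto
        fix \<tau> assume \<tau>: "\<tau> \<in> {s..t}"
        show "(if \<tau> \<in> N then - c + e * norm (w \<tau>) else inner (x t) (w \<tau>)) \<le> - c + e * norm (w \<tau>)"
        proof (cases "\<tau> \<in> N")
          case False
          then have "inner (x \<tau>) (w \<tau>) \<le> - c" using st \<tau> by (auto simp: N_def)
          moreover have "norm (x t - x \<tau>) \<le> e"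
            using d(2)[of t \<tau>] st \<tau> by (auto simp: dist_norm)
          then have "inner (x t - x \<tau>) (w \<tau>) \<le> e * norm (w \<tau>)"
            by (meson norm_cauchy_schwarz order_trans mult_right_mono norm_ge_zero)
          ultimately show ?thesis using False by (simp add: inner_diff_left)
        qed simp
      qed
      also have "\<dots> = - c * (t - s) + e * integral {s..t} (\<lambda>s. norm (w s))"
        using integrable_cmul[OF nst, of e] st by (subst integral_add) (auto simp: mult.commute)
      finally have "2 * inner (x t) (x t - x s) \<le> 2 * (- c * (t - s) + e * integral {s..t} (\<lambda>s. norm (w s)))"
        by simp
      moreover have "(norm (x t))\<^sup>2 - (norm (x s))\<^sup>2 = 2 * inner (x t) (x t - x s) - (norm (x t - x s))\<^sup>2"
        by (simp add: power2_norm_eq_inner algebra_simps inner_commute)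
      moreover have "(norm (x t - x s))\<^sup>2 \<ge> 0" by simp
      ultimately have "(norm (x t))\<^sup>2 - (norm (x s))\<^sup>2 \<le> 2 * (- c * (t - s) + e * integral {s..t} (\<lambda>s. norm (w s)))"
        by linarith
      then show "\<Psi> t \<le> \<Psi> s" unfolding \<Psi>_def nadd[symmetric] by (simp add: algebra_simps)
    qed
    then show ?thesis by (simp add: \<Psi>_def B_def algebra_simps)
  qed
  have "(norm (x b))\<^sup>2 + 2 * c * (b - a) \<le> (norm (x a))\<^sup>2"
  proof (rule tendsto_lowerbound)
    show "((\<lambda>e. (norm (x a))\<^sup>2 + e * (2 * B)) \<longlongrightarrow> (norm (x a))\<^sup>2) (at_right 0)"
      by (auto intro!: tendsto_eq_intros)
    show "\<forall>\<^sub>F e in at_right 0. (norm (x b))\<^sup>2 + 2 * c * (b - a) \<le> (norm (x a))\<^sup>2 + e * (2 * B)"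
      using main by (auto simp: eventually_at intro!: exI[of _ 1])
  qed simp
  then show ?thesis by simp
qed

text \<open>Let \<phi> b > L and look at the last time s before b with \<phi> s \<le> L. After s the
  decrease applies, so \<phi> b is at most the right limit \<phi> s, which is absurd. Without such a
  time the decrease applies on all of {0..b}.\<close>

lemma decrease_above_level:
  fixes \<phi> :: "real \<Rightarrow> real"
  assumes cont: "continuous_on {0..T} \<phi>" and b: "b \<in> {0..T}" and c: "c \<ge> 0"
    and dec: "\<And>a b. 0 \<le> a \<Longrightarrow> a \<le> b \<Longrightarrow> b \<le> T \<Longrightarrow> (\<And>s. s \<in> {a..b} \<Longrightarrow> \<phi> s > L) \<Longrightarrow> \<phi> b \<le> \<phi> a - c * (b - a)"
  shows "\<phi> b \<le> max L (\<phi> 0 - c * b)"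
proof (cases "\<phi> b \<le> L")
  case False
  define A where "A = {0..b} \<inter> \<phi> -` {..L}"
  show ?thesis
  proof (cases "A = {}")
    case True
    then have "\<phi> b \<le> \<phi> 0 - c * (b - 0)" using b by (intro dec) (auto simp: A_def)
    then show ?thesis by simp
  next
    case A: False
    have cl: "closed A"
      unfolding A_def using continuous_on_subset[OF cont, of "{0..b}"] b
      by (intro continuous_closed_preimage) auto
    have bd: "bdd_above A" by (auto simp: A_def intro!: bdd_aboveI[of _ b])
    define s where "s = Sup A"
    have sA: "s \<in> A" unfolding s_def using closed_contains_Sup[OF A bd cl] .
    then have s: "0 \<le> s" "s \<le> b" "\<phi> s \<le> L" by (auto simp: A_def)
    have up: "t \<notin> A" if "s < t" for t using cSup_upper[OF _ bd, of t] that by (auto simp: s_def)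
    have "s \<noteq> b" using s False by auto
    then have "s < b" using s by simp
    have "continuous_on {s..b} \<phi>" by (rule continuous_on_subset[OF cont]) (use s b in auto)
    \<comment> \<open>\<open>dec\<close> needs \<phi> > L at the left end too, which fails at s. It
      is applied from a > s, and then a tends to s.\<close>
    then have lim: "(\<phi> \<longlongrightarrow> \<phi> s) (at_right s)"
      using \<open>s < b\<close> by (simp add: continuous_on_Icc_at_rightD)
    have "\<phi> b \<le> \<phi> s"
    proof (rule tendsto_lowerbound[OF lim])
      show "\<forall>\<^sub>F a in at_right s. \<phi> b \<le> \<phi> a"
        unfolding eventually_at_right[OF \<open>s < b\<close>]
      proof (intro exI[of _ b] conjI allI impI \<open>s < b\<close>)
        fix a assume a: "s < a" "a < b"
        have "\<phi> b \<le> \<phi> a - c * (b - a)"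
        proof (rule dec)
          fix t assume t: "t \<in> {a..b}"
          with up[of t] a s b show "\<phi> t > L" by (auto simp: A_def)
        qed (use s a b in auto)
        moreover have "c * (b - a) \<ge> 0" using c a by simp
        ultimately show "\<phi> b \<le> \<phi> a" by linarith
      qed
    qed simp
    with s False show ?thesis by simp
  qed
qed simp

text \<open>The maximum separates trajectories that have met the ball of radius R from those that
  stayed outside it. If R < |x 0|, c > 0 and b > 0, both terms are strictly below the square of |x
  0|; this is the strictness that will contradict (i).\<close>

lemma norm_square_bound_outside_ball:
  fixes w :: "real \<Rightarrow> 'a::euclidean_space"
  assumes w: "w absolutely_integrable_on {0..T}" and b: "b \<in> {0..T}" and "c \<ge> 0" and "R \<ge> 0"
    and x: "\<And>t. t \<in> {0..T} \<Longrightarrow> x t = x 0 + integral {0..t} w"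
    and le: "AE s in lebesgue_on {0..T}. norm (x s) > R \<longrightarrow> inner (x s) (w s) \<le> - c"
  shows "(norm (x b))\<^sup>2 \<le> max (R\<^sup>2) ((norm (x 0))\<^sup>2 - 2 * c * b)"
proof (rule decrease_above_level[where T = T])
  have wi: "w integrable_on {0..T}" using w by (rule set_lebesgue_integral_eq_integral)
  have "continuous_on {0..T} x"
    using indefinite_integral_continuous_1[OF wi]
    by (subst continuous_on_cong[OF refl x]) (auto intro!: continuous_intros)
  then show "continuous_on {0..T} (\<lambda>b. (norm (x b))\<^sup>2)" by (intro continuous_intros)
  fix a b assume ab: "0 \<le> a" "a \<le> b" "b \<le> T" and R: "\<And>s. s \<in> {a..b} \<Longrightarrow> R\<^sup>2 < (norm (x s))\<^sup>2"
  show "(norm (x b))\<^sup>2 \<le> (norm (x a))\<^sup>2 - 2 * c * (b - a)"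
  proof (rule norm_square_decrease)
    show "w absolutely_integrable_on {a..b}"
      using ab by (intro absolutely_integrable_on_subinterval[OF w]) auto
    fix t assume t: "t \<in> {a..b}"
    have "integral {0..a} w + integral {a..t} w = integral {0..t} w"
      using t ab integrable_subinterval_real[OF wi] by (intro Henstock_Kurzweil_Integration.integral_combine) auto
    then show "x t = x a + integral {a..t} w" using x[of t] x[of a] t ab by simp
  next
    have R': "norm (x s) > R" if "s \<in> {a..b}" for s
      using R[OF that] by (rule power2_less_imp_less) simp
    show "AE s in lebesgue_on {a..b}. inner (x s) (w s) \<le> - c"
      using le ab R' by (auto simp: AE_lebesgue_on_iff_negligible elim!: negligible_subset)
  qed (use ab in auto)
qed (use assms in auto)

subsection \<open>Weak limits of dominated primitives\<close>

text \<open>The convex hull of a tail is encoded by coefficients because the same coefficients have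
  to act on functions, on their values at a point and on their integrals.\<close>

definition tail_weights :: "nat \<Rightarrow> (nat \<Rightarrow> real) set" where
  "tail_weights n = {c. (\<forall>k. 0 \<le> c k) \<and> (\<forall>k<n. c k = 0) \<and> finite {k. c k \<noteq> 0} \<and> (\<Sum>k | c k \<noteq> 0. c k) = 1}"

definition weighted_sum :: "(nat \<Rightarrow> real) \<Rightarrow> (nat \<Rightarrow> 'a::real_vector) \<Rightarrow> 'a" where
  "weighted_sum c v = (\<Sum>k | c k \<noteq> 0. c k *\<^sub>R v k)"

lemma weighted_sum_eq:
  assumes "finite A" "{k. c k \<noteq> 0} \<subseteq> A"
  shows "weighted_sum c v = (\<Sum>k\<in>A. c k *\<^sub>R v k)"
  unfolding weighted_sum_def by (rule sum.mono_neutral_left) (use assms in auto)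

lemma tail_weights_sum:
  assumes "c \<in> tail_weights n" "finite A" "{k. c k \<noteq> 0} \<subseteq> A"
  shows "(\<Sum>k\<in>A. c k) = 1"
proof -
  have "(\<Sum>k | c k \<noteq> 0. c k) = (\<Sum>k\<in>A. c k)"
    by (rule sum.mono_neutral_left) (use assms in auto)
  then show ?thesis using assms(1) by (simp add: tail_weights_def)
qed

lemma tail_weights_mono: "n \<le> n' \<Longrightarrow> tail_weights n' \<subseteq> tail_weights n"
  by (auto simp: tail_weights_def)

lemma tail_weights_unit: "(\<lambda>k. if k = n then 1 else 0) \<in> tail_weights n"
  by (auto simp: tail_weights_def)

text \<open>Closure under midpoints is the convexity of the set of weights that the parallelogram
  argument uses.\<close>

lemma tail_weights_midpoint:
  assumes "c \<in> tail_weights n" "d \<in> tail_weights n"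
  shows "(\<lambda>k. (c k + d k) / 2) \<in> tail_weights n"
    and "weighted_sum (\<lambda>k. (c k + d k) / 2) v = (1/2) *\<^sub>R (weighted_sum c v + weighted_sum d v)"
proof -
  define A where "A = {k. c k \<noteq> 0} \<union> {k. d k \<noteq> 0}"
  have A: "finite A" "{k. c k \<noteq> 0} \<subseteq> A" "{k. d k \<noteq> 0} \<subseteq> A" "{k. (c k + d k) / 2 \<noteq> 0} \<subseteq> A"
    using assms by (auto simp: A_def tail_weights_def)
  have "(\<Sum>k | (c k + d k) / 2 \<noteq> 0. (c k + d k) / 2) = (\<Sum>k\<in>A. (c k + d k) / 2)"
    by (rule sum.mono_neutral_left) (use A in auto)
  also have "\<dots> = ((\<Sum>k\<in>A. c k) + (\<Sum>k\<in>A. d k)) / 2"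
    by (simp add: sum_divide_distrib[symmetric] sum.distrib)
  also have "\<dots> = 1"
    using tail_weights_sum[OF assms(1) A(1,2)] tail_weights_sum[OF assms(2) A(1,3)] by simp
  finally show "(\<lambda>k. (c k + d k) / 2) \<in> tail_weights n"
    using assms finite_subset[OF A(4,1)] by (auto simp: tail_weights_def)
  show "weighted_sum (\<lambda>k. (c k + d k) / 2) v = (1/2) *\<^sub>R (weighted_sum c v + weighted_sum d v)"
    unfolding weighted_sum_eq[OF A(1,2)] weighted_sum_eq[OF A(1,3)] weighted_sum_eq[OF A(1,4)]
    by (simp add: sum.distrib[symmetric] scaleR_sum_right algebra_simps add_divide_distrib)
qed

lemma weighted_sum_in_convex:
  assumes c: "c \<in> tail_weights n" and "convex S" and "\<And>k. k \<ge> n \<Longrightarrow> v k \<in> S"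
  shows "weighted_sum c v \<in> S"
  unfolding weighted_sum_def
proof (rule convex_sum)
  fix k assume "k \<in> {k. c k \<noteq> 0}"
  then have "k \<ge> n" using c by (force simp: tail_weights_def not_less[symmetric])
  then show "v k \<in> S" using assms by blast
qed (use assms in \<open>auto simp: tail_weights_def\<close>)

lemma weighted_sum_norm_le:
  fixes v :: "nat \<Rightarrow> 'a::real_normed_vector"
  assumes "c \<in> tail_weights n" "\<And>k. norm (v k) \<le> b"
  shows "norm (weighted_sum c v) \<le> b"
  using weighted_sum_in_convex[OF assms(1) convex_cball[of 0 b], of v] assms(2) by auto

text \<open>From some index on, all \<open>v k\<close> lie in a ball around l. The ball is convex,
  and the j-th sum involves only indices from j on.\<close>

lemma tendsto_weighted_sum:
  fixes v :: "nat \<Rightarrow> 'a::real_normed_vector"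
  assumes c: "\<And>j. c j \<in> tail_weights j" and v: "v \<longlonglongrightarrow> l"
  shows "(\<lambda>j. weighted_sum (c j) v) \<longlonglongrightarrow> l"
proof (rule LIMSEQ_I)
  fix e :: real assume "e > 0"
  then obtain N where N: "\<And>k. k \<ge> N \<Longrightarrow> dist (v k) l < e" using v unfolding lim_sequentially by blast
  have "weighted_sum (c j) v \<in> ball l e" if "j \<ge> N" for j
    using that N by (intro weighted_sum_in_convex[OF c]) (auto simp: dist_commute)
  then show "\<exists>N. \<forall>j\<ge>N. norm (weighted_sum (c j) v - l) < e"
    by (auto simp: dist_norm norm_minus_commute)
qed

text \<open>The terms of a summable series tend to 0. As 4^k is the square of 2^k, the increments
  are eventually at most 2^-k, and the telescoping series converges absolutely.\<close>

lemma summable_if_weighted_squares_summable: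
  fixes v :: "nat \<Rightarrow> 'a::banach"
  assumes s: "summable (\<lambda>k. 4 ^ k * (norm (v (Suc k) - v k))\<^sup>2)"
  shows "convergent v"
proof -
  have "(\<lambda>k. 4 ^ k * (norm (v (Suc k) - v k))\<^sup>2) \<longlonglongrightarrow> 0" using s by (rule summable_LIMSEQ_zero)
  then have "\<forall>\<^sub>F k in sequentially. 4 ^ k * (norm (v (Suc k) - v k))\<^sup>2 < 1"
    by (rule order_tendstoD) simp
  then have ev: "\<forall>\<^sub>F k in sequentially. norm (norm (v (Suc k) - v k)) \<le> (1/2) ^ k"
  proof eventually_elim
    case (elim k)
    have "(2 ^ k * norm (v (Suc k) - v k))\<^sup>2 = 4 ^ k * (norm (v (Suc k) - v k))\<^sup>2"
      by (simp add: power2_eq_square flip: power_mult_distrib)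
    then have "(2 ^ k * norm (v (Suc k) - v k))\<^sup>2 < 1\<^sup>2" using elim by simp
    then have "2 ^ k * norm (v (Suc k) - v k) < 1" by (rule power2_less_imp_less) simp
    then show ?case by (simp add: power_one_over field_simps)
  qed
  have "summable (\<lambda>k. norm (v (Suc k) - v k))"
    by (rule summable_comparison_test_ev[OF ev]) simp
  then have "summable (\<lambda>k. v (Suc k) - v k)" by (rule summable_norm_cancel)
  then have "convergent (\<lambda>n. \<Sum>k<n. v (Suc k) - v k)" by (simp add: summable_iff_convergent)
  then have "convergent (\<lambda>n. v n - v 0)" by (simp add: sum_lessThan_telescope)
  then have "convergent (\<lambda>n. (v n - v 0) + v 0)" by (intro convergent_add convergent_const)
  then show ?thesis by simp
qed

text \<open>An elementary form of weak compactness together with Mazur's lemma. With the weight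
  \<open>1 / m\<close> the functions lie in a bounded set of an \<open>L\<^sup>2\<close> space; almost norm-minimal convex
  combinations of the tails form a Cauchy sequence there by the parallelogram law.\<close>

lemma AE_convergent_weighted_sums:
  fixes w :: "nat \<Rightarrow> 'b \<Rightarrow> 'a::euclidean_space"
  assumes w[measurable]: "\<And>n. w n \<in> borel_measurable M"
    and bd: "\<And>n s. s \<in> space M \<Longrightarrow> norm (w n s) \<le> m s"
    and m: "integrable M m"
  obtains c where "\<And>j. c j \<in> tail_weights j"
    "AE s in M. convergent (\<lambda>j. weighted_sum (c j) (\<lambda>k. w k s))"
proof -
  have [measurable]: "m \<in> borel_measurable M" using m by simp
  have m0: "0 \<le> m s" if "s \<in> space M" for s using bd[OF that, of 0] by (meson norm_ge_zero order_trans)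
  \<comment> \<open>The scaling turns |w| \<le> m into |v|^2 \<le> m, an integrable bound on the
    square. Where m = 0, both w and the quotient by 0 vanish, so w is still recovered from
    v.\<close>
  define v where "v k s = w k s /\<^sub>R sqrt (m s)" for k s
  have [measurable]: "v k \<in> borel_measurable M" for k unfolding v_def by measurable
  have wv: "w k s = sqrt (m s) *\<^sub>R v k s" if "s \<in> space M" for k s
    using bd[OF that, of k] by (cases "m s = 0") (auto simp: v_def)
  have vb: "norm (v k s) \<le> sqrt (m s)" if s: "s \<in> space M" for k s
  proof (cases "m s = 0")
    case False
    then have "norm (w k s) / sqrt (m s) \<le> m s / sqrt (m s)"
      using bd[OF s] m0[OF s] by (intro divide_right_mono) auto
    moreover have "norm (v k s) = norm (w k s) / sqrt (m s)"
      using m0[OF s] by (simp add: v_def divide_inverse mult.commute)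
    ultimately show ?thesis using real_div_sqrt[OF m0[OF s]] by linarith
  qed (simp add: v_def)
  define U where "U c s = weighted_sum c (\<lambda>k. v k s)" for c s
  have U[measurable]: "U c \<in> borel_measurable M" for c
    unfolding U_def weighted_sum_def by measurable
  have Ub: "(norm (U c s))\<^sup>2 \<le> m s" if "c \<in> tail_weights n" "s \<in> space M" for c n s
  proof -
    have "norm (U c s) \<le> sqrt (m s)" unfolding U_def using vb that by (intro weighted_sum_norm_le) auto
    then have "(norm (U c s))\<^sup>2 \<le> (sqrt (m s))\<^sup>2" by (rule power_mono) simp
    then show ?thesis using m0 that by simp
  qed
  have Ui: "integrable M (\<lambda>s. (norm (U c s))\<^sup>2)" if "c \<in> tail_weights n" for c n
    by (rule Bochner_Integration.integrable_bound[OF m])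
      (use Ub[OF that] m0 in \<open>auto intro!: AE_I2\<close>)
  define J where "J c = (\<integral>s. (norm (U c s))\<^sup>2 \<partial>M)" for c
  have J0: "0 \<le> J c" for c by (simp add: J_def)
  have Jm: "J c \<le> (\<integral>s. m s \<partial>M)" if "c \<in> tail_weights n" for c n
    unfolding J_def using Ub[OF that] Ui[OF that] m by (intro integral_mono) auto
  \<comment> \<open>Infima over shrinking tails increase, and they are bounded by the integral of m.
    The differences to their limit D measure how far the almost minimal combinations are from each
    other.\<close>
  define d where "d n = Inf (J ` tail_weights n)" for n
  have ne: "J ` tail_weights n \<noteq> {}" for n using tail_weights_unit by blast
  have bdd: "bdd_below (J ` tail_weights n)" for n by (rule bdd_belowI[of _ 0]) (use J0 in auto)
  have dJ: "d n \<le> J c" if "c \<in> tail_weights n" for c n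
    unfolding d_def using that bdd by (intro cInf_lower) auto
  have "incseq d"
    unfolding d_def by (intro incseq_SucI cInf_superset_mono ne bdd image_mono tail_weights_mono) simp
  moreover have "d n \<le> (\<integral>s. m s \<partial>M)" for n
    using dJ[OF tail_weights_unit] Jm[OF tail_weights_unit] by (rule order_trans)
  ultimately obtain D where "d \<longlonglongrightarrow> D" and dD: "\<And>n. d n \<le> D"
    using incseq_convergent[of d] by blast
  have "\<exists>c\<in>tail_weights n. J c < d n + 1 / (real n + 1)" for n
  proof -
    have "Inf (J ` tail_weights n) < d n + 1 / (real n + 1)" by (simp add: d_def)
    then show ?thesis using cInf_less_iff[OF ne bdd] by auto
  qed
  then obtain c where c: "\<And>n. c n \<in> tail_weights n" and cJ: "\<And>n. J (c n) < d n + 1 / (real n + 1)"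
    by metis
  have diff: "(\<integral>s. (norm (U (c i) s - U (c j) s))\<^sup>2 \<partial>M) \<le> 2 * (D - d i) + 4 / (real i + 1)" and
    diff_int: "integrable M (\<lambda>s. (norm (U (c i) s - U (c j) s))\<^sup>2)" if "i \<le> j" for i j
  proof -
    have cj: "c j \<in> tail_weights i" using c tail_weights_mono[OF that] by blast
    define e where "e = (\<lambda>k. (c i k + c j k) / 2)"
    have e: "e \<in> tail_weights i" and Ue: "U e s = (1/2) *\<^sub>R (U (c i) s + U (c j) s)" for s
      unfolding U_def e_def by (rule tail_weights_midpoint[OF c cj])+
    \<comment> \<open>Parallelogram identity. The midpoint e belongs to the i-th tail, so
      \<open>J e\<close> is at least \<open>d i\<close>; this leaves 2 (D - d i) plus the two
      minimisation errors, together at most 4 / (i + 1).\<close>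
    have par: "(norm (U (c i) s - U (c j) s))\<^sup>2 =
        2 * (norm (U (c i) s))\<^sup>2 + 2 * (norm (U (c j) s))\<^sup>2 - 4 * (norm (U e s))\<^sup>2" for s
      unfolding Ue by (simp add: power2_norm_eq_inner algebra_simps inner_commute)
    show "integrable M (\<lambda>s. (norm (U (c i) s - U (c j) s))\<^sup>2)"
      unfolding par using Ui[OF c] Ui[OF e] by auto
    have "(\<integral>s. (norm (U (c i) s - U (c j) s))\<^sup>2 \<partial>M) = 2 * J (c i) + 2 * J (c j) - 4 * J e"
      unfolding par J_def using Ui[OF c] Ui[OF e] by simp
    moreover have "1 / (real j + 1) \<le> 1 / (real i + 1)" using that by (simp add: field_simps)
    ultimately show "(\<integral>s. (norm (U (c i) s - U (c j) s))\<^sup>2 \<partial>M) \<le> 2 * (D - d i) + 4 / (real i + 1)"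
      using cJ[of i] cJ[of j] dJ[OF e] dD[of j] by simp
  qed
  have "(\<lambda>i. 2 * (D - d i) + 4 / (real i + 1)) \<longlonglongrightarrow> 2 * (D - D) + 0"
    by (intro tendsto_intros \<open>d \<longlonglongrightarrow> D\<close>) real_asymp
  then have lim0: "(\<lambda>i. 2 * (D - d i) + 4 / (real i + 1)) \<longlonglongrightarrow> 0" by simp
  \<comment> \<open>The bound 16^-k leaves a summable 4^-k after multiplication by the weight 4^k of
    \<open>summable_if_weighted_squares_summable\<close>.\<close>
  have "\<exists>N. \<forall>i\<ge>N. 2 * (D - d i) + 4 / (real i + 1) < (1/16) ^ k" for k
    using order_tendstoD(2)[OF lim0, of "(1/16) ^ k"] by (simp add: eventually_sequentially)
  then obtain N where N: "\<And>k i. i \<ge> N k \<Longrightarrow> 2 * (D - d i) + 4 / (real i + 1) < (1/16) ^ k" by metis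
  \<comment> \<open>The partial sums make \<open>\<sigma>\<close> nondecreasing with
    \<open>\<sigma> k\<close> at least \<open>N k\<close>; the summand k puts the k-th weights into
    the k-th tail.\<close>
  define \<sigma> where "\<sigma> k = k + (\<Sum>i\<le>k. N i)" for k
  have \<sigma>: "k \<le> \<sigma> k" "N k \<le> \<sigma> k" "\<sigma> k \<le> \<sigma> (Suc k)" for k
    using member_le_sum[of k "{..k}" N] by (auto simp: \<sigma>_def)
  define g where "g k s = 4 ^ k * (norm (U (c (\<sigma> (Suc k))) s - U (c (\<sigma> k)) s))\<^sup>2" for k s
  have [measurable]: "g k \<in> borel_measurable M" for k unfolding g_def by measurable
  have g0: "0 \<le> g k s" for k s by (simp add: g_def)
  have gi: "integrable M (g k)" and gI: "(\<integral>s. g k s \<partial>M) \<le> (1/4) ^ k" for k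
  proof -
    have eq: "g k = (\<lambda>s. 4 ^ k * (norm (U (c (\<sigma> k)) s - U (c (\<sigma> (Suc k))) s))\<^sup>2)"
      by (auto simp: g_def norm_minus_commute)
    show "integrable M (g k)" unfolding eq using diff_int[OF \<sigma>(3)] by simp
    have "(\<integral>s. g k s \<partial>M) = 4 ^ k * (\<integral>s. (norm (U (c (\<sigma> k)) s - U (c (\<sigma> (Suc k))) s))\<^sup>2 \<partial>M)"
      unfolding eq by simp
    also have "\<dots> \<le> 4 ^ k * (1/16) ^ k"
      using diff[OF \<sigma>(3)[of k]] N[OF \<sigma>(2)[of k]] by (intro mult_left_mono) auto
    also have "\<dots> = (4 * (1/16)) ^ k" by (simp only: power_mult_distrib)
    finally show "(\<integral>s. g k s \<partial>M) \<le> (1/4) ^ k" by simp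
  qed
  have "(\<integral>\<^sup>+s. (\<Sum>k. ennreal (g k s)) \<partial>M) = (\<Sum>k. \<integral>\<^sup>+s. ennreal (g k s) \<partial>M)"
    by (rule nn_integral_suminf) measurable
  also have "\<dots> = (\<Sum>k. ennreal (\<integral>s. g k s \<partial>M))"
    using gi g0 by (simp add: nn_integral_eq_integral)
  also have "\<dots> \<le> (\<Sum>k. ennreal ((1/4) ^ k))"
    using gI by (intro suminf_le ennreal_leI) auto
  also have "\<dots> = ennreal (\<Sum>k. (1/4) ^ k)"
    by (rule suminf_ennreal2) (auto intro!: summable_geometric)
  also have "\<dots> < \<infinity>" by simp
  finally have "AE s in M. (\<Sum>k. ennreal (g k s)) \<noteq> \<infinity>"
    by (intro nn_integral_PInf_AE) auto
  then have "AE s in M. convergent (\<lambda>j. weighted_sum (c (\<sigma> j)) (\<lambda>k. w k s))"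
  proof (rule AE_mp, intro AE_I2 impI)
    fix s assume s: "s \<in> space M" and "(\<Sum>k. ennreal (g k s)) \<noteq> \<infinity>"
    then have "summable (\<lambda>k. g k s)" using g0 by (intro summable_suminf_not_top) auto
    then have "convergent (\<lambda>j. U (c (\<sigma> j)) s)"
      unfolding g_def by (rule summable_if_weighted_squares_summable)
    then have "convergent (\<lambda>j. sqrt (m s) *\<^sub>R U (c (\<sigma> j)) s)"
      by (auto simp: convergent_def intro: tendsto_scaleR[OF tendsto_const])
    moreover have "sqrt (m s) *\<^sub>R U (c (\<sigma> j)) s = weighted_sum (c (\<sigma> j)) (\<lambda>k. w k s)" for j
      unfolding U_def weighted_sum_def wv[OF s] by (simp add: scaleR_sum_right mult.commute)
    ultimately show "convergent (\<lambda>j. weighted_sum (c (\<sigma> j)) (\<lambda>k. w k s))" by simp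
  qed
  moreover have "c (\<sigma> j) \<in> tail_weights j" for j using c tail_weights_mono[OF \<sigma>(1)] by blast
  ultimately show ?thesis using that[of "\<lambda>j. c (\<sigma> j)"] by blast
qed


section \<open>Trajectories with a common integrable majorant: compactness and closure\<close>

definition dominated_primitive ::
    "real \<Rightarrow> (real \<Rightarrow> real) \<Rightarrow> (real \<Rightarrow> 'a::euclidean_space) \<Rightarrow> (real \<Rightarrow> 'a) \<Rightarrow> bool" where
  "dominated_primitive T m x w \<longleftrightarrow>
     w \<in> borel_measurable (lebesgue_on {0..T}) \<and> (\<forall>s\<in>{0..T}. norm (w s) \<le> m s) \<and>
     (\<forall>t\<in>{0..T}. x t = x 0 + integral {0..t} w)"

lemma dominated_primitiveD:
  assumes "dominated_primitive T m x w"
  shows "w \<in> borel_measurable (lebesgue_on {0..T})" "s \<in> {0..T} \<Longrightarrow> norm (w s) \<le> m s"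
    "t \<in> {0..T} \<Longrightarrow> x t = x 0 + integral {0..t} w"
  using assms unfolding dominated_primitive_def by blast+

lemma dominated_absolutely_integrable:
  fixes w :: "real \<Rightarrow> 'a::euclidean_space"
  assumes "w \<in> borel_measurable (lebesgue_on {0..T})" "\<And>s. s \<in> {0..T} \<Longrightarrow> norm (w s) \<le> m s"
    "m integrable_on {0..T}"
  shows "w absolutely_integrable_on {0..T}"
  by (rule measurable_bounded_by_integrable_imp_absolutely_integrable[OF assms(1) _ assms(3)])
    (use assms(2) in auto)

lemma dominated_primitive_integrable:
  assumes "dominated_primitive T m x w" "m integrable_on {0..T}"
  shows "w absolutely_integrable_on {0..T}"
  using assms by (intro dominated_absolutely_integrable[of _ _ m]) (auto intro: dominated_primitiveD)

lemma dominated_primitive_continuous: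
  assumes "dominated_primitive T m x w" "m integrable_on {0..T}"
  shows "continuous_on {0..T} x"
proof -
  have "continuous_on {0..T} (\<lambda>t. x 0 + integral {0..t} w)"
    using dominated_primitive_integrable[OF assms]
    by (intro continuous_intros indefinite_integral_continuous_1) (simp add: absolutely_integrable_on_def)
  then show ?thesis
    by (rule continuous_on_eq) (rule dominated_primitiveD(3)[OF assms(1), symmetric])
qed

text \<open>The bound is the increment of the primitive of m, the same for every trajectory. This is
  the equicontinuity behind \<open>dominated_primitive_compact\<close>.\<close>

lemma dominated_primitive_increment:
  assumes x: "dominated_primitive T m x w" and m: "m integrable_on {0..T}"
    and st: "0 \<le> s" "s \<le> t" "t \<le> T"
  shows "norm (x t - x s) \<le> integral {0..t} m - integral {0..s} m"
proof -
  have w: "w integrable_on {0..T}" 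
    using dominated_primitive_integrable[OF x m] by (simp add: absolutely_integrable_on_def)
  have i: "w integrable_on {p..q}" "m integrable_on {p..q}" if "0 \<le> p" "q \<le> T" for p q
    using integrable_subinterval_real[OF w, of p q] integrable_subinterval_real[OF m, of p q] that by auto
  have "integral {0..s} w + integral {s..t} w = integral {0..t} w"
    "integral {0..s} m + integral {s..t} m = integral {0..t} m"
    using st by (auto intro!: Henstock_Kurzweil_Integration.integral_combine i)
  moreover have "x t = x 0 + integral {0..t} w" "x s = x 0 + integral {0..s} w"
    by (rule dominated_primitiveD(3)[OF x]; use st in simp)+
  ultimately have "x t - x s = integral {s..t} w" "integral {0..t} m - integral {0..s} m = integral {s..t} m"
    by (auto simp: algebra_simps)
  moreover have "norm (integral {s..t} w) \<le> integral {s..t} m"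
    using x st by (intro integral_norm_bound_integral i) (auto intro: dominated_primitiveD)
  ultimately show ?thesis by simp
qed

lemma dominated_primitive_compact:
  fixes x :: "nat \<Rightarrow> real \<Rightarrow> 'a::euclidean_space"
  assumes x: "\<And>n. dominated_primitive T m (x n) (w n)" and m: "m integrable_on {0..T}"
    and "T \<ge> 0" and bd: "\<And>n. norm (x n 0) \<le> \<rho>"
  obtains r x' where "strict_mono (r :: nat \<Rightarrow> nat)" "uniform_limit {0..T} (\<lambda>j. x (r j)) x' sequentially"
proof -
  define M where "M t = integral {0..t} m" for t
  have incr: "norm (x n t - x n s) \<le> \<bar>M t - M s\<bar>" if "s \<in> {0..T}" "t \<in> {0..T}" for n s t
    using dominated_primitive_increment[OF x m, of s t n] dominated_primitive_increment[OF x m, of t s n] that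
    by (cases "s \<le> t") (auto simp: M_def norm_minus_commute)
  have M: "continuous_on {0..T} M" unfolding M_def by (rule indefinite_integral_continuous_1[OF m])
  then have "bounded (M ` {0..T})" by (intro compact_imp_bounded compact_continuous_image) auto
  then obtain B where B: "\<And>t. t \<in> {0..T} \<Longrightarrow> \<bar>M t\<bar> \<le> B" unfolding bounded_iff real_norm_def by blast
  have M0: "M 0 = 0" by (simp add: M_def)
  obtain x' r where "strict_mono (r :: nat \<Rightarrow> nat)"
    and r: "\<And>e. 0 < e \<Longrightarrow> \<exists>N. \<forall>n t. n \<ge> N \<and> t \<in> {0..T} \<longrightarrow> norm (x (r n) t - x' t) < e"
  proof (rule Arzela_Ascoli[of "{0..T}" x "\<rho> + B"])
    show "norm (x n t) \<le> \<rho> + B" if "t \<in> {0..T}" for n t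
    proof -
      have "norm (x n t) \<le> norm (x n 0) + norm (x n t - x n 0)" by norm
      also have "norm (x n t - x n 0) \<le> \<bar>M t - M 0\<bar>" using that \<open>T \<ge> 0\<close> by (intro incr) auto
      finally show ?thesis using bd[of n] B[OF that] M0 by simp
    qed
    show "\<exists>d>0. \<forall>n t. t \<in> {0..T} \<and> norm (s - t) < d \<longrightarrow> norm (x n s - x n t) < e"
      if se: "s \<in> {0..T}" "0 < e" for s e
    proof -
      obtain d where d: "d > 0" "\<And>t. t \<in> {0..T} \<Longrightarrow> dist t s < d \<Longrightarrow> dist (M t) (M s) < e"
        using M[unfolded continuous_on_iff, rule_format, OF se] by blast
      have "norm (x n s - x n t) < e" if "t \<in> {0..T}" "norm (s - t) < d" for n t
      proof -
        have "norm (x n s - x n t) \<le> dist (M t) (M s)"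
          using incr[OF that(1) \<open>s \<in> {0..T}\<close>, of n] by (simp add: dist_real_def abs_minus_commute)
        also have "\<dots> < e" using d(2)[OF that(1)] that(2) by (simp add: dist_norm norm_minus_commute)
        finally show ?thesis .
      qed
      then show ?thesis using \<open>d > 0\<close> by blast
    qed
  qed auto
  have "uniform_limit {0..T} (\<lambda>j. x (r j)) x' sequentially"
    unfolding uniform_limit_sequentially_iff dist_norm using r by blast
  with \<open>strict_mono r\<close> that show ?thesis by blast
qed

text \<open>The strict inequality makes the neighbourhood open, so that it can serve as a test set
  in \<open>upper_semicontinuous\<close>.\<close>

definition thicken :: "real \<Rightarrow> 'a::metric_space set \<Rightarrow> 'a set" where
  "thicken e K = {y. \<exists>z\<in>K. dist y z < e}"

text \<open>The neighbourhood is the Minkowski sum of K and a ball around 0.\<close>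

lemma convex_thicken:
  fixes K :: "'a::real_normed_vector set"
  assumes "convex K"
  shows "convex (thicken e K)"
proof -
  have "thicken e K = (\<Union>x\<in>K. \<Union>y\<in>ball 0 e. {x + y})"
  proof (intro set_eqI iffI)
    fix y assume "y \<in> thicken e K"
    then obtain z where "z \<in> K" "dist y z < e" by (auto simp: thicken_def)
    then have "y - z \<in> ball 0 e" "y = z + (y - z)" by (auto simp: dist_norm norm_minus_commute)
    with \<open>z \<in> K\<close> show "y \<in> (\<Union>x\<in>K. \<Union>y\<in>ball 0 e. {x + y})" by blast
  next
    fix y assume "y \<in> (\<Union>x\<in>K. \<Union>y\<in>ball 0 e. {x + y})"
    then obtain z b where "z \<in> K" "norm b < e" "y = z + b" by auto
    then show "y \<in> thicken e K" unfolding thicken_def by (auto simp: dist_norm intro!: bexI[of _ z])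
  qed
  then show ?thesis using convex_sums[OF assms convex_ball] by simp
qed

lemma mem_closed_if_in_thicken:
  assumes "closed K" "\<And>e. e > 0 \<Longrightarrow> y \<in> thicken e K"
  shows "y \<in> K"
proof -
  have "y \<in> closure K"
    unfolding closure_approachable using assms(2) by (auto simp: thicken_def dist_commute)
  then show ?thesis using assms(1) by simp
qed

text \<open>The velocities need not converge, but convex combinations of their tails do, almost
  everywhere. The same combinations of the trajectories still tend to x', since the weights move off
  to infinity, so the limit of the combined velocities is a velocity of x'. It lies in
  \<open>K s\<close> because the neighbourhoods of \<open>K s\<close> are convex and
  \<open>K s\<close> is closed.\<close>

lemma dominated_primitive_limit:
  fixes x :: "nat \<Rightarrow> real \<Rightarrow> 'a::euclidean_space"
  assumes x: "\<And>n. dominated_primitive T m (x n) (w n)" and m: "integrable (lebesgue_on {0..T}) m"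
    and "T \<ge> 0" and lim: "\<And>t. t \<in> {0..T} \<Longrightarrow> (\<lambda>n. x n t) \<longlonglongrightarrow> x' t"
    and K: "\<And>s. s \<in> {0..T} \<Longrightarrow> closed (K s)" "\<And>s. s \<in> {0..T} \<Longrightarrow> convex (K s)"
    and wK: "AE s in lebesgue_on {0..T}. \<forall>e>0. \<forall>\<^sub>F n in sequentially. w n s \<in> thicken e (K s)"
  obtains w' where "dominated_primitive T m x' w'" "AE s in lebesgue_on {0..T}. w' s \<in> K s"
proof -
  have mi: "m integrable_on {0..T}" using m by (simp add: integrable_on_lebesgue_on)
  have wm[measurable]: "w n \<in> borel_measurable (lebesgue_on {0..T})" and
    wb: "s \<in> {0..T} \<Longrightarrow> norm (w n s) \<le> m s" for n s
    by (rule dominated_primitiveD[OF x]; assumption)+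
  have [measurable]: "m \<in> borel_measurable (lebesgue_on {0..T})" using m by simp
  obtain c where c: "\<And>j. c j \<in> tail_weights j"
    and conv: "AE s in lebesgue_on {0..T}. convergent (\<lambda>j. weighted_sum (c j) (\<lambda>k. w k s))"
    using AE_convergent_weighted_sums[of w "lebesgue_on {0..T}" m] wb m by auto
  define u where "u j s = weighted_sum (c j) (\<lambda>k. w k s)" for j s
  have um[measurable]: "u j \<in> borel_measurable (lebesgue_on {0..T})" for j
    unfolding u_def weighted_sum_def by measurable
  have ub: "norm (u j s) \<le> m s" if "s \<in> {0..T}" for j s
    unfolding u_def using that wb by (intro weighted_sum_norm_le[OF c]) auto
  \<comment> \<open>\<open>lim\<close> is arbitrary where the sequence diverges. The truncation
    makes the bound by m hold at every point of {0..T}, as \<open>dominated_primitive\<close> asks,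
    and keeps \<open>w'\<close> measurable.\<close>
  define w' where "w' s = (if norm (lim (\<lambda>j. u j s)) \<le> m s then lim (\<lambda>j. u j s) else 0)" for s
  have w'm: "w' \<in> borel_measurable (lebesgue_on {0..T})" unfolding w'_def by measurable
  have w'b: "norm (w' s) \<le> m s" if "s \<in> {0..T}" for s
    using wb[OF that, of 0] norm_ge_zero[of "w 0 s"] by (simp add: w'_def del: norm_ge_zero)
  have uw': "(\<lambda>j. u j s) \<longlonglongrightarrow> w' s" if "s \<in> {0..T}" "convergent (\<lambda>j. u j s)" for s
  proof -
    have l: "(\<lambda>j. u j s) \<longlonglongrightarrow> lim (\<lambda>j. u j s)" using that by (simp add: convergent_LIMSEQ_iff)
    then have "norm (lim (\<lambda>j. u j s)) \<le> m s"
      by (rule tendsto_upperbound[OF tendsto_norm]) (use ub that in auto)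
    then show ?thesis using l by (simp add: w'_def)
  qed
  define N where "N = {s \<in> {0..T}. \<not> convergent (\<lambda>j. u j s)}"
  have N: "negligible N" using conv by (simp add: N_def u_def AE_lebesgue_on_iff_negligible)
  have wi: "w n integrable_on {0..t}" if "t \<in> {0..T}" for n t
    using dominated_primitive_integrable[OF x mi, of n] integrable_subinterval_real[of "w n" 0 T 0 t] that
    by (auto simp: absolutely_integrable_on_def)
  have repr: "x' t = x' 0 + integral {0..t} w'" if t: "t \<in> {0..T}" for t
  proof -
    have mt: "m integrable_on {0..t}" using integrable_subinterval_real[OF mi, of 0 t] t by auto
    \<comment> \<open>Zero on N, so that convergence holds at every point, as
      \<open>dominated_convergence\<close> requires.\<close>
    define v where "v j s = (if s \<in> N then 0 else u j s)" for j s
    have ui: "u j integrable_on {0..t}" and uI: "integral {0..t} (u j) = weighted_sum (c j) (\<lambda>k. integral {0..t} (w k))" for j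
    proof -
      have fin: "finite {k. c j k \<noteq> 0}" using c by (auto simp: tail_weights_def)
      show "u j integrable_on {0..t}"
        unfolding u_def weighted_sum_def using fin wi[OF t] by (intro integrable_sum integrable_cmul) auto
      show "integral {0..t} (u j) = weighted_sum (c j) (\<lambda>k. integral {0..t} (w k))"
        unfolding u_def weighted_sum_def using fin wi[OF t]
        by (subst integral_sum) (auto intro!: integrable_cmul)
    qed
    have "(\<lambda>j. integral {0..t} (v j)) \<longlonglongrightarrow> integral {0..t} (\<lambda>s. if s \<in> N then 0 else w' s)"
    proof (rule dominated_convergence(2)[OF _ mt])
      show "v j integrable_on {0..t}" for j
        by (rule integrable_spike[OF ui N]) (simp add: v_def)
      fix s assume s: "s \<in> {0..t}"
      show "norm (v j s) \<le> m s" for j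
        using ub[of s j] s t norm_ge_zero[of "u j s"] by (auto simp: v_def simp del: norm_ge_zero)
      show "(\<lambda>j. v j s) \<longlonglongrightarrow> (if s \<in> N then 0 else w' s)"
        using uw'[of s] s t by (auto simp: v_def N_def)
    qed
    also have "integral {0..t} (\<lambda>s. if s \<in> N then 0 else w' s) = integral {0..t} w'"
      by (rule integral_spike[OF N]) simp
    also have "(\<lambda>j. integral {0..t} (v j)) = (\<lambda>j. integral {0..t} (u j))"
      by (intro ext integral_spike[OF N]) (simp add: v_def)
    finally have "(\<lambda>j. weighted_sum (c j) (\<lambda>k. integral {0..t} (w k))) \<longlonglongrightarrow> integral {0..t} w'"
      unfolding uI .
    moreover have "(\<lambda>k. integral {0..t} (w k)) = (\<lambda>k. x k t - x k 0)"
      by (intro ext) (simp add: dominated_primitiveD(3)[OF x t])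
    ultimately have "(\<lambda>j. weighted_sum (c j) (\<lambda>k. x k t - x k 0)) \<longlonglongrightarrow> integral {0..t} w'"
      by simp
    moreover have "(\<lambda>j. weighted_sum (c j) (\<lambda>k. x k t - x k 0)) \<longlonglongrightarrow> x' t - x' 0"
      using lim[OF t] lim[of 0] \<open>T \<ge> 0\<close> by (intro tendsto_weighted_sum[OF c] tendsto_diff) auto
    ultimately have "integral {0..t} w' = x' t - x' 0" by (rule LIMSEQ_unique)
    then show ?thesis by simp
  qed
  have "AE s in lebesgue_on {0..T}. w' s \<in> K s"
    using conv wK AE_space
  proof eventually_elim
    case (elim s)
    then have s: "s \<in> {0..T}" by simp
    have lim: "(\<lambda>j. u j s) \<longlonglongrightarrow> w' s" using elim s by (intro uw') (auto simp: u_def)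
    show "w' s \<in> K s"
    proof (rule mem_closed_if_in_thicken[OF K(1)[OF s]])
      fix e :: real assume "e > 0"
      then have e: "e / 2 > 0" by simp
      obtain n0 where n0: "\<And>n. n \<ge> n0 \<Longrightarrow> w n s \<in> thicken (e / 2) (K s)"
        using elim(2) e unfolding eventually_sequentially by blast
      obtain j0 where j0: "\<And>j. j \<ge> j0 \<Longrightarrow> dist (u j s) (w' s) < e / 2"
        using lim e unfolding lim_sequentially by blast
      have "u (max n0 j0) s \<in> thicken (e / 2) (K s)"
        unfolding u_def by (rule weighted_sum_in_convex[OF c convex_thicken[OF K(2)[OF s]]]) (use n0 in auto)
      then obtain z where "z \<in> K s" "dist (u (max n0 j0) s) z < e / 2" by (auto simp: thicken_def)
      moreover have "dist (w' s) z \<le> dist (u (max n0 j0) s) (w' s) + dist (u (max n0 j0) s) z"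
        by (metis dist_commute dist_triangle)
      ultimately show "w' s \<in> thicken e (K s)"
        using j0[of "max n0 j0"] by (auto simp: thicken_def intro!: bexI[of _ z])
    qed
  qed
  with w'm w'b repr that[of w'] show ?thesis unfolding dominated_primitive_def by blast
qed

subsection \<open>Approximation of differential inclusions\<close>

text \<open>The retraction onto a closed ball; the maximum gives it by one formula whose continuity
  is immediate.\<close>

definition radial_proj :: "real \<Rightarrow> 'a::real_normed_vector \<Rightarrow> 'a" where
  "radial_proj \<rho> x = (\<rho> / max \<rho> (norm x)) *\<^sub>R x"

lemma radial_proj_id: "0 < \<rho> \<Longrightarrow> norm x \<le> \<rho> \<Longrightarrow> radial_proj \<rho> x = x"
  by (simp add: radial_proj_def)

lemma norm_radial_proj: "0 < \<rho> \<Longrightarrow> norm (radial_proj \<rho> x) = min \<rho> (norm x)"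
  by (simp add: radial_proj_def max_def min_def)

lemma continuous_on_radial_proj: "0 < \<rho> \<Longrightarrow> continuous_on S (radial_proj \<rho>)"
  unfolding radial_proj_def by (intro continuous_intros) auto

text \<open>Let B be the compact set of pairs (l, z) with h l z = z. Its projection to z avoids the
  sphere, so a Urysohn function u is 0 on the sphere and 1 on that projection. Brouwer's theorem
  gives a fixed point z of the map z \<mapsto> \<open>radial_proj \<rho> (h (u z) z)\<close>. Once
  the projection is seen to act trivially there, (u z, z) lies in B, whence u z = 1.\<close>

lemma fixed_point_by_homotopy:
  fixes h :: "real \<Rightarrow> 'a::euclidean_space \<Rightarrow> 'a"
  assumes "\<rho> > 0" and cont: "continuous_on ({0..1} \<times> cball 0 \<rho>) (\<lambda>p. h (fst p) (snd p))"
    and rothe: "\<And>z. norm z = \<rho> \<Longrightarrow> norm (h 0 z) \<le> \<rho>"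
    and nofix: "\<And>l z. l \<in> {0..1} \<Longrightarrow> norm z = \<rho> \<Longrightarrow> h l z \<noteq> z"
  obtains z where "norm z \<le> \<rho>" "h 1 z = z"
proof -
  define B where "B = ({0..1::real} \<times> cball (0::'a) \<rho>) \<inter> (\<lambda>p. h (fst p) (snd p) - snd p) -` {0}"
  have "closed B" unfolding B_def
    by (intro continuous_closed_preimage continuous_intros cont closed_Times) auto
  moreover have "bounded B" unfolding B_def by (intro bounded_Int) (auto intro!: bounded_Times)
  ultimately have "compact B" by (simp add: compact_eq_bounded_closed)
  then have clA: "closed (snd ` B)" by (intro compact_imp_closed compact_continuous_image continuous_intros)
  obtain u :: "'a \<Rightarrow> real" where u: "continuous_on UNIV u" "\<And>z. u z \<in> closed_segment 0 1"
    and u0: "\<And>z. z \<in> sphere 0 \<rho> \<Longrightarrow> u z = 0" and u1: "\<And>z. z \<in> snd ` B \<Longrightarrow> u z = 1"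
  proof (rule Urysohn[of "sphere (0::'a) \<rho>" "snd ` B" 0 "1::real"])
    show "sphere 0 \<rho> \<inter> snd ` B = {}" using nofix by (auto simp: B_def)
  qed (use clA in auto)
  have u01: "u z \<in> {0..1}" for z using u(2)[of z] by (simp add: closed_segment_eq_real_ivl)
  define k where "k z = radial_proj \<rho> (h (u z) z)" for z
  have "continuous_on (cball 0 \<rho>) (\<lambda>z. h (u z) z)"
    using continuous_on_compose2[OF cont, of "cball 0 \<rho>" "\<lambda>z. (u z, z)"] u01
      continuous_on_subset[OF u(1)] by (fastforce intro!: continuous_intros)
  then have "continuous_on (cball 0 \<rho>) k"
    unfolding k_def using continuous_on_compose2[OF continuous_on_radial_proj[OF \<open>\<rho> > 0\<close>, of UNIV]] by auto
  moreover have "k \<in> cball 0 \<rho> \<rightarrow> cball 0 \<rho>"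
    using \<open>\<rho> > 0\<close> by (auto simp: k_def norm_radial_proj)
  ultimately obtain z where z: "norm z \<le> \<rho>" "k z = z"
    using brouwer_ball[OF \<open>\<rho> > 0\<close>, of 0 k] by auto
  \<comment> \<open>If the projection moved this point, z would lie on the sphere, where u z = 0 and
    \<open>h 0\<close> maps into the ball.\<close>
  have "norm (h (u z) z) \<le> \<rho>"
  proof (rule ccontr)
    assume *: "\<not> norm (h (u z) z) \<le> \<rho>"
    then have "norm z = \<rho>" using z(2) norm_radial_proj[OF \<open>\<rho> > 0\<close>, of "h (u z) z"] by (simp add: k_def)
    then show False using * rothe[of z] u0[of z] by simp
  qed
  then have "h (u z) z = z" using z(2) \<open>\<rho> > 0\<close> by (simp add: k_def radial_proj_id)
  moreover from this have "(u z, z) \<in> B" using z(1) u01 by (auto simp: B_def)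
  then have "u z = 1" by (metis u1 image_eqI snd_conv)
  ultimately show ?thesis using that z(1) by simp
qed

section \<open>Measurable near-selections and continuous approximations\<close>

lemma approximate_measurable_selection:
  fixes \<Phi> :: "real \<Rightarrow> 'a::euclidean_space set"
  assumes S: "S \<in> sets lebesgue" and hit: "\<And>C. closed C \<Longrightarrow> {t \<in> S. \<Phi> t \<inter> C \<noteq> {}} \<in> sets lebesgue"
    and ne: "\<And>t. t \<in> S \<Longrightarrow> \<Phi> t \<noteq> {}" and "\<eta> > 0"
  obtains v where "v \<in> borel_measurable (lebesgue_on S)" "\<And>t. t \<in> S \<Longrightarrow> v t \<in> thicken \<eta> (\<Phi> t)"
proof -
  obtain D :: "'a set" where D: "countable D" "\<And>X. open X \<Longrightarrow> X \<noteq> {} \<Longrightarrow> \<exists>d\<in>D. d \<in> X"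
    by (rule countable_dense_setE) auto
  have "D \<noteq> {}" using D(2)[of UNIV] by auto
  define q where "q = from_nat_into D"
  \<comment> \<open>The selection takes the first point of a countable dense set whose ball meets
    \<open>\<Phi> t\<close>. The balls are closed because measurability is given for closed test
    sets, and the radius \<eta>/2 keeps the distance strictly below \<eta>.\<close>
  define P where "P k t \<longleftrightarrow> \<Phi> t \<inter> cball (q k) (\<eta> / 2) \<noteq> {}" for k t
  have [measurable]: "Measurable.pred (lebesgue_on S) (P k)" for k
    unfolding pred_def P_def using hit[of "cball (q k) (\<eta> / 2)"] S
    by (simp add: sets_restrict_space_iff)
  have "(\<lambda>t. q (LEAST k. P k t)) \<in> borel_measurable (lebesgue_on S)"
    by (rule measurable_compose[of _ _ "count_space UNIV"]) measurable
  moreover have "q (LEAST k. P k t) \<in> thicken \<eta> (\<Phi> t)" if "t \<in> S" for t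
  proof -
    obtain y where y: "y \<in> \<Phi> t" using ne[OF \<open>t \<in> S\<close>] by blast
    obtain d where "d \<in> D" "d \<in> ball y (\<eta> / 2)" using D(2)[of "ball y (\<eta> / 2)"] \<open>\<eta> > 0\<close> by auto
    then obtain k where "dist y (q k) < \<eta> / 2"
      using from_nat_into_surj[OF D(1)] by (auto simp: q_def)
    then have "P k t" using y by (auto simp: P_def dist_commute)
    then have "P (LEAST k. P k t) t" by (rule LeastI)
    then show ?thesis using \<open>\<eta> > 0\<close> by (force simp: P_def thicken_def)
  qed
  ultimately show ?thesis using that[of "\<lambda>t. q (LEAST k. P k t)"] by blast
qed

lemma thicken_norm_le:
  assumes "y \<in> thicken e K" "\<And>z. z \<in> K \<Longrightarrow> norm z \<le> b"
  shows "norm y \<le> b + e"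
proof -
  obtain z where "z \<in> K" "norm (y - z) < e" using assms(1) by (auto simp: thicken_def dist_norm)
  then show ?thesis using assms(2)[of z] norm_triangle_ineq2[of y z] by linarith
qed

text \<open>By the last clause \<open>G s x\<close> is a convex combination of points near the values of
  \<open>\<Gamma> s\<close> at points near \<open>x\<close>.\<close>

definition approximates ::
    "real set \<Rightarrow> real \<Rightarrow> (real \<Rightarrow> real) \<Rightarrow> (real \<Rightarrow> 'a::euclidean_space \<Rightarrow> 'a set) \<Rightarrow> real \<Rightarrow> (real \<Rightarrow> 'a \<Rightarrow> 'a) \<Rightarrow> bool" where
  "approximates S \<rho> m \<Gamma> \<eta> G \<longleftrightarrow>
     (\<forall>y. y \<in> borel_measurable (lebesgue_on S) \<longrightarrow> (\<lambda>s. G s (y s)) \<in> borel_measurable (lebesgue_on S)) \<and>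
     (\<forall>s. continuous_on UNIV (G s)) \<and>
     (\<forall>s\<in>S. \<forall>x. norm (G s x) \<le> m s + \<eta>) \<and>
     (\<forall>s\<in>S. \<forall>x U. convex U \<longrightarrow>
        (\<forall>x'. norm x' \<le> \<rho> \<longrightarrow> dist x' (radial_proj \<rho> x) < \<eta> \<longrightarrow> thicken \<eta> (\<Gamma> s x') \<subseteq> U) \<longrightarrow> G s x \<in> U)"

text \<open>Measurable near-selections at the points of a finite \<eta>-net of the ball are blended
  by a partition of unity. A net point has nonzero weight only within distance \<eta> of
  \<open>radial_proj \<rho> x\<close>, which is the localisation that \<open>approximates\<close>
  records.\<close>

lemma continuous_approximation:
  fixes \<Gamma> :: "real \<Rightarrow> 'a::euclidean_space \<Rightarrow> 'a set"
  assumes "\<rho> > 0" "\<eta> > 0" and S: "S \<in> sets lebesgue"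
    and ne: "\<And>s x. s \<in> S \<Longrightarrow> norm x \<le> \<rho> \<Longrightarrow> \<Gamma> s x \<noteq> {}"
    and bd: "\<And>s x y. s \<in> S \<Longrightarrow> norm x \<le> \<rho> \<Longrightarrow> y \<in> \<Gamma> s x \<Longrightarrow> norm y \<le> m s"
    and hit: "\<And>x C. norm x \<le> \<rho> \<Longrightarrow> closed C \<Longrightarrow> {s \<in> S. \<Gamma> s x \<inter> C \<noteq> {}} \<in> sets lebesgue"
  shows "\<exists>G. approximates S \<rho> m \<Gamma> \<eta> G"
proof -
  obtain A :: "'a set" where A: "A \<subseteq> cball 0 \<rho>" "finite A" "cball 0 \<rho> \<subseteq> (\<Union>a\<in>A. ball a \<eta>)"
    by (rule compactE_image[of "cball (0::'a) \<rho>" "cball 0 \<rho>" "\<lambda>a. ball a \<eta>"]) (use \<open>\<eta> > 0\<close> in auto)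
  have "\<exists>v. v \<in> borel_measurable (lebesgue_on S) \<and> (\<forall>t\<in>S. v t \<in> thicken \<eta> (\<Gamma> t a))" if "a \<in> A" for a
  proof -
    have a: "norm a \<le> \<rho>" using that A(1) by auto
    show ?thesis
      by (rule approximate_measurable_selection[OF S, of "\<lambda>t. \<Gamma> t a" \<eta>])
        (use hit[OF a] ne[OF _ a] \<open>\<eta> > 0\<close> in blast)+
  qed
  then obtain v where vm: "\<And>a. a \<in> A \<Longrightarrow> v a \<in> borel_measurable (lebesgue_on S)"
    and v: "\<And>a t. a \<in> A \<Longrightarrow> t \<in> S \<Longrightarrow> v a t \<in> thicken \<eta> (\<Gamma> t a)"
    by metis
  \<comment> \<open>The projection inside the weight extends the blend to the whole space, although
    \<Gamma> is controlled only on the ball.\<close>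
  define p where "p a x = max 0 (\<eta> - dist (radial_proj \<rho> x) a)" for a x :: 'a
  define D where "D x = (\<Sum>a\<in>A. p a x)" for x
  define c where "c a x = p a x / D x" for a x
  have pc: "continuous_on UNIV (p a)" for a
    unfolding p_def by (intro continuous_intros continuous_on_radial_proj \<open>\<rho> > 0\<close>)
  have p0: "0 \<le> p a x" for a x by (simp add: p_def)
  have D0: "D x > 0" for x
  proof -
    have "radial_proj \<rho> x \<in> cball 0 \<rho>" using norm_radial_proj[OF \<open>\<rho> > 0\<close>, of x] by simp
    then obtain a where "a \<in> A" "dist a (radial_proj \<rho> x) < \<eta>" using A(3) by auto
    then have "a \<in> A" "p a x > 0" by (auto simp: p_def dist_commute)
    then show ?thesis unfolding D_def by (rule sum_pos2[OF A(2)]) (rule p0)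
  qed
  have cc: "continuous_on UNIV (c a)" for a
    unfolding c_def
  proof (intro continuous_on_divide pc ballI)
    show "continuous_on UNIV D" unfolding D_def by (intro continuous_on_sum pc)
    show "D x \<noteq> 0" for x using D0[of x] by simp
  qed
  have c0: "0 \<le> c a x" for a x using p0 D0[of x] by (simp add: c_def)
  have c1: "(\<Sum>a\<in>A. c a x) = 1" for x
    using D0[of x] by (simp add: c_def D_def sum_divide_distrib[symmetric])
  define G where "G s x = (\<Sum>a\<in>A. c a x *\<^sub>R v a s)" for s x
  have near: "G s x \<in> U" if s: "s \<in> S" and U: "convex U"
    and *: "\<And>x'. norm x' \<le> \<rho> \<Longrightarrow> dist x' (radial_proj \<rho> x) < \<eta> \<Longrightarrow> thicken \<eta> (\<Gamma> s x') \<subseteq> U" for s x U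
  proof -
    define A' where "A' = {a \<in> A. c a x \<noteq> 0}"
    have "G s x = (\<Sum>a\<in>A'. c a x *\<^sub>R v a s)"
      unfolding G_def A'_def by (rule sum.mono_neutral_right) (use A in auto)
    also have "\<dots> \<in> U"
    proof (rule convex_sum)
      show "(\<Sum>a\<in>A'. c a x) = 1"
        unfolding c1[of x, symmetric] A'_def by (rule sum.mono_neutral_left) (use A in auto)
      fix a assume "a \<in> A'"
      then have a: "a \<in> A" "dist a (radial_proj \<rho> x) < \<eta>" by (auto simp: A'_def c_def p_def max_def dist_commute split: if_splits)
      then show "v a s \<in> U" using *[of a] v[OF a(1) s] subsetD[OF A(1) a(1)] by auto
    qed (use A U c0 in \<open>auto simp: A'_def\<close>)
    finally show ?thesis .
  qed
  show ?thesis
    unfolding approximates_def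
  proof (intro exI[of _ G] conjI allI impI ballI)
    show "(\<lambda>s. G s (y s)) \<in> borel_measurable (lebesgue_on S)" if "y \<in> borel_measurable (lebesgue_on S)" for y
      unfolding G_def
      by (intro borel_measurable_sum borel_measurable_scaleR vm
          measurable_compose[OF that borel_measurable_continuous_onI[OF cc]])
    show "continuous_on UNIV (G s)" for s
      unfolding G_def by (intro continuous_intros cc)
    show "norm (G s x) \<le> m s + \<eta>" if "s \<in> S" for s x
    proof -
      have "G s x \<in> cball 0 (m s + \<eta>)"
        by (rule near[OF that]) (use bd[OF that] thicken_norm_le in fastforce)+
      then show ?thesis by simp
    qed
    show "G s x \<in> U" if "s \<in> S" "convex U"
      "\<forall>x'. norm x' \<le> \<rho> \<longrightarrow> dist x' (radial_proj \<rho> x) < \<eta> \<longrightarrow> thicken \<eta> (\<Gamma> s x') \<subseteq> U" for s x U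
      using that by (intro near) auto
  qed
qed

text \<open>With a delay, the Picard iteration becomes stationary on \<open>{..k h}\<close> after \<open>k\<close> steps.\<close>

primrec delayed_iterate ::
    "(real \<Rightarrow> 'a \<Rightarrow> 'a::euclidean_space) \<Rightarrow> real \<Rightarrow> 'a \<Rightarrow> nat \<Rightarrow> real \<Rightarrow> 'a" where
  "delayed_iterate f h z 0 = (\<lambda>t. z)"
| "delayed_iterate f h z (Suc k) = (\<lambda>t. z + integral {0..t} (\<lambda>s. f s (delayed_iterate f h z k (s - h))))"

text \<open>For t \<le> 0 the interval {0..t} is empty or a point, so the integral is 0: the history
  before time 0 is the constant z.\<close>

lemma delayed_iterate_nonpos: "t \<le> 0 \<Longrightarrow> delayed_iterate f h z k t = z"
proof (cases k)
  case (Suc j)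
  assume "t \<le> 0"
  then have "t < 0 \<or> t = 0" by linarith
  then show ?thesis using Suc by auto
qed simp

text \<open>Up to time (k + 1) h the integrand sees the previous iterate only up to time k h, where
  the induction hypothesis applies.\<close>

lemma delayed_iterate_stationary:
  assumes "h > 0" "t \<le> real k * h"
  shows "delayed_iterate f h z (Suc k) t = delayed_iterate f h z k t"
  using assms(2)
proof (induction k arbitrary: t)
  case 0 then show ?case using delayed_iterate_nonpos[of t f h z "Suc 0"] by simp
next
  case (Suc k)
  have "integral {0..t} (\<lambda>s. f s (delayed_iterate f h z (Suc k) (s - h)))
      = integral {0..t} (\<lambda>s. f s (delayed_iterate f h z k (s - h)))"
  proof (rule integral_cong)
    fix s assume "s \<in> {0..t}"
    then have "s - h \<le> real k * h" using Suc.prems by (simp add: algebra_simps)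
    then show "f s (delayed_iterate f h z (Suc k) (s - h)) = f s (delayed_iterate f h z k (s - h))"
      using Suc.IH by simp
  qed
  then show ?case by simp
qed

text \<open>The delay determines the solution on successive intervals of length h, so it can be
  given as a function of the factor l and the initial value z. The last clause is joint continuity
  in (l, z), put sequentially and with uniform convergence because it will be composed with
  \<open>g\<close>.\<close>

definition delayed_solutions ::
    "real \<Rightarrow> real \<Rightarrow> (real \<Rightarrow> real) \<Rightarrow> (real \<Rightarrow> 'a::euclidean_space \<Rightarrow> 'a) \<Rightarrow> (real \<Rightarrow> 'a \<Rightarrow> real \<Rightarrow> 'a) \<Rightarrow> bool" where
  "delayed_solutions T h m G P \<longleftrightarrow>
     (\<forall>l z. l \<in> {0..1} \<longrightarrow> dominated_primitive T m (P l z) (\<lambda>s. l *\<^sub>R G s (P l z (s - h)))) \<and>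
     (\<forall>l z t. t \<le> 0 \<longrightarrow> P l z t = z) \<and>
     (\<forall>l z ls zs. (\<forall>j. ls j \<in> {0..1}) \<longrightarrow> l \<in> {0..1} \<longrightarrow> ls \<longlonglongrightarrow> l \<longrightarrow> zs \<longlonglongrightarrow> z \<longrightarrow>
        uniform_limit {0..T} (\<lambda>j. P (ls j) (zs j)) (P l z) sequentially)"

text \<open>N iterations with N h \<ge> T reach a solution on {0..T}. Since N is fixed, continuity
  in t and in (l, z) has to pass through one integration at a time; dominated convergence does this
  for a G that is merely continuous in x.\<close>

lemma delayed_solutions_exist:
  fixes G :: "real \<Rightarrow> 'a::euclidean_space \<Rightarrow> 'a"
  assumes "T > 0" "h > 0" and m: "m integrable_on {0..T}"
    and meas: "\<And>y. y \<in> borel_measurable (lebesgue_on {0..T}) \<Longrightarrow>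
        (\<lambda>s. G s (y s)) \<in> borel_measurable (lebesgue_on {0..T})"
    and cont: "\<And>s. continuous_on UNIV (G s)"
    and bd: "\<And>s x. s \<in> {0..T} \<Longrightarrow> norm (G s x) \<le> m s"
  shows "\<exists>P. delayed_solutions T h m G P"
proof -
  define X where "X l z = delayed_iterate (\<lambda>s y. l *\<^sub>R G s y) h z" for l z
  define W where "W l z k s = l *\<^sub>R G s (X l z k (s - h))" for l z k s
  have X0: "X l z 0 = (\<lambda>t. z)" and XS: "X l z (Suc k) = (\<lambda>t. z + integral {0..t} (W l z k))" for l z k
    unfolding X_def W_def delayed_iterate.simps by (rule refl)+
  have Wb: "norm (W l z k s) \<le> m s" if "l \<in> {0..1}" "s \<in> {0..T}" for l z k s
    using bd[OF that(2), of "X l z k (s - h)"] that(1) mult_left_le_one_le[of "norm (G s (X l z k (s - h)))" l]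
    by (simp add: W_def)
  have Xc: "continuous_on {..T} (X l z k)" and Wm: "W l z k \<in> borel_measurable (lebesgue_on {0..T})"
    if l: "l \<in> {0..1}" for l z k
  proof -
    have W_of_X: "W l z k \<in> borel_measurable (lebesgue_on {0..T})" if "continuous_on {..T} (X l z k)" for k
    proof -
      have "continuous_on {0..T} (\<lambda>s. X l z k (s - h))"
        by (rule continuous_on_compose2[OF that]) (use \<open>h > 0\<close> in \<open>auto intro!: continuous_intros\<close>)
      then have "(\<lambda>s. X l z k (s - h)) \<in> borel_measurable (lebesgue_on {0..T})"
        by (rule continuous_imp_measurable_on_sets_lebesgue) simp
      then show ?thesis unfolding W_def by (intro borel_measurable_scaleR borel_measurable_const meas)
    qed
    show "continuous_on {..T} (X l z k)"
    proof (induction k)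
      case (Suc k)
      have "W l z k absolutely_integrable_on {0..T}"
        using W_of_X[OF Suc] Wb[OF l] m by (rule dominated_absolutely_integrable)
      then have "continuous_on {0..T} (\<lambda>t. integral {0..t} (W l z k))"
        by (intro indefinite_integral_continuous_1) (simp add: absolutely_integrable_on_def)
      \<comment> \<open>Iterates are evaluated at s - h, hence also at negative times;
        \<open>max 0\<close> carries continuity over from {0..T} to {..T}.\<close>
      then have "continuous_on {..T} (\<lambda>t. z + integral {0..max 0 t} (W l z k))"
        using \<open>T > 0\<close>
        by (intro continuous_on_add continuous_on_const
            continuous_on_compose2[where g = "\<lambda>t. integral {0..t} (W l z k)" and f = "max 0"]
            continuous_on_max continuous_on_id) auto
      moreover have "integral {0..max 0 t} (W l z k) = integral {0..t} (W l z k)" for t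
        by (cases "t < 0") (auto simp: max_def)
      ultimately show ?case by (simp add: XS)
    qed (simp add: X0)
    then show "W l z k \<in> borel_measurable (lebesgue_on {0..T})" by (rule W_of_X)
  qed
  have Wi: "W l z k absolutely_integrable_on {0..T}" if "l \<in> {0..1}" for l z k
    using Wm[OF that] Wb[OF that] m by (rule dominated_absolutely_integrable)
  have lim: "uniform_limit {..T} (\<lambda>j. X (ls j) (zs j) k) (X l z k) sequentially"
    if ls: "\<And>j. ls j \<in> {0..1}" and l: "l \<in> {0..1}" and lsl: "ls \<longlonglongrightarrow> l" and zs: "zs \<longlonglongrightarrow> z" for ls l zs z k
  proof (induction k)
    case 0
    show ?case unfolding X0 uniform_limit_iff using zs by (auto simp: tendsto_iff)
  next
    case (Suc k)
    define d where "d j s = norm (W (ls j) (zs j) k s - W l z k s)" for j s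
    have di: "d j integrable_on {0..T}" for j
      using absolutely_integrable_norm[OF set_integral_diff(1)[OF Wi[OF ls, of j "zs j" k] Wi[OF l, of z k]]]
      by (simp add: d_def[abs_def] o_def absolutely_integrable_on_def)
    have "(\<lambda>j. integral {0..T} (d j)) \<longlonglongrightarrow> integral {0..T} (\<lambda>s. 0)"
    proof (rule dominated_convergence(2)[OF di])
      show "(\<lambda>s. 2 * m s) integrable_on {0..T}" using integrable_cmul[OF m, of 2] by simp
      show "norm (d j s) \<le> 2 * m s" if "s \<in> {0..T}" for j s
        using Wb[OF ls that, of j "zs j" k] Wb[OF l that, of z k]
          norm_triangle_ineq4[of "W (ls j) (zs j) k s" "W l z k s"] by (simp add: d_def)
      fix s assume s: "s \<in> {0..T}"
      have "(\<lambda>j. X (ls j) (zs j) k (s - h)) \<longlonglongrightarrow> X l z k (s - h)"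
        using Suc s \<open>h > 0\<close> by (intro tendsto_uniform_limitI) auto
      then have "(\<lambda>j. G s (X (ls j) (zs j) k (s - h))) \<longlonglongrightarrow> G s (X l z k (s - h))"
        using cont by (intro continuous_on_tendsto_compose[OF cont]) auto
      then have "(\<lambda>j. W (ls j) (zs j) k s) \<longlonglongrightarrow> W l z k s"
        unfolding W_def by (intro tendsto_scaleR lsl)
      then show "(\<lambda>j. d j s) \<longlonglongrightarrow> 0"
        unfolding d_def by (simp add: LIM_zero tendsto_norm_zero)
    qed
    then have "(\<lambda>j. dist (zs j) z + integral {0..T} (d j)) \<longlonglongrightarrow> 0 + 0"
      using zs by (intro tendsto_add) (simp_all add: tendsto_dist_iff[symmetric])
    then have small: "(\<lambda>j. dist (zs j) z + integral {0..T} (d j)) \<longlonglongrightarrow> 0" by simp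
    have le: "dist (X (ls j) (zs j) (Suc k) t) (X l z (Suc k) t) \<le> dist (zs j) z + integral {0..T} (d j)"
      if "t \<le> T" for j t
    proof -
      have sub: "{0..t} \<subseteq> {0..T}" using that by auto
      have i: "W (ls j) (zs j) k integrable_on {0..t}" "W l z k integrable_on {0..t}"
        using Wi[OF ls, of j "zs j" k] Wi[OF l, of z k] integrable_subinterval_real[OF _ sub]
        by (auto simp: absolutely_integrable_on_def)
      have "X (ls j) (zs j) (Suc k) t - X l z (Suc k) t
          = (zs j - z) + integral {0..t} (\<lambda>s. W (ls j) (zs j) k s - W l z k s)"
        unfolding XS using i by (simp add: integral_diff)
      then have "dist (X (ls j) (zs j) (Suc k) t) (X l z (Suc k) t)
          \<le> dist (zs j) z + norm (integral {0..t} (\<lambda>s. W (ls j) (zs j) k s - W l z k s))"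
        by (simp add: dist_norm norm_triangle_ineq)
      also have "norm (integral {0..t} (\<lambda>s. W (ls j) (zs j) k s - W l z k s)) \<le> integral {0..t} (d j)"
        using i di integrable_subinterval_real[OF _ sub]
        by (intro integral_norm_bound_integral integrable_diff) (auto simp: d_def)
      also have "integral {0..t} (d j) \<le> integral {0..T} (d j)"
        using di integrable_subinterval_real[OF _ sub] sub
        by (intro integral_subset_le) (auto simp: d_def)
      finally show ?thesis by simp
    qed
    show ?case unfolding uniform_limit_iff
    proof (intro allI impI)
      fix e :: real assume "e > 0"
      then have "\<forall>\<^sub>F j in sequentially. dist (zs j) z + integral {0..T} (d j) < e"
        using small by (intro order_tendstoD(2)) auto
      then show "\<forall>\<^sub>F j in sequentially. \<forall>t\<in>{..T}. dist (X (ls j) (zs j) (Suc k) t) (X l z (Suc k) t) < e"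
        by eventually_elim (use le in \<open>auto intro: le_less_trans\<close>)
    qed
  qed
  obtain N :: nat where "T / h \<le> real N" using real_arch_simple by blast
  then have N: "T \<le> real N * h" using \<open>h > 0\<close> by (simp add: field_simps)
  show ?thesis
    unfolding delayed_solutions_def
  proof (intro exI[of _ "\<lambda>l z. X l z N"] conjI allI impI)
    show "dominated_primitive T m (X l z N) (\<lambda>s. l *\<^sub>R G s (X l z N (s - h)))" if l: "l \<in> {0..1}" for l z
    proof -
      have "X l z N t = X l z N 0 + integral {0..t} (W l z N)" if "t \<in> {0..T}" for t
      proof -
        have "X l z (Suc N) t = X l z N t"
          unfolding X_def using that N by (intro delayed_iterate_stationary \<open>h > 0\<close>) auto
        moreover have "X l z N 0 = z" unfolding X_def by (rule delayed_iterate_nonpos) simp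
        ultimately show ?thesis by (simp add: XS)
      qed
      then show ?thesis
        using Wm[OF l, of z N] Wb[OF l, of _ z N] unfolding dominated_primitive_def W_def by blast
    qed
    show "X l z N t = z" if "t \<le> 0" for l z t unfolding X_def using that by (rule delayed_iterate_nonpos)
    show "uniform_limit {0..T} (\<lambda>j. X (ls j) (zs j) N) (X l z N) sequentially"
      if "\<forall>j. ls j \<in> {0..1}" "l \<in> {0..1}" "ls \<longlonglongrightarrow> l" "zs \<longlonglongrightarrow> z" for l z ls zs
      by (rule uniform_limit_on_subset[OF lim[OF that(1)[rule_format] that(2-4)]]) auto
  qed
qed

subsection \<open>Strictly inward pointing inclusions\<close>

lemma absolutely_continuous_on_cong:
  assumes "absolutely_continuous_on S f" "\<And>t. t \<in> S \<Longrightarrow> x t = f t"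
  shows "absolutely_continuous_on S x"
  unfolding absolutely_continuous_on_def
proof (intro allI impI)
  fix e :: real assume "e > 0"
  then obtain d where d: "d > 0" "\<And>(n::nat) a b. (\<forall>k<n. a k \<le> b k \<and> {a k..b k} \<subseteq> S) \<Longrightarrow>
      disjoint_family_on (\<lambda>k. {a k<..<b k}) {..<n} \<Longrightarrow> (\<Sum>k<n. b k - a k) < d \<Longrightarrow>
      (\<Sum>k<n. norm (f (b k) - f (a k))) < e"
    using assms(1) unfolding absolutely_continuous_on_def by blast
  show "\<exists>d>0. \<forall>(n::nat) a b. (\<forall>k<n. a k \<le> b k \<and> {a k..b k} \<subseteq> S) \<longrightarrow>
      disjoint_family_on (\<lambda>k. {a k<..<b k}) {..<n} \<longrightarrow> (\<Sum>k<n. b k - a k) < d \<longrightarrow>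
      (\<Sum>k<n. norm (x (b k) - x (a k))) < e"
  proof (intro exI[of _ d] conjI allI impI)
    show "d > 0" by (rule d(1))
    fix n :: nat and a b :: "nat \<Rightarrow> real"
    assume ab: "\<forall>k<n. a k \<le> b k \<and> {a k..b k} \<subseteq> S" and "disjoint_family_on (\<lambda>k. {a k<..<b k}) {..<n}"
      and "(\<Sum>k<n. b k - a k) < d"
    then have "(\<Sum>k<n. norm (f (b k) - f (a k))) < e" by (rule d(2))
    moreover have "x (b k) = f (b k)" "x (a k) = f (a k)" if "k < n" for k
      using ab[rule_format, OF that] assms(2) by (auto simp: subset_iff)
    then have "(\<Sum>k<n. norm (f (b k) - f (a k))) = (\<Sum>k<n. norm (x (b k) - x (a k)))" by simp
    ultimately show "(\<Sum>k<n. norm (x (b k) - x (a k))) < e" by simp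
  qed
qed

lemma dominated_primitive_absolutely_continuous:
  assumes "dominated_primitive T m x w" "m integrable_on {0..T}"
  shows "absolutely_continuous_on {0..T} x"
proof (rule absolutely_continuous_on_cong)
  show "absolutely_continuous_on {0..T} (\<lambda>t. x 0 + integral {0..t} w)"
    by (intro absolutely_continuous_on_add_const absolutely_continuous_on_integral
        dominated_primitive_integrable[OF assms])
qed (rule dominated_primitiveD(3)[OF assms(1)])

text \<open>The evaluation point may move with the index, as the delayed times do.\<close>

lemma uniform_limit_tendsto_at:
  assumes ul: "uniform_limit S X x sequentially" and x: "continuous_on S x"
    and t: "\<And>j. t j \<in> S" "s \<in> S" "t \<longlonglongrightarrow> s"
  shows "(\<lambda>j. X j (t j)) \<longlonglongrightarrow> x s"
proof (rule tendstoI)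
  fix e :: real assume "e > 0"
  then have e: "e / 2 > 0" by simp
  have "(\<lambda>j. x (t j)) \<longlonglongrightarrow> x s"
    by (rule continuous_on_tendsto_compose[OF x t(3,2)]) (simp add: t)
  then have "\<forall>\<^sub>F j in sequentially. dist (x (t j)) (x s) < e / 2" using e by (rule tendstoD)
  moreover have "\<forall>\<^sub>F j in sequentially. \<forall>t\<in>S. dist (X j t) (x t) < e / 2"
    using ul e unfolding uniform_limit_iff by blast
  ultimately show "\<forall>\<^sub>F j in sequentially. dist (X j (t j)) (x s) < e"
  proof eventually_elim
    case (elim j)
    have "dist (X j (t j)) (x s) \<le> dist (X j (t j)) (x (t j)) + dist (x (t j)) (x s)" by (rule dist_triangle)
    then show ?case using elim(1) elim(2)[rule_format, OF t(1)[of j]] by linarith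
  qed
qed

lemma thicken_thicken:
  assumes "K \<subseteq> thicken a L"
  shows "thicken b K \<subseteq> thicken (a + b) L"
proof
  fix q assume "q \<in> thicken b K"
  then obtain z where z: "z \<in> K" "dist q z < b" by (auto simp: thicken_def)
  then obtain y where y: "y \<in> L" "dist z y < a" using assms by (auto simp: thicken_def)
  have "dist q y \<le> dist q z + dist z y" by (rule dist_triangle)
  with z y show "q \<in> thicken (a + b) L" by (force simp: thicken_def)
qed

lemma thicken_mono: "a \<le> b \<Longrightarrow> thicken a K \<subseteq> thicken b K"
  by (force simp: thicken_def)

text \<open>All conditions are confined to the ball of radius \<rho>; outside it the state will be
  projected. Measurability is stated as \<open>hit\<close>, for sets meeting a closed C, since this
  form passes from F to its intersection with a closed half-space and to translates: the test set
  merely changes into another closed set.\<close>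

locale bounded_inclusion =
  fixes T \<rho> :: real and m :: "real \<Rightarrow> real" and \<Gamma> :: "real \<Rightarrow> 'a::euclidean_space \<Rightarrow> 'a set"
  assumes T_pos: "T > 0" and rho_pos: "\<rho> > 0" and m: "integrable (lebesgue_on {0..T}) m"
    and nonempty: "\<And>s x. s \<in> {0..T} \<Longrightarrow> norm x \<le> \<rho> \<Longrightarrow> \<Gamma> s x \<noteq> {}"
    and convex: "\<And>s x. s \<in> {0..T} \<Longrightarrow> norm x \<le> \<rho> \<Longrightarrow> convex (\<Gamma> s x)"
    and compact: "\<And>s x. s \<in> {0..T} \<Longrightarrow> norm x \<le> \<rho> \<Longrightarrow> compact (\<Gamma> s x)"
    and bound: "\<And>s x y. s \<in> {0..T} \<Longrightarrow> norm x \<le> \<rho> \<Longrightarrow> y \<in> \<Gamma> s x \<Longrightarrow> norm y \<le> m s"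
    and hit: "\<And>x C. norm x \<le> \<rho> \<Longrightarrow> closed C \<Longrightarrow> {s \<in> {0..T}. \<Gamma> s x \<inter> C \<noteq> {}} \<in> sets lebesgue"
    and usc: "AE s in lebesgue_on {0..T}. \<forall>x. norm x \<le> \<rho> \<longrightarrow> (\<forall>e>0. \<exists>d>0. \<forall>x'. norm x' \<le> \<rho> \<longrightarrow>
      dist x' x < d \<longrightarrow> \<Gamma> s x' \<subseteq> thicken e (\<Gamma> s x))"
begin

text \<open>The added 1 absorbs the approximation error \<eta> \<le> 1, so that one majorant serves
  all approximations.\<close>

definition m1 :: "real \<Rightarrow> real" where "m1 s = m s + 1"

lemma m1: "integrable (lebesgue_on {0..T}) m1" "m1 integrable_on {0..T}"
proof -
  show "integrable (lebesgue_on {0..T}) m1"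
    unfolding m1_def[abs_def] using m by simp
  then show "m1 integrable_on {0..T}" by (simp add: integrable_on_lebesgue_on)
qed

text \<open>In the last clause index, factor and initial value vary together, because it will be
  applied to fixed points found at uncontrolled indices; \<open>j \<le> ns j\<close> says that these
  tend to infinity. The limit inclusion contains \<open>radial_proj\<close>, as nothing so far keeps
  the trajectories in the ball.\<close>

lemma approximating_scheme:
  obtains P :: "nat \<Rightarrow> real \<Rightarrow> 'a \<Rightarrow> real \<Rightarrow> 'a" where
    "\<And>n l z. P n l z 0 = z"
    "\<And>n l z. l \<in> {0..1} \<Longrightarrow> continuous_on {0..T} (P n l z)"
    "\<And>n z t. t \<in> {0..T} \<Longrightarrow> P n 0 z t = z"
    "\<And>n l z ls zs. (\<And>j. ls j \<in> {0..1}) \<Longrightarrow> l \<in> {0..1} \<Longrightarrow> ls \<longlonglongrightarrow> l \<Longrightarrow> zs \<longlonglongrightarrow> z \<Longrightarrow>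
       uniform_limit {0..T} (\<lambda>j. P n (ls j) (zs j)) (P n l z) sequentially"
    "\<And>ns ls zs. (\<And>j. ls j \<in> {0..1}) \<Longrightarrow> (\<And>j. j \<le> ns j) \<Longrightarrow> (\<And>j. norm (zs j) \<le> \<rho>) \<Longrightarrow>
       \<exists>r l x w. strict_mono (r :: nat \<Rightarrow> nat) \<and> l \<in> {0..1} \<and> (\<lambda>j. ls (r j)) \<longlonglongrightarrow> l \<and>
         uniform_limit {0..T} (\<lambda>j. P (ns (r j)) (ls (r j)) (zs (r j))) x sequentially \<and>
         dominated_primitive T m1 x w \<and>
         (AE s in lebesgue_on {0..T}. w s \<in> (\<lambda>y. l *\<^sub>R y) ` \<Gamma> s (radial_proj \<rho> (x s)))"
proof -
  define \<eta> where "\<eta> n = 1 / (real n + 1)" for n :: nat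
  have \<eta>: "0 < \<eta> n" "\<eta> n \<le> 1" for n by (auto simp: \<eta>_def field_simps)
  have "\<exists>G. approximates {0..T} \<rho> m \<Gamma> (\<eta> n) G" for n
    by (rule continuous_approximation[OF rho_pos \<eta>(1) _ nonempty bound hit]) auto
  then obtain G where G: "\<And>n. approximates {0..T} \<rho> m \<Gamma> (\<eta> n) (G n)" by metis
  define h where "h n = T * \<eta> n" for n
  have "\<exists>P. delayed_solutions T (h n) m1 (G n) P" for n
  proof -
    have "norm (G n s x) \<le> m1 s" if "s \<in> {0..T}" for s x
    proof -
      have "norm (G n s x) \<le> m s + \<eta> n" using G[of n] that unfolding approximates_def by blast
      then show ?thesis using \<eta>(2)[of n] by (simp add: m1_def)
    qed
    moreover have "h n > 0" using T_pos \<eta> by (simp add: h_def)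
    ultimately show ?thesis
      using G[of n] unfolding approximates_def
      by (intro delayed_solutions_exist[OF T_pos _ m1(2)]) blast+
  qed
  then obtain P where P: "\<And>n. delayed_solutions T (h n) m1 (G n) (P n)" by metis
  have traj: "dominated_primitive T m1 (P n l z) (\<lambda>s. l *\<^sub>R G n s (P n l z (s - h n)))"
    if "l \<in> {0..1}" for n l z using P[of n] that unfolding delayed_solutions_def by blast
  have init: "P n l z t = z" if "t \<le> 0" for n l z t using P[of n] that unfolding delayed_solutions_def by blast
  show ?thesis
  proof (rule that[of P])
    show "P n l z 0 = z" for n l z by (rule init) simp
    show "continuous_on {0..T} (P n l z)" if "l \<in> {0..1}" for n l z
      by (rule dominated_primitive_continuous[OF traj[OF that] m1(2)])
    show "P n 0 z t = z" if "t \<in> {0..T}" for n z t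
      using dominated_primitiveD(3)[OF traj[of 0 n z] that] init[of 0 n 0 z] by simp
    show "uniform_limit {0..T} (\<lambda>j. P n (ls j) (zs j)) (P n l z) sequentially"
      if "\<And>j. ls j \<in> {0..1}" "l \<in> {0..1}" "ls \<longlonglongrightarrow> l" "zs \<longlonglongrightarrow> z" for n l z ls zs
      using P[of n] that unfolding delayed_solutions_def by blast
    fix ns :: "nat \<Rightarrow> nat" and ls :: "nat \<Rightarrow> real" and zs :: "nat \<Rightarrow> 'a"
    assume ls: "\<And>j. ls j \<in> {0..1}" and ns: "\<And>j. j \<le> ns j" and zs: "\<And>j. norm (zs j) \<le> \<rho>"
    obtain l r1 where l: "l \<in> {0..1}" and r1: "strict_mono (r1 :: nat \<Rightarrow> nat)" and lim1: "(ls \<circ> r1) \<longlonglongrightarrow> l"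
      using compact_Icc[of 0 "1::real"] ls unfolding compact_def by blast
    obtain r2 x where r2: "strict_mono (r2 :: nat \<Rightarrow> nat)"
      and ul: "uniform_limit {0..T} (\<lambda>j. P (ns (r1 (r2 j))) (ls (r1 (r2 j))) (zs (r1 (r2 j)))) x sequentially"
      by (rule dominated_primitive_compact[of T m1 "\<lambda>j. P (ns (r1 j)) (ls (r1 j)) (zs (r1 j))"
            "\<lambda>j s. ls (r1 j) *\<^sub>R G (ns (r1 j)) s (P (ns (r1 j)) (ls (r1 j)) (zs (r1 j)) (s - h (ns (r1 j))))" \<rho>])
        (use traj[OF ls] m1 T_pos zs init in auto)
    define r where "r j = r1 (r2 j)" for j
    have r: "strict_mono r" using r1 r2 by (auto simp: r_def strict_mono_def)
    define N where "N j = ns (r j)" for j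
    have Nj: "j \<le> N j" for j using ns[of "r j"] seq_suble[OF r, of j] by (simp add: N_def)
    define L where "L j = ls (r j)" for j
    have Ll: "L \<longlonglongrightarrow> l" using LIMSEQ_subseq_LIMSEQ[OF lim1 r2] by (simp add: L_def[abs_def] r_def o_def)
    have L01: "L j \<in> {0..1}" for j using ls by (simp add: L_def)
    define X where "X j = P (N j) (L j) (zs (r j))" for j
    have ulX: "uniform_limit {0..T} X x sequentially"
      using ul by (simp add: X_def[abs_def] N_def L_def r_def)
    have trajX: "dominated_primitive T m1 (X j) (\<lambda>s. L j *\<^sub>R G (N j) s (X j (s - h (N j))))" for j
      unfolding X_def using L01 by (rule traj)
    have xc: "continuous_on {0..T} x"
      by (rule uniform_limit_theorem[OF _ ulX]) (auto intro!: always_eventually dominated_primitive_continuous[OF trajX m1(2)])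
    have \<eta>lim: "(\<lambda>j. \<eta> (N j)) \<longlonglongrightarrow> 0"
    proof (rule tendsto_sandwich[of "\<lambda>j. 0" _ _ \<eta>])
      show "\<eta> \<longlonglongrightarrow> 0" unfolding \<eta>_def by real_asymp
      show "\<forall>\<^sub>F j in sequentially. \<eta> (N j) \<le> \<eta> j"
        using Nj by (intro always_eventually) (auto simp: \<eta>_def field_simps)
    qed (use \<eta> in \<open>auto intro!: always_eventually less_imp_le\<close>)
    have hlim: "(\<lambda>j. h (N j)) \<longlonglongrightarrow> 0" unfolding h_def using tendsto_mult_right_zero[OF \<eta>lim, of T] .
    define K where "K s = (\<lambda>y. l *\<^sub>R y) ` \<Gamma> s (radial_proj \<rho> (x s))" for s
    have rp: "norm (radial_proj \<rho> y) \<le> \<rho>" for y :: 'a using norm_radial_proj[OF rho_pos, of y] by simp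
    obtain w where "dominated_primitive T m1 x w" "AE s in lebesgue_on {0..T}. w s \<in> K s"
    proof (rule dominated_primitive_limit[OF trajX m1(1)])
      show "(\<lambda>j. X j t) \<longlonglongrightarrow> x t" if "t \<in> {0..T}" for t
        using ulX that by (rule tendsto_uniform_limitI)
      show "closed (K s)" "convex (K s)" if "s \<in> {0..T}" for s
        unfolding K_def using compact[OF that rp] convex[OF that rp]
        by (auto intro!: compact_imp_closed compact_scaling convex_scaling)
      show "AE s in lebesgue_on {0..T}. \<forall>e>0. \<forall>\<^sub>F j in sequentially.
          L j *\<^sub>R G (N j) s (X j (s - h (N j))) \<in> thicken e (K s)"
        using usc AE_space
      proof eventually_elim
        case (elim s)
        then have s: "s \<in> {0..T}" by simp
        define y where "y = radial_proj \<rho> (x s)"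
        \<comment> \<open>Uniform convergence is known on {0..T} only. Before time 0 the trajectory
          is constant, so the maximum does not change the value.\<close>
        have "(\<lambda>j. X j (max 0 (s - h (N j)))) \<longlonglongrightarrow> x s"
        proof (rule uniform_limit_tendsto_at[OF ulX xc])
          show "max 0 (s - h (N j)) \<in> {0..T}" for j
          proof -
            have "0 < h (N j)" using T_pos \<eta> by (simp add: h_def)
            then show ?thesis using s T_pos by auto
          qed
          have "(\<lambda>j. max 0 (s - h (N j))) \<longlonglongrightarrow> max 0 (s - 0)" by (intro tendsto_intros hlim)
          then show "(\<lambda>j. max 0 (s - h (N j))) \<longlonglongrightarrow> s" using s by simp
        qed (rule s)
        moreover have "X j (max 0 (s - h (N j))) = X j (s - h (N j))" for j
          unfolding X_def by (cases "s - h (N j) \<le> 0") (simp_all add: init)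
        ultimately have "(\<lambda>j. X j (s - h (N j))) \<longlonglongrightarrow> x s" by simp
        then have ylim: "(\<lambda>j. radial_proj \<rho> (X j (s - h (N j)))) \<longlonglongrightarrow> y"
          unfolding y_def by (intro continuous_on_tendsto_compose[OF continuous_on_radial_proj[OF rho_pos, of UNIV]]) auto
        show ?case
        proof (intro allI impI)
          fix e :: real assume "e > 0"
          \<comment> \<open>One third pays for semicontinuity of \<Gamma>, one for the error \<eta>
            of the approximation, one for the convergence of the factor L j to l.\<close>
          then have e: "e / 3 > 0" by simp
          have "norm y \<le> \<rho>" unfolding y_def by (rule rp)
          then obtain d where d: "d > 0" "\<And>x'. norm x' \<le> \<rho> \<Longrightarrow> dist x' y < d \<Longrightarrow> \<Gamma> s x' \<subseteq> thicken (e / 3) (\<Gamma> s y)"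
            using elim(1) e by blast
          have "\<forall>\<^sub>F j in sequentially. dist (radial_proj \<rho> (X j (s - h (N j)))) y < d / 2"
            using ylim d(1) by (intro tendstoD) auto
          moreover have "\<forall>\<^sub>F j in sequentially. \<eta> (N j) < min (d / 2) (e / 3)"
            using \<eta>lim d(1) e by (intro order_tendstoD(2)) auto
          moreover have "(\<lambda>j. \<bar>L j - l\<bar> * m s) \<longlonglongrightarrow> \<bar>l - l\<bar> * m s" by (intro tendsto_intros Ll)
          then have "\<forall>\<^sub>F j in sequentially. \<bar>L j - l\<bar> * m s < e / 3"
            using e by (intro order_tendstoD(2)) auto
          ultimately show "\<forall>\<^sub>F j in sequentially. L j *\<^sub>R G (N j) s (X j (s - h (N j))) \<in> thicken e (K s)"
          proof eventually_elim
            case (elim j)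
            define q where "q = G (N j) s (X j (s - h (N j)))"
            have "q \<in> thicken (e / 3 + e / 3) (\<Gamma> s y)"
            proof -
              have "thicken (\<eta> (N j)) (\<Gamma> s x') \<subseteq> thicken (e / 3 + e / 3) (\<Gamma> s y)"
                if x': "norm x' \<le> \<rho>" "dist x' (radial_proj \<rho> (X j (s - h (N j)))) < \<eta> (N j)" for x'
              proof -
                have "dist x' y \<le> dist x' (radial_proj \<rho> (X j (s - h (N j)))) + dist (radial_proj \<rho> (X j (s - h (N j)))) y"
                  by (rule dist_triangle)
                then have "dist x' y < d" using elim x' by simp
                then have "thicken (\<eta> (N j)) (\<Gamma> s x') \<subseteq> thicken (e / 3 + \<eta> (N j)) (\<Gamma> s y)"
                  by (intro thicken_thicken d x')
                also have "\<dots> \<subseteq> thicken (e / 3 + e / 3) (\<Gamma> s y)" using elim by (intro thicken_mono) auto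
                finally show ?thesis .
              qed
              moreover have "convex (thicken (e / 3 + e / 3) (\<Gamma> s y))"
                by (intro convex_thicken convex s \<open>norm y \<le> \<rho>\<close>)
              ultimately show ?thesis unfolding q_def using G[of "N j"] s unfolding approximates_def by blast
            qed
            then obtain z where z: "z \<in> \<Gamma> s y" "dist q z < 2 * (e / 3)" by (auto simp: thicken_def)
            have "L j *\<^sub>R q - l *\<^sub>R z = L j *\<^sub>R (q - z) + (L j - l) *\<^sub>R z" by (simp add: algebra_simps)
            then have "dist (L j *\<^sub>R q) (l *\<^sub>R z) \<le> norm (L j *\<^sub>R (q - z)) + norm ((L j - l) *\<^sub>R z)"
              by (simp add: dist_norm norm_triangle_ineq del: norm_scaleR)
            also have "norm (L j *\<^sub>R (q - z)) \<le> dist q z"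
              using L01[of j] by (simp add: dist_norm mult_left_le_one_le)
            also have "norm ((L j - l) *\<^sub>R z) \<le> \<bar>L j - l\<bar> * m s"
              using bound[OF s \<open>norm y \<le> \<rho>\<close> z(1)] by (simp add: mult_left_mono)
            finally have "dist (L j *\<^sub>R q) (l *\<^sub>R z) < e" using z(2) elim by simp
            then show ?case using z(1) unfolding K_def thicken_def q_def y_def by blast
          qed
        qed
      qed
    qed (use T_pos in auto)
    then show "\<exists>r l x w. strict_mono (r :: nat \<Rightarrow> nat) \<and> l \<in> {0..1} \<and> (\<lambda>j. ls (r j)) \<longlonglongrightarrow> l \<and>
         uniform_limit {0..T} (\<lambda>j. P (ns (r j)) (ls (r j)) (zs (r j))) x sequentially \<and>
         dominated_primitive T m1 x w \<and>
         (AE s in lebesgue_on {0..T}. w s \<in> (\<lambda>y. l *\<^sub>R y) ` \<Gamma> s (radial_proj \<rho> (x s)))"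
      using r l Ll ulX unfolding K_def X_def[abs_def] N_def L_def[abs_def] by blast
  qed
qed

text \<open>The velocity belongs to the projected state, but x s is a multiple k \<ge> 1 of its
  projection, so <x s, y> \<le> - k c \<le> - c. The bound thus holds before the trajectory is known
  to stay in the ball.\<close>

lemma solution_norm_bound:
  assumes x: "dominated_primitive T m1 x w" and l: "l \<in> {0..1}"
    and w: "AE s in lebesgue_on {0..T}. w s \<in> (\<lambda>y. l *\<^sub>R y) ` \<Gamma> s (radial_proj \<rho> (x s))"
    and R: "0 \<le> R" "R < \<rho>" and "c \<ge> 0" and t: "t \<in> {0..T}"
    and inward: "\<And>s x y. s \<in> {0..T} \<Longrightarrow> R < norm x \<Longrightarrow> norm x \<le> \<rho> \<Longrightarrow> y \<in> \<Gamma> s x \<Longrightarrow> inner x y \<le> - c"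
  shows "(norm (x t))\<^sup>2 \<le> max (R\<^sup>2) ((norm (x 0))\<^sup>2 - 2 * (c * l) * t)"
proof (rule norm_square_bound_outside_ball[OF dominated_primitive_integrable[OF x m1(2)] t])
  show "AE s in lebesgue_on {0..T}. R < norm (x s) \<longrightarrow> inner (x s) (w s) \<le> - (c * l)"
    using w AE_space
  proof eventually_elim
    case (elim s)
    then have s: "s \<in> {0..T}" by simp
    obtain y where y: "w s = l *\<^sub>R y" "y \<in> \<Gamma> s (radial_proj \<rho> (x s))" using elim by auto
    show ?case
    proof
      assume "R < norm (x s)"
      then have le: "inner (radial_proj \<rho> (x s)) y \<le> - c"
        using norm_radial_proj[OF rho_pos, of "x s"] R by (intro inward[OF s _ _ y(2)]) auto
      define k where "k = max \<rho> (norm (x s)) / \<rho>"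
      have k: "k \<ge> 1" using rho_pos by (simp add: k_def)
      have "max \<rho> (norm (x s)) > 0" using rho_pos by simp
      then have "x s = k *\<^sub>R radial_proj \<rho> (x s)"
        using rho_pos by (simp add: k_def radial_proj_def)
      then have "inner (x s) y = k * inner (radial_proj \<rho> (x s)) y" by (metis inner_scaleR_left)
      also have "\<dots> \<le> k * (- c)" using le k by (intro mult_left_mono) auto
      also have "\<dots> \<le> - c" using k \<open>c \<ge> 0\<close> mult_right_mono[of 1 k c] by simp
      finally have "l * inner (x s) y \<le> l * (- c)" using l by (intro mult_left_mono) auto
      then show "inner (x s) (w s) \<le> - (c * l)" by (simp add: y(1) mult.commute)
    qed
  qed
qed (use dominated_primitiveD(3)[OF x] R \<open>c \<ge> 0\<close> l in \<open>auto simp only: atLeastAtMost_iff zero_le_mult_iff\<close>)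

text \<open>Here \<open>g\<close> acts on arbitrary functions of time. \<open>g_cong\<close> and
  \<open>g_cont\<close> stand in for the function space, so that trajectories can be inserted
  together with their values at negative times.\<close>

lemma solution_of_strict_problem:
  fixes g :: "(real \<Rightarrow> 'a) \<Rightarrow> 'a"
  assumes R: "0 \<le> R" "R < \<rho>" and c: "c > 0"
    and inward: "\<And>s x y. s \<in> {0..T} \<Longrightarrow> R < norm x \<Longrightarrow> norm x \<le> \<rho> \<Longrightarrow> y \<in> \<Gamma> s x \<Longrightarrow> inner x y \<le> - c"
    and g_cong: "\<And>x y. (\<And>t. t \<in> {0..T} \<Longrightarrow> x t = y t) \<Longrightarrow> g x = g y"
    and g_cont: "\<And>X x. (\<And>j. continuous_on {0..T} (X j)) \<Longrightarrow> uniform_limit {0..T} X x sequentially \<Longrightarrow>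
       (\<lambda>j. g (X j)) \<longlonglongrightarrow> g x"
    and g1: "\<And>x. absolutely_continuous_on {0..T} x \<Longrightarrow> (\<And>t. t \<in> {0..T} \<Longrightarrow> norm (x t) \<le> \<rho>) \<Longrightarrow>
       x 0 = g x \<Longrightarrow> \<exists>t\<in>{0<..T}. norm (g x) \<le> norm (x t)"
    and g2: "\<And>z. norm z = \<rho> \<Longrightarrow> norm (g (\<lambda>t. z)) \<le> \<rho>"
    and g3: "\<And>z. norm z = \<rho> \<Longrightarrow> g (\<lambda>t. z) \<noteq> z"
  obtains x w where "dominated_primitive T m1 x w" "AE s in lebesgue_on {0..T}. w s \<in> \<Gamma> s (x s)"
    "\<And>t. t \<in> {0..T} \<Longrightarrow> norm (x t) \<le> \<rho>" "x 0 = g x"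
proof -
  obtain P where P0: "\<And>n l z. P n l z 0 = z"
    and Pc: "\<And>n l z. l \<in> {0..1} \<Longrightarrow> continuous_on {0..T} (P n l z)"
    and Pconst: "\<And>n z t. t \<in> {0..T} \<Longrightarrow> P n 0 z t = z"
    and Pdep: "\<And>n l z ls zs. (\<And>j. ls j \<in> {0..1}) \<Longrightarrow> l \<in> {0..1} \<Longrightarrow> ls \<longlonglongrightarrow> l \<Longrightarrow> zs \<longlonglongrightarrow> z \<Longrightarrow>
       uniform_limit {0..T} (\<lambda>j. P n (ls j) (zs j)) (P n l z) sequentially"
    and Plim: "\<And>ns ls zs. (\<And>j. ls j \<in> {0..1}) \<Longrightarrow> (\<And>j. j \<le> ns j) \<Longrightarrow> (\<And>j. norm (zs j) \<le> \<rho>) \<Longrightarrow>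
       \<exists>r l x w. strict_mono (r :: nat \<Rightarrow> nat) \<and> l \<in> {0..1} \<and> (\<lambda>j. ls (r j)) \<longlonglongrightarrow> l \<and>
         uniform_limit {0..T} (\<lambda>j. P (ns (r j)) (ls (r j)) (zs (r j))) x sequentially \<and>
         dominated_primitive T m1 x w \<and>
         (AE s in lebesgue_on {0..T}. w s \<in> (\<lambda>y. l *\<^sub>R y) ` \<Gamma> s (radial_proj \<rho> (x s)))"
    using approximating_scheme by blast
  have initial: "x 0 = g x" "r' \<longlonglongrightarrow> x 0" if r': "\<And>j. r' j = zs (r j)" and ls: "\<And>j. ls j \<in> {0..1}"
    and ul: "uniform_limit {0..T} (\<lambda>j. P (ns (r j)) (ls (r j)) (zs (r j))) x sequentially"
    and fix_z: "\<And>j. g (P (ns j) (ls j) (zs j)) = zs j" for ns ls zs x and r :: "nat \<Rightarrow> nat" and r'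
  proof -
    have "(\<lambda>j. P (ns (r j)) (ls (r j)) (zs (r j)) 0) \<longlonglongrightarrow> x 0"
      using ul T_pos by (intro tendsto_uniform_limitI) auto
    then show *: "r' \<longlonglongrightarrow> x 0" by (simp add: P0 r'[abs_def])
    have "(\<lambda>j. g (P (ns (r j)) (ls (r j)) (zs (r j)))) \<longlonglongrightarrow> g x"
      using ul by (intro g_cont Pc ls)
    then have "r' \<longlonglongrightarrow> g x" by (simp add: fix_z r'[abs_def])
    with * show "x 0 = g x" by (rule LIMSEQ_unique)
  qed
  have norm_le: "norm (x t) \<le> \<rho>"
    if "dominated_primitive T m1 x w" "l \<in> {0..1}" "t \<in> {0..T}" "norm (x 0) \<le> \<rho>"
      "AE s in lebesgue_on {0..T}. w s \<in> (\<lambda>y. l *\<^sub>R y) ` \<Gamma> s (radial_proj \<rho> (x s))" for x w l t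
  proof -
    have "(norm (x t))\<^sup>2 \<le> max (R\<^sup>2) ((norm (x 0))\<^sup>2 - 2 * (c * l) * t)"
      using that R c by (intro solution_norm_bound[OF _ _ _ _ _ _ _ inward]) auto
    moreover have "R\<^sup>2 \<le> \<rho>\<^sup>2" "(norm (x 0))\<^sup>2 \<le> \<rho>\<^sup>2" using R that by (auto intro!: power_mono)
    moreover have "0 \<le> 2 * (c * l) * t" using c that by simp
    ultimately have "(norm (x t))\<^sup>2 \<le> \<rho>\<^sup>2" by linarith
    then show ?thesis using rho_pos by (intro power2_le_imp_le[of "norm (x t)" \<rho>]) auto
  qed
  \<comment> \<open>The index must be uniform in l and z. If there is none, counterexamples exist at
    indices \<open>ns j\<close> with \<open>j \<le> ns j\<close>, which is the shape that
    \<open>Plim\<close> accepts.\<close>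
  have "\<exists>n0. \<forall>n\<ge>n0. \<forall>l\<in>{0..1}. \<forall>z. norm z = \<rho> \<longrightarrow> g (P n l z) \<noteq> z"
  proof (rule ccontr)
    assume "\<not> ?thesis"
    then have "\<forall>j. \<exists>n l z. j \<le> n \<and> l \<in> {0..1} \<and> norm z = \<rho> \<and> g (P n l z) = z" by blast
    then obtain ns ls zs where ns: "\<And>j. j \<le> ns j" and ls: "\<And>j. ls j \<in> {0..1}" and zs: "\<And>j. norm (zs j) = \<rho>"
      and fix_z: "\<And>j. g (P (ns j) (ls j) (zs j)) = zs j" by metis
    obtain r l x w where l: "l \<in> {0..1}"
      and ul: "uniform_limit {0..T} (\<lambda>j. P (ns (r j)) (ls (r j)) (zs (r j))) x sequentially"
      and x: "dominated_primitive T m1 x w"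
      and w: "AE s in lebesgue_on {0..T}. w s \<in> (\<lambda>y. l *\<^sub>R y) ` \<Gamma> s (radial_proj \<rho> (x s))"
      using Plim[of ls ns zs, OF ls ns] zs by auto
    have x0: "x 0 = g x" and "(\<lambda>j. zs (r j)) \<longlonglongrightarrow> x 0"
      using initial[of "\<lambda>j. zs (r j)" zs r ls ns x, OF refl ls ul fix_z] by auto
    from tendsto_norm[OF this(2)] have nx0: "norm (x 0) = \<rho>"
      by (simp add: zs LIMSEQ_const_iff)
    show False
    proof (cases "l = 0")
      case True
      have w0: "AE s in lebesgue_on {0..T}. w s = 0" using w True by (auto elim!: eventually_mono)
      have "x t = x 0" if "t \<in> {0..T}" for t
      proof -
        have "integral {0..t} w = integral {0..t} (\<lambda>s. 0)"
          by (rule integral_spike[of "{s \<in> {0..T}. w s \<noteq> 0}"])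
            (use w0 that in \<open>auto simp: AE_lebesgue_on_iff_negligible\<close>)
        then show ?thesis using dominated_primitiveD(3)[OF x that] by simp
      qed
      then have "g x = g (\<lambda>t. x 0)" by (rule g_cong)
      from trans[OF this[symmetric] x0[symmetric]] g3[OF nx0] show False by contradiction
    next
      case False
      then have "l > 0" using l by simp
      have "absolutely_continuous_on {0..T} x" by (rule dominated_primitive_absolutely_continuous[OF x m1(2)])
      then obtain t where t: "t \<in> {0<..T}" "norm (g x) \<le> norm (x t)"
        using g1[of x] norm_le[OF x l _ _ w] nx0 x0 by auto
      have "(norm (x t))\<^sup>2 \<le> max (R\<^sup>2) ((norm (x 0))\<^sup>2 - 2 * (c * l) * t)"
        using t R c by (intro solution_norm_bound[OF x l w _ _ _ _ inward]) auto
      moreover have "R\<^sup>2 < \<rho>\<^sup>2" using R by (intro power_strict_mono) auto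
      moreover have "0 < 2 * (c * l) * t" using c \<open>l > 0\<close> t by simp
      ultimately have "(norm (x t))\<^sup>2 < \<rho>\<^sup>2" using nx0 by simp
      moreover have "\<rho>\<^sup>2 \<le> (norm (x t))\<^sup>2" using t(2) x0 nx0 rho_pos by (intro power_mono) auto
      ultimately show False by simp
    qed
  qed
  then obtain n0 where n0: "\<And>n l z. n \<ge> n0 \<Longrightarrow> l \<in> {0..1} \<Longrightarrow> norm z = \<rho> \<Longrightarrow> g (P n l z) \<noteq> z" by blast
  have "\<exists>z. norm z \<le> \<rho> \<and> g (P n 1 z) = z" if "n \<ge> n0" for n
  proof (rule fixed_point_by_homotopy[OF rho_pos, of "\<lambda>l z. g (P n l z)"])
    show "continuous_on ({0..1} \<times> cball 0 \<rho>) (\<lambda>p. g (P n (fst p) (snd p)))"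
      unfolding continuous_on_sequentially o_def
    proof (intro allI ballI impI, elim conjE)
      fix ps :: "nat \<Rightarrow> real \<times> 'a" and p assume p: "p \<in> {0..1} \<times> cball 0 \<rho>"
        and ps: "\<forall>j. ps j \<in> {0..1} \<times> cball 0 \<rho>" and lim: "ps \<longlonglongrightarrow> p"
      have ps1: "fst (ps j) \<in> {0..1}" for j using ps[rule_format, of j] by (simp add: mem_Times_iff)
      have "uniform_limit {0..T} (\<lambda>j. P n (fst (ps j)) (snd (ps j))) (P n (fst p) (snd p)) sequentially"
        using p by (intro Pdep ps1 tendsto_fst tendsto_snd lim) (simp add: mem_Times_iff)
      then show "(\<lambda>j. g (P n (fst (ps j)) (snd (ps j)))) \<longlonglongrightarrow> g (P n (fst p) (snd p))"
        by (intro g_cont Pc ps1)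
    qed
    show "norm (g (P n 0 z)) \<le> \<rho>" if "norm z = \<rho>" for z
      using g2[OF that] g_cong[of "P n 0 z" "\<lambda>t. z"] Pconst by simp
    show "g (P n l z) \<noteq> z" if "l \<in> {0..1}" "norm z = \<rho>" for l z
      using n0 \<open>n \<ge> n0\<close> that by blast
  qed auto
  then have "\<forall>j. \<exists>z. norm z \<le> \<rho> \<and> g (P (n0 + j) 1 z) = z" by (metis le_add1)
  from choice[OF this] obtain zs where "\<forall>j. norm (zs j) \<le> \<rho> \<and> g (P (n0 + j) 1 (zs j)) = zs j" ..
  then have zs: "\<And>j. norm (zs j) \<le> \<rho>" and fix_z: "\<And>j. g (P (n0 + j) 1 (zs j)) = zs j" by blast+
  obtain r l x w where l: "(\<lambda>j::nat. 1::real) \<longlonglongrightarrow> l"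
    and ul: "uniform_limit {0..T} (\<lambda>j. P (n0 + r j) 1 (zs (r j))) x sequentially"
    and x: "dominated_primitive T m1 x w"
    and w: "AE s in lebesgue_on {0..T}. w s \<in> (\<lambda>y. l *\<^sub>R y) ` \<Gamma> s (radial_proj \<rho> (x s))"
    using Plim[of "\<lambda>j. 1" "\<lambda>j. n0 + j" zs] zs by auto
  have l1: "l = 1" using l by (simp add: LIMSEQ_const_iff)
  have x0: "x 0 = g x" and "(\<lambda>j. zs (r j)) \<longlonglongrightarrow> x 0"
    using initial[of "\<lambda>j. zs (r j)" zs r "\<lambda>j. 1" "\<lambda>j. n0 + j" x] ul fix_z by auto
  then have "norm (x 0) \<le> \<rho>" using zs by (intro tendsto_upperbound[OF tendsto_norm]) auto
  then have xr: "norm (x t) \<le> \<rho>" if "t \<in> {0..T}" for t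
    using norm_le[OF x _ that _ w] l1 by simp
  \<comment> \<open>Now that the trajectory is confined to the ball, the projection in the limit
    inclusion is the identity.\<close>
  have "AE s in lebesgue_on {0..T}. w s \<in> \<Gamma> s (x s)"
    using w AE_space
    by eventually_elim (use xr in \<open>auto simp: l1 radial_proj_id[OF rho_pos]\<close>)
  with x x0 xr that show ?thesis by blast
qed

end

subsection \<open>Reduction to the strict case\<close>

text \<open>The complement of C is an increasing union of closed sets, and a compact value disjoint
  from C lies in one of them. So the times at which C is missed form a countable union of sets that
  \<open>measurable_multimap\<close> covers.\<close>

lemma measurable_multimap_hit:
  fixes \<Phi> :: "real \<Rightarrow> 'a::euclidean_space set"
  assumes \<Phi>: "measurable_multimap S \<Phi>" and S: "S \<in> sets lebesgue"
    and comp: "\<And>t. t \<in> S \<Longrightarrow> compact (\<Phi> t)" and C: "closed C"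
  shows "{t \<in> S. \<Phi> t \<inter> C \<noteq> {}} \<in> sets lebesgue"
proof (cases "C = {}")
  case False
  \<comment> \<open>C is nonempty here: \<open>infdist\<close> to the empty set is 0, which would
    make every A n empty.\<close>
  define A where "A n = {y. 1 / (real n + 1) \<le> infdist y C}" for n :: nat
  have clA: "closed (A n)" for n
    unfolding A_def by (intro closed_Collect_le continuous_intros)
  have eq: "(\<Phi> t \<inter> C = {}) \<longleftrightarrow> (\<exists>n. \<Phi> t \<subseteq> A n)" if t: "t \<in> S" for t
  proof
    assume "\<Phi> t \<inter> C = {}"
    then obtain d where d: "d > 0" "\<And>x y. x \<in> \<Phi> t \<Longrightarrow> y \<in> C \<Longrightarrow> d \<le> dist x y"
      using separate_compact_closed[OF comp[OF t] C] by blast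
    then have "d \<le> infdist x C" if "x \<in> \<Phi> t" for x
      using that \<open>C \<noteq> {}\<close> by (auto simp: infdist_notempty intro!: cINF_greatest)
    moreover obtain n where "1 / (real n + 1) < d"
      using reals_Archimedean[OF d(1)] by (auto simp: inverse_eq_divide add.commute)
    ultimately have "\<Phi> t \<subseteq> A n" by (force simp: A_def)
    then show "\<exists>n. \<Phi> t \<subseteq> A n" ..
  next
    assume "\<exists>n. \<Phi> t \<subseteq> A n"
    then obtain n where n: "\<Phi> t \<subseteq> A n" ..
    have "y \<notin> A n" if "y \<in> C" for y
    proof -
      have "infdist y C = 0" "0 < 1 / (real n + 1)" using that by simp_all
      then show ?thesis unfolding A_def by simp
    qed
    with n show "\<Phi> t \<inter> C = {}" by blast
  qed
  have "{t \<in> S. \<Phi> t \<inter> C \<noteq> {}} = {t \<in> S. \<not> (\<exists>n. \<Phi> t \<subseteq> A n)}"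
    by (intro Collect_cong conj_cong refl) (simp only: eq)
  also have "\<dots> = S - (\<Union>n. {t \<in> S. \<Phi> t \<subseteq> A n})" by blast
  also have "\<dots> \<in> sets lebesgue"
    using \<Phi> clA S unfolding measurable_multimap_def by (intro sets.Diff sets.countable_UN) auto
  finally show ?thesis .
qed simp

lemma open_thicken: "open (thicken e K)"
proof -
  have "thicken e K = (\<Union>z\<in>K. ball z e)" by (auto simp: thicken_def dist_commute)
  then show ?thesis using open_UN[of K "\<lambda>z. ball z e"] by simp
qed

lemma mem_thicken: "y \<in> K \<Longrightarrow> e > 0 \<Longrightarrow> y \<in> thicken e K"
  by (auto simp: thicken_def intro!: bexI[of _ y])

text \<open>Off a neighbourhood of \<open>{y \<in> \<Phi> x. \<langle>x, y\<rangle> \<le> 0}\<close> the function \<open>\<langle>x, \<cdot>\<rangle>\<close> is bounded away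
  from \<open>0\<close> on \<open>\<Phi> x\<close>, so a small change of \<open>x\<close> does not create new points with
  \<open>\<langle>x, y\<rangle> \<le> 0\<close>.\<close>

lemma usc_restrict_halfspace:
  fixes \<Phi> :: "'a::euclidean_space \<Rightarrow> 'a set"
  assumes usc: "upper_semicontinuous \<Phi>" and comp: "compact (\<Phi> x)"
    and bd: "\<And>x' y. norm x' \<le> \<rho> \<Longrightarrow> y \<in> \<Phi> x' \<Longrightarrow> norm y \<le> b" and "e > 0"
  shows "\<exists>d>0. \<forall>x'. norm x' \<le> \<rho> \<longrightarrow> dist x' x < d \<longrightarrow>
    {y \<in> \<Phi> x'. R < norm x' \<longrightarrow> inner x' y \<le> 0} \<subseteq> thicken e {y \<in> \<Phi> x. R < norm x \<longrightarrow> inner x y \<le> 0}"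
proof -
  define K where "K = {y \<in> \<Phi> x. R < norm x \<longrightarrow> inner x y \<le> 0}"
  show ?thesis
  proof (cases "R < norm x")
    \<comment> \<open>For |x| \<le> R the set at x is the whole of \<Phi> x. The constraint starts
      only at R < |x|, so on the sphere |x| = R, where it switches on, the set at x is the larger
      one, as upper semicontinuity wants.\<close>
    case False
    then have K: "K = \<Phi> x" by (simp add: K_def)
    have "open {x'. \<Phi> x' \<subseteq> thicken e K}" using usc open_thicken unfolding upper_semicontinuous_def by blast
    moreover have "x \<in> {x'. \<Phi> x' \<subseteq> thicken e K}" using \<open>e > 0\<close> by (auto simp: K mem_thicken)
    ultimately obtain d where "d > 0" "\<And>x'. dist x' x < d \<Longrightarrow> \<Phi> x' \<subseteq> thicken e K"
      unfolding open_dist by blast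
    then show ?thesis unfolding K_def[symmetric] by blast
  next
    case True
    define L where "L = \<Phi> x - thicken e K"
    have "compact L" unfolding L_def using comp open_thicken by (rule compact_diff)
    have pos: "inner x y > 0" if "y \<in> L" for y
      using that \<open>e > 0\<close> True mem_thicken[of y K e] by (auto simp: L_def K_def not_le[symmetric])
    obtain c where c: "c > 0" "\<And>y. y \<in> L \<Longrightarrow> c < inner x y"
    proof (cases "L = {}")
      case False
      have "continuous_on L (\<lambda>y. inner x y)" by (intro continuous_intros)
      then obtain y0 where "y0 \<in> L" "\<And>y. y \<in> L \<Longrightarrow> inner x y0 \<le> inner x y"
        using continuous_attains_inf[OF \<open>compact L\<close> False] by blast
      moreover have "inner x y0 > 0" using pos \<open>y0 \<in> L\<close> .
      ultimately show ?thesis using that[of "inner x y0 / 2"] by force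
    qed (use that[of 1] in auto)
    \<comment> \<open>An open set containing \<Phi> x: a point of \<Phi> x outside the neighbourhood
      of K lies in L.\<close>
    define U where "U = thicken e K \<union> {y. c < inner x y}"
    have "open U" unfolding U_def by (intro open_Un open_thicken open_Collect_less continuous_intros)
    then have "open {x'. \<Phi> x' \<subseteq> U}" using usc unfolding upper_semicontinuous_def by blast
    moreover have "x \<in> {x'. \<Phi> x' \<subseteq> U}" using c(2) by (auto simp: U_def L_def)
    ultimately obtain d where d: "d > 0" "\<And>x'. dist x' x < d \<Longrightarrow> \<Phi> x' \<subseteq> U"
      unfolding open_dist by blast
    \<comment> \<open>The second term keeps |x'| > R, so the constraint is active at x'. The third
      bounds the change of the inner product by c, since values are bounded by b; |b| + 1 avoids
      division by 0.\<close>
    define d' where "d' = min d (min (norm x - R) (c / (\<bar>b\<bar> + 1)))"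
    have "d' > 0" using d True c by (simp add: d'_def)
    have "y \<in> thicken e K"
      if x': "norm x' \<le> \<rho>" "dist x' x < d'" and y: "y \<in> \<Phi> x'" "R < norm x' \<longrightarrow> inner x' y \<le> 0" for x' y
    proof -
      have "norm x - norm x' \<le> dist x' x" by (simp add: dist_norm norm_minus_commute norm_triangle_ineq2)
      then have "R < norm x'" using x' by (simp add: d'_def)
      then have "inner x y \<le> inner (x - x') y" using y by (simp add: inner_diff_left)
      also have "\<dots> \<le> norm (x - x') * norm y" by (rule norm_cauchy_schwarz)
      also have "\<dots> \<le> (c / (\<bar>b\<bar> + 1)) * (\<bar>b\<bar> + 1)"
        using x' bd[OF x'(1) y(1)] c(1)
        by (intro mult_mono) (auto simp: d'_def dist_norm norm_minus_commute add_nonneg_pos)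
      finally have "\<not> c < inner x y" by (simp add: add_pos_nonneg)
      moreover have "y \<in> U" using d(2)[of x'] x' y by (auto simp: d'_def)
      ultimately show ?thesis by (simp add: U_def)
    qed
    then show ?thesis using \<open>d' > 0\<close> unfolding K_def[symmetric] by blast
  qed
qed

text \<open>Majorant and radius do not depend on e, so the trajectories found for e = 1 / (j + 1)
  form a relatively compact family. A limit solves the inclusion with e = 0, whose values are
  subsets of those of F.\<close>

lemma nonlocal_problem_in_ball:
  fixes F :: "real \<Rightarrow> 'a::euclidean_space \<Rightarrow> 'a set" and g :: "(real \<Rightarrow> 'a) \<Rightarrow> 'a"
  assumes T: "T > 0" and F: "caratheodory_map {0..T} F" and R: "0 < R" "R < \<rho>"
    and guide: "\<And>t x. t \<in> {0..T} \<Longrightarrow> R \<le> norm x \<Longrightarrow> \<exists>y\<in>F t x. inner x y \<le> 0"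
    and g_cong: "\<And>x y. (\<And>t. t \<in> {0..T} \<Longrightarrow> x t = y t) \<Longrightarrow> g x = g y"
    and g_cont: "\<And>X x. (\<And>j. continuous_on {0..T} (X j)) \<Longrightarrow> uniform_limit {0..T} X x sequentially \<Longrightarrow>
       (\<lambda>j. g (X j)) \<longlonglongrightarrow> g x"
    and g1: "\<And>x. absolutely_continuous_on {0..T} x \<Longrightarrow> (\<And>t. t \<in> {0..T} \<Longrightarrow> norm (x t) \<le> \<rho>) \<Longrightarrow>
       x 0 = g x \<Longrightarrow> \<exists>t\<in>{0<..T}. norm (g x) \<le> norm (x t)"
    and g2: "\<And>z. norm z = \<rho> \<Longrightarrow> norm (g (\<lambda>t. z)) \<le> \<rho>"
    and g3: "\<And>z. norm z = \<rho> \<Longrightarrow> g (\<lambda>t. z) \<noteq> z"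
  obtains x w m where "m integrable_on {0..T}" "dominated_primitive T m x w"
    "AE s in lebesgue_on {0..T}. w s \<in> F s (x s)" "x 0 = g x"
proof -
  have Fne: "F t x \<noteq> {}" and Fconv: "convex (F t x)" and Fcomp: "compact (F t x)" if "t \<in> {0..T}" for t x
    using F that unfolding caratheodory_map_def by blast+
  have Fmeas: "measurable_multimap {0..T} (\<lambda>t. F t x)" for x using F unfolding caratheodory_map_def by blast
  have Fusc: "AE t in lebesgue_on {0..T}. upper_semicontinuous (F t)" using F unfolding caratheodory_map_def by blast
  obtain \<mu> where \<mu>: "integrable (lebesgue_on {0..T}) \<mu>"
    and \<mu>F: "\<And>t x. t \<in> {0..T} \<Longrightarrow> (SUP y\<in>F t x. norm y) \<le> \<mu> t * (1 + norm x)"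
    using F unfolding caratheodory_map_def by blast
  have rho: "\<rho> > 0" using R by simp
  have Fb: "norm y \<le> \<mu> t * (1 + \<rho>)" if t: "t \<in> {0..T}" and x: "norm x \<le> \<rho>" and y: "y \<in> F t x" for t x y
  proof -
    have "bounded (norm ` F t x)"
      using Fcomp[OF t, of x] by (intro compact_imp_bounded compact_continuous_image continuous_intros) auto
    then have "norm y \<le> (SUP y\<in>F t x. norm y)" using y by (intro cSUP_upper bounded_imp_bdd_above) auto
    also have le: "\<dots> \<le> \<mu> t * (1 + norm x)" by (rule \<mu>F[OF t])
    finally have *: "norm y \<le> \<mu> t * (1 + norm x)" .
    then have "0 \<le> \<mu> t * (1 + norm x)" by (rule order_trans[OF norm_ge_zero])
    \<comment> \<open>Nonnegativity of \<mu> comes from the growth bound itself; it permits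
      replacing |x| by \<rho>.\<close>
    then have "0 \<le> \<mu> t" by (smt (verit) norm_ge_zero zero_le_mult_iff)
    then have "\<mu> t * (1 + norm x) \<le> \<mu> t * (1 + \<rho>)" using x by (intro mult_left_mono) auto
    with * show ?thesis by simp
  qed
  define \<Gamma>0 where "\<Gamma>0 t x = {y \<in> F t x. R < norm x \<longrightarrow> inner x y \<le> 0}" for t x
  define \<Gamma> where "\<Gamma> e t x = (\<lambda>y. y - e *\<^sub>R x) ` \<Gamma>0 t x" for e t x
  \<comment> \<open>The extra \<rho> bounds the term e x for all e \<le> 1.\<close>
  define m where "m t = \<mu> t * (1 + \<rho>) + \<rho>" for t
  have half: "{y. R < norm x \<longrightarrow> inner x y \<le> 0} = (if R < norm x then {y. inner x y \<le> 0} else UNIV)" for x :: 'a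
    by auto
  have \<Gamma>0_eq: "\<Gamma>0 t x = F t x \<inter> {y. R < norm x \<longrightarrow> inner x y \<le> 0}" for t x by (auto simp: \<Gamma>0_def)
  have halfcl: "closed {y. R < norm x \<longrightarrow> inner x y \<le> 0}" for x :: 'a
    unfolding half by (simp add: closed_halfspace_le)
  have \<Gamma>0cv: "convex (\<Gamma>0 t x)" and \<Gamma>0cp: "compact (\<Gamma>0 t x)" if "t \<in> {0..T}" for t x
    unfolding \<Gamma>0_eq using Fconv[OF that, of x] Fcomp[OF that, of x] halfcl[of x]
    by (auto intro!: convex_Int compact_Int_closed simp: half convex_halfspace_le)
  have \<Gamma>0b: "norm y \<le> \<mu> t * (1 + \<rho>)" if "t \<in> {0..T}" "norm x \<le> \<rho>" "y \<in> \<Gamma>0 t x" for t x y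
    using Fb[OF that(1,2)] that(3) by (simp add: \<Gamma>0_def)
  have usc0: "AE s in lebesgue_on {0..T}. \<forall>x e. norm x \<le> \<rho> \<longrightarrow> e > 0 \<longrightarrow> (\<exists>d>0. \<forall>x'. norm x' \<le> \<rho> \<longrightarrow>
      dist x' x < d \<longrightarrow> \<Gamma>0 s x' \<subseteq> thicken e (\<Gamma>0 s x))"
    using Fusc AE_space
  proof eventually_elim
    case (elim s)
    then have s: "s \<in> {0..T}" by simp
    show ?case
      unfolding \<Gamma>0_def using usc_restrict_halfspace[OF elim(1) Fcomp[OF s], of \<rho> "\<mu> s * (1 + \<rho>)"] Fb[OF s] by blast
  qed
  have loc: "bounded_inclusion T \<rho> m (\<Gamma> e)" if e: "0 \<le> e" "e \<le> 1" for e
  proof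
    show "T > 0" "\<rho> > 0" by fact+
    show "integrable (lebesgue_on {0..T}) m"
      unfolding m_def[abs_def] using \<mu> by simp
  next
    fix s and x :: 'a assume s: "s \<in> {0..T}" and x: "norm x \<le> \<rho>"
    show "\<Gamma> e s x \<noteq> {}"
      using Fne[OF s, of x] guide[OF s, of x] by (cases "R < norm x") (auto simp: \<Gamma>_def \<Gamma>0_def)
    show "convex (\<Gamma> e s x)" unfolding \<Gamma>_def using \<Gamma>0cv[OF s] by (rule convex_translation_subtract)
    show "compact (\<Gamma> e s x)" unfolding \<Gamma>_def using \<Gamma>0cp[OF s] by (rule compact_translation_subtract)
    fix y assume "y \<in> \<Gamma> e s x"
    then obtain q where q: "q \<in> \<Gamma>0 s x" "y = q - e *\<^sub>R x" by (auto simp: \<Gamma>_def)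
    have "norm y \<le> norm q + norm (e *\<^sub>R x)" unfolding q by (rule norm_triangle_ineq4)
    also have "norm (e *\<^sub>R x) \<le> 1 * \<rho>" unfolding norm_scaleR using e x by (intro mult_mono) auto
    finally show "norm y \<le> m s" using \<Gamma>0b[OF s x q(1)] by (simp add: m_def)
  next
    fix x :: 'a and C :: "'a set" assume x: "norm x \<le> \<rho>" and C: "closed C"
    define C' where "C' = {y. R < norm x \<longrightarrow> inner x y \<le> 0} \<inter> (\<lambda>y. y - e *\<^sub>R x) -` C"
    have "closed ((\<lambda>y. y - e *\<^sub>R x) -` C)"
      by (intro continuous_closed_vimage C continuous_intros)
    then have "closed C'" unfolding C'_def using halfcl by (intro closed_Int) auto
    have "\<Gamma> e s x \<inter> C \<noteq> {} \<longleftrightarrow> F s x \<inter> C' \<noteq> {}" for s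
    proof
      assume "\<Gamma> e s x \<inter> C \<noteq> {}"
      then obtain y where "y \<in> \<Gamma>0 s x" "y - e *\<^sub>R x \<in> C" by (auto simp: \<Gamma>_def)
      then have "y \<in> F s x \<inter> C'" by (simp add: C'_def \<Gamma>0_def)
      then show "F s x \<inter> C' \<noteq> {}" by blast
    next
      assume "F s x \<inter> C' \<noteq> {}"
      then obtain y where "y \<in> F s x" "y \<in> C'" by blast
      then have "y \<in> \<Gamma>0 s x" "y - e *\<^sub>R x \<in> C" by (simp_all add: C'_def \<Gamma>0_def)
      then show "\<Gamma> e s x \<inter> C \<noteq> {}" by (auto simp: \<Gamma>_def)
    qed
    then show "{s \<in> {0..T}. \<Gamma> e s x \<inter> C \<noteq> {}} \<in> sets lebesgue"
      using measurable_multimap_hit[OF Fmeas[of x] _ Fcomp \<open>closed C'\<close>] by simp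
  next
    show "AE s in lebesgue_on {0..T}. \<forall>x. norm x \<le> \<rho> \<longrightarrow> (\<forall>e'>0. \<exists>d>0. \<forall>x'. norm x' \<le> \<rho> \<longrightarrow>
      dist x' x < d \<longrightarrow> \<Gamma> e s x' \<subseteq> thicken e' (\<Gamma> e s x))"
      using usc0
    proof (rule eventually_mono, intro allI impI)
      fix s e' :: real and x :: 'a
      assume us: "\<forall>x e. norm x \<le> \<rho> \<longrightarrow> e > 0 \<longrightarrow> (\<exists>d>0. \<forall>x'. norm x' \<le> \<rho> \<longrightarrow>
          dist x' x < d \<longrightarrow> \<Gamma>0 s x' \<subseteq> thicken e (\<Gamma>0 s x))" and x: "norm x \<le> \<rho>" and "e' > 0"
      then have "e' / 2 > 0" by simp
      then obtain d where d: "d > 0" "\<And>x'. norm x' \<le> \<rho> \<Longrightarrow> dist x' x < d \<Longrightarrow> \<Gamma>0 s x' \<subseteq> thicken (e' / 2) (\<Gamma>0 s x)"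
        using us x by blast
      have "\<Gamma> e s x' \<subseteq> thicken e' (\<Gamma> e s x)" if x': "norm x' \<le> \<rho>" "dist x' x < min d (e' / 2)" for x'
      proof
        fix y assume "y \<in> \<Gamma> e s x'"
        then obtain q where q: "q \<in> \<Gamma>0 s x'" "y = q - e *\<^sub>R x'" by (auto simp: \<Gamma>_def)
        then obtain z where z: "z \<in> \<Gamma>0 s x" "dist q z < e' / 2" using d(2)[of x'] x' by (auto simp: thicken_def)
        have "y - (z - e *\<^sub>R x) = (q - z) - e *\<^sub>R (x' - x)" by (simp add: q algebra_simps)
        then have "dist y (z - e *\<^sub>R x) \<le> dist q z + norm (e *\<^sub>R (x' - x))"
          unfolding dist_norm by (metis norm_triangle_ineq4)
        also have "norm (e *\<^sub>R (x' - x)) \<le> dist x' x" using e by (simp add: dist_norm mult_left_le_one_le)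
        finally have "dist y (z - e *\<^sub>R x) < e'" using z x' by simp
        then show "y \<in> thicken e' (\<Gamma> e s x)" using z(1) by (auto simp: thicken_def \<Gamma>_def)
      qed
      then show "\<exists>d>0. \<forall>x'. norm x' \<le> \<rho> \<longrightarrow> dist x' x < d \<longrightarrow> \<Gamma> e s x' \<subseteq> thicken e' (\<Gamma> e s x)"
        using d(1) \<open>e' > 0\<close> by (intro exI[of _ "min d (e' / 2)"]) auto
    qed
  qed
  define m1 where "m1 = (\<lambda>s. m s + 1)"
  have m1: "integrable (lebesgue_on {0..T}) m1" unfolding m1_def m_def[abs_def] using \<mu> by simp
  then have m1i: "m1 integrable_on {0..T}" by (simp add: integrable_on_lebesgue_on)
  define \<epsilon> where "\<epsilon> j = 1 / (real j + 1)" for j :: nat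
  have \<epsilon>: "0 < \<epsilon> j" "\<epsilon> j \<le> 1" for j by (auto simp: \<epsilon>_def field_simps)
  have "\<exists>x w. dominated_primitive T m1 x w \<and> (AE s in lebesgue_on {0..T}. w s \<in> \<Gamma> (\<epsilon> j) s (x s)) \<and>
      (\<forall>t\<in>{0..T}. norm (x t) \<le> \<rho>) \<and> x 0 = g x" for j
  proof -
    interpret bounded_inclusion T \<rho> m "\<Gamma> (\<epsilon> j)" using \<epsilon>[of j] by (intro loc) auto
    have m1_eq: "bounded_inclusion.m1 m = m1"
      by (rule ext) (simp add: bounded_inclusion.m1_def[OF loc[of 1]] \<open>m1 = (\<lambda>s. m s + 1)\<close>)
    show ?thesis
    \<comment> \<open>For |x| > R the term - e x lowers the inner product with x by at least e R^2;
      R > 0 makes this a strict margin.\<close>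
    proof (rule solution_of_strict_problem[of R "\<epsilon> j * R\<^sup>2" g])
      show "0 \<le> R" "R < \<rho>" "0 < \<epsilon> j * R\<^sup>2" using R \<epsilon>[of j] by auto
      show "inner x y \<le> - (\<epsilon> j * R\<^sup>2)"
        if "s \<in> {0..T}" "R < norm x" "norm x \<le> \<rho>" "y \<in> \<Gamma> (\<epsilon> j) s x" for s x y
      proof -
        obtain q where q: "q \<in> \<Gamma>0 s x" "y = q - \<epsilon> j *\<^sub>R x" using \<open>y \<in> \<Gamma> (\<epsilon> j) s x\<close> by (auto simp: \<Gamma>_def)
        have "inner x q \<le> 0" using q that by (simp add: \<Gamma>0_def)
        moreover have "R\<^sup>2 \<le> (norm x)\<^sup>2" using that R by (intro power_mono) auto
        then have "\<epsilon> j * R\<^sup>2 \<le> \<epsilon> j * (norm x)\<^sup>2" using \<epsilon>[of j] by simp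
        moreover have "inner x y = inner x q - \<epsilon> j * (norm x)\<^sup>2"
          by (simp add: q inner_diff_right power2_norm_eq_inner)
        ultimately show ?thesis by linarith
      qed
      show "\<exists>x w. dominated_primitive T m1 x w \<and> (AE s in lebesgue_on {0..T}. w s \<in> \<Gamma> (\<epsilon> j) s (x s)) \<and>
          (\<forall>t\<in>{0..T}. norm (x t) \<le> \<rho>) \<and> x 0 = g x"
        if "dominated_primitive T (bounded_inclusion.m1 m) x w" "AE s in lebesgue_on {0..T}. w s \<in> \<Gamma> (\<epsilon> j) s (x s)"
          "\<And>t. t \<in> {0..T} \<Longrightarrow> norm (x t) \<le> \<rho>" "x 0 = g x" for x w
        using that unfolding m1_eq by blast
    qed (fact g_cong g_cont g1 g2 g3)+
  qed
  then obtain X W where X: "\<And>j. dominated_primitive T m1 (X j) (W j)"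
    and W: "\<And>j. AE s in lebesgue_on {0..T}. W j s \<in> \<Gamma> (\<epsilon> j) s (X j s)"
    and Xb: "\<And>j t. t \<in> {0..T} \<Longrightarrow> norm (X j t) \<le> \<rho>" and X0: "\<And>j. X j 0 = g (X j)"
    by metis
  obtain r x where r: "strict_mono (r :: nat \<Rightarrow> nat)" and ul: "uniform_limit {0..T} (\<lambda>j. X (r j)) x sequentially"
    by (rule dominated_primitive_compact[where \<rho> = \<rho>, OF X m1i]) (use T Xb[of 0] in auto)
  have lim: "(\<lambda>j. X (r j) t) \<longlonglongrightarrow> x t" if "t \<in> {0..T}" for t
    using ul that by (rule tendsto_uniform_limitI)
  have xb: "norm (x t) \<le> \<rho>" if "t \<in> {0..T}" for t
    by (rule tendsto_upperbound[OF tendsto_norm[OF lim[OF that]]]) (use Xb that in auto)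
  have "(\<lambda>j. \<epsilon> j) \<longlonglongrightarrow> 0" unfolding \<epsilon>_def by real_asymp
  then have \<epsilon>lim: "(\<lambda>j. \<epsilon> (r j)) \<longlonglongrightarrow> 0" using LIMSEQ_subseq_LIMSEQ[OF _ r] by (auto simp: o_def)
  obtain w where w: "dominated_primitive T m1 x w" "AE s in lebesgue_on {0..T}. w s \<in> \<Gamma>0 s (x s)"
  proof (rule dominated_primitive_limit[OF X m1 _ lim])
    show "closed (\<Gamma>0 s (x s))" "convex (\<Gamma>0 s (x s))" if "s \<in> {0..T}" for s
      using \<Gamma>0cp[OF that] \<Gamma>0cv[OF that] compact_imp_closed by auto
    \<comment> \<open>Every j has its own exceptional null set; the countably many are merged before
      s is fixed.\<close>
    have "AE s in lebesgue_on {0..T}. \<forall>j. W (r j) s \<in> \<Gamma> (\<epsilon> (r j)) s (X (r j) s)"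
      by (rule AE_all_countable[THEN iffD2]) (use W in blast)
    then show "AE s in lebesgue_on {0..T}. \<forall>e>0. \<forall>\<^sub>F j in sequentially. W (r j) s \<in> thicken e (\<Gamma>0 s (x s))"
      using usc0 AE_space
    proof eventually_elim
      case (elim s)
      then have s: "s \<in> {0..T}" by simp
      show ?case
      proof (intro allI impI)
        fix e :: real assume "e > 0"
        then have e: "e / 2 > 0" by simp
        then obtain d where d: "d > 0" "\<And>x'. norm x' \<le> \<rho> \<Longrightarrow> dist x' (x s) < d \<Longrightarrow> \<Gamma>0 s x' \<subseteq> thicken (e / 2) (\<Gamma>0 s (x s))"
          using elim(2) xb[OF s] by blast
        have "(\<lambda>j. \<epsilon> (r j) * \<rho>) \<longlonglongrightarrow> 0 * \<rho>" by (intro tendsto_intros \<epsilon>lim)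
        then have "\<forall>\<^sub>F j in sequentially. \<epsilon> (r j) * \<rho> < e / 2"
          using e by (intro order_tendstoD(2)) auto
        moreover have "\<forall>\<^sub>F j in sequentially. dist (X (r j) s) (x s) < d"
          using lim[OF s] d(1) by (rule tendstoD)
        ultimately show "\<forall>\<^sub>F j in sequentially. W (r j) s \<in> thicken e (\<Gamma>0 s (x s))"
        proof eventually_elim
          case (elim j)
          obtain q where q: "q \<in> \<Gamma>0 s (X (r j) s)" "W (r j) s = q - \<epsilon> (r j) *\<^sub>R X (r j) s"
            using \<open>\<forall>j. W (r j) s \<in> \<Gamma> (\<epsilon> (r j)) s (X (r j) s)\<close> by (auto simp: \<Gamma>_def)
          then obtain z where z: "z \<in> \<Gamma>0 s (x s)" "dist q z < e / 2"
            using d(2)[OF Xb[OF s] elim(2)] by (auto simp: thicken_def)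
          have "dist (W (r j) s) z \<le> dist (W (r j) s) q + dist q z" by (rule dist_triangle)
          also have "dist (W (r j) s) q \<le> \<epsilon> (r j) * \<rho>"
            using \<epsilon>[of "r j"] Xb[OF s, of "r j"] by (simp add: q dist_norm mult_left_mono)
          finally have "dist (W (r j) s) z < e" using z elim by simp
          then show ?case using z(1) by (auto simp: thicken_def)
        qed
      qed
    qed
  qed (use T in auto)
  have "AE s in lebesgue_on {0..T}. w s \<in> F s (x s)" using w(2) by (auto simp: \<Gamma>0_def elim!: eventually_mono)
  moreover have "x 0 = g x"
  proof (rule LIMSEQ_unique)
    show "(\<lambda>j. X (r j) 0) \<longlonglongrightarrow> x 0" using T by (intro lim) auto
    have "(\<lambda>j. g (X (r j))) \<longlonglongrightarrow> g x"
      using ul by (intro g_cont dominated_primitive_continuous[OF X m1i])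
    then show "(\<lambda>j. X (r j) 0) \<longlonglongrightarrow> g x" by (simp only: X0)
  qed
  ultimately show ?thesis using that[OF m1i w(1)] by blast
qed

subsection \<open>Radial potentials and the space of continuous functions\<close>

lemma absolutely_continuous_on_imp_continuous_on:
  fixes f :: "real \<Rightarrow> 'a::real_normed_vector"
  assumes "absolutely_continuous_on {a..b} f"
  shows "continuous_on {a..b} f"
  unfolding continuous_on_iff dist_norm
proof (intro ballI allI impI)
  fix s e :: real assume s: "s \<in> {a..b}" and "e > 0"
  then obtain d where d: "d > 0" "\<And>(n::nat) p q. (\<forall>k<n. p k \<le> q k \<and> {p k..q k} \<subseteq> {a..b}) \<Longrightarrow>
      disjoint_family_on (\<lambda>k. {p k<..<q k}) {..<n} \<Longrightarrow> (\<Sum>k<n. q k - p k) < d \<Longrightarrow>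
      (\<Sum>k<n. norm (f (q k) - f (p k))) < e"
    using assms unfolding absolutely_continuous_on_def by blast
  have *: "norm (f v - f u) < e" if "u \<le> v" "a \<le> u" "v \<le> b" "v - u < d" for u v
    using d(2)[of 1 "\<lambda>k. u" "\<lambda>k. v"] that by (simp add: disjoint_family_on_def)
  have "norm (f t - f s) < e" if "t \<in> {a..b}" "norm (t - s) < d" for t
    using *[of s t] *[of t s] s that by (cases "s \<le> t") (auto simp: norm_minus_commute)
  then show "\<exists>d>0. \<forall>t\<in>{a..b}. norm (t - s) < d \<longrightarrow> norm (f t - f s) < e" using d(1) by blast
qed

text \<open>The derivative is a linear functional, represented by its adjoint at 1; uniqueness of
  the derivative makes the description in \<open>gradient\<close> well defined.\<close>

lemma GDERIV_gradient:
  fixes V :: "'a::euclidean_space \<Rightarrow> real"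
  assumes "V differentiable (at x)"
  shows "GDERIV V x :> gradient V x"
proof -
  obtain f' where f': "(V has_derivative f') (at x)" using assms by (auto simp: differentiable_def)
  have lin: "linear f'" using f' by (rule has_derivative_linear)
  have f'_eq: "f' = (\<lambda>h. inner h (adjoint f' 1))" using adjoint_works[OF lin, of _ "1::real"] by auto
  have ex: "GDERIV V x :> adjoint f' 1" unfolding gderiv_def using f' by (subst f'_eq[symmetric])
  moreover have "D = adjoint f' 1" if "GDERIV V x :> D" for D
  proof -
    have "(\<lambda>h. inner h D) = (\<lambda>h. inner h (adjoint f' 1))"
      using that ex unfolding gderiv_def by (rule has_derivative_unique)
    then have "inner h D = inner h (adjoint f' 1)" for h by meson
    then show ?thesis by (metis vector_eq_ldot)
  qed
  ultimately show ?thesis unfolding gradient_def by (rule theI)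
qed

text \<open>If <x, z> > 0, then x + h z has larger norm than x for h > 0, so V does not decrease in
  the direction z. If <x, y> > 0, then also <x, z> > 0 for z = y - c D with D the gradient and c > 0
  small; yet the derivative along z is at most - c |D|^2 < 0.\<close>

lemma inner_nonpos_of_monotone_gradient:
  fixes V :: "'a::euclidean_space \<Rightarrow> real"
  assumes mono: "norm_monotone V" and diff: "V differentiable (at x)" and ne: "gradient V x \<noteq> 0"
    and y: "inner (gradient V x) y \<le> 0"
  shows "inner x y \<le> 0"
proof (rule ccontr)
  assume "\<not> inner x y \<le> 0"
  then have pos: "inner x y > 0" by simp
  have grad: "inner z (gradient V x) \<ge> 0" if z: "inner x z > 0" for z
  proof (rule ccontr)
    assume neg: "\<not> inner z (gradient V x) \<ge> 0"
    have "((\<lambda>h. V (x + h *\<^sub>R z)) has_derivative (\<lambda>h. inner (h *\<^sub>R z) (gradient V x))) (at 0)"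
    proof (rule has_derivative_compose[of "\<lambda>h. x + h *\<^sub>R z" "\<lambda>h. h *\<^sub>R z"])
      show "((\<lambda>h. x + h *\<^sub>R z) has_derivative (\<lambda>h. h *\<^sub>R z)) (at 0)"
        by (auto intro!: derivative_eq_intros)
      show "(V has_derivative (\<lambda>h. inner h (gradient V x))) (at (x + 0 *\<^sub>R z))"
        using GDERIV_gradient[OF diff] by (simp add: gderiv_def)
    qed
    then have "((\<lambda>h. V (x + h *\<^sub>R z)) has_field_derivative inner z (gradient V x)) (at 0)"
      unfolding has_field_derivative_def by (simp add: mult.commute[of _ "inner z (gradient V x)"])
    then obtain d where d: "d > 0" "\<And>h. 0 < h \<Longrightarrow> h < d \<Longrightarrow> V (x + h *\<^sub>R z) < V x"
      using DERIV_neg_dec_right[of "\<lambda>h. V (x + h *\<^sub>R z)" "inner z (gradient V x)" 0] neg by auto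
    define h where "h = d / 2"
    have h: "h > 0" "h < d" using d(1) by (auto simp: h_def)
    have "(norm (x + h *\<^sub>R z))\<^sup>2 = (norm x)\<^sup>2 + 2 * h * inner x z + (h * norm z)\<^sup>2"
      by (simp add: power2_norm_eq_inner inner_add_left inner_add_right inner_commute power_mult_distrib)
        (simp add: power2_eq_square)
    moreover have "2 * h * inner x z > 0" using h z by simp
    ultimately have "(norm x)\<^sup>2 \<le> (norm (x + h *\<^sub>R z))\<^sup>2" using zero_le_power2[of "h * norm z"] by linarith
    then have "norm x \<le> norm (x + h *\<^sub>R z)" by (rule power2_le_imp_le) simp
    then have "V x \<le> V (x + h *\<^sub>R z)" using mono by (simp add: norm_monotone_def)
    with d(2)[OF h] show False by simp
  qed
  define D where "D = gradient V x"
  \<comment> \<open>k is positive and dominates <x, D>, so the choice of c below gives away at most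
    half of <x, y>.\<close>
  define k where "k = \<bar>inner x D\<bar> + 1"
  have k: "k > 0" "inner x D \<le> k" by (simp_all add: k_def add_nonneg_pos)
  define c where "c = inner x y / (2 * k)"
  have c: "c > 0" using pos k by (simp add: c_def)
  have "c * inner x D \<le> c * k" using c k by (intro mult_left_mono) auto
  also have "\<dots> = inner x y / 2" using k by (simp add: c_def)
  finally have "inner x (y - c *\<^sub>R D) > 0" using pos by (simp add: inner_diff_right)
  then have "inner (y - c *\<^sub>R D) D \<ge> 0" unfolding D_def by (rule grad)
  then have "c * inner D D \<le> 0" using y by (simp add: inner_diff_left inner_diff_right inner_commute D_def)
  moreover have "c * inner D D > 0" using c ne by (simp add: D_def)
  ultimately show False by simp
qed

text \<open>Monotonicity in both directions makes V constant on spheres, so the intermediate value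
  theorem along one ray suffices. It starts at radius R, where V < r, and ends at
  \<open>max R b\<close>, where coercivity gives V \<ge> r; the strict inequality at R yields \<rho>
  > R.\<close>

lemma sublevel_ball:
  fixes V :: "'a::euclidean_space \<Rightarrow> real"
  assumes mono: "norm_monotone V" and co: "coercive V" and cont: "continuous_on UNIV V"
    and "R > 0" and r: "r > (SUP x\<in>{x. norm x \<le> R}. V x)"
  obtains \<rho> where "\<rho> > R" "\<And>x. norm x = \<rho> \<Longrightarrow> V x = r" "\<And>x. norm x \<le> \<rho> \<Longrightarrow> V x \<le> r"
proof -
  have Vle: "V x \<le> V y" if "norm x \<le> norm y" for x y using mono that by (simp add: norm_monotone_def)
  obtain e :: 'a where "e \<in> Basis" using nonempty_Basis by blast
  then have ne: "norm e = 1" by simp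
  have "bdd_above (V ` {x. norm x \<le> R})"
    by (rule bdd_aboveI[of _ "V (R *\<^sub>R e)"]) (use \<open>R > 0\<close> in \<open>auto intro!: Vle simp: ne\<close>)
  then have VR: "V (R *\<^sub>R e) < r"
    using cSUP_upper[of "R *\<^sub>R e" "{x. norm x \<le> R}" V] r \<open>R > 0\<close> by (simp add: ne)
  have "eventually (\<lambda>x. r \<le> V x) at_infinity"
    using co unfolding coercive_def by (simp add: filterlim_at_top)
  then obtain b where b: "\<And>x. norm x \<ge> b \<Longrightarrow> r \<le> V x" by (auto simp: eventually_at_infinity)
  have "\<exists>s\<ge>R. s \<le> max R b \<and> V (s *\<^sub>R e) = r"
  proof (rule IVT')
    show "V (R *\<^sub>R e) \<le> r" using VR by simp
    show "r \<le> V (max R b *\<^sub>R e)" using \<open>R > 0\<close> by (intro b) (simp add: ne)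
    show "continuous_on {R..max R b} (\<lambda>s. V (s *\<^sub>R e))"
      by (intro continuous_on_compose2[OF cont] continuous_intros) auto
  qed simp
  then obtain \<rho> where \<rho>: "\<rho> \<ge> R" "V (\<rho> *\<^sub>R e) = r" by blast
  have "\<rho> \<noteq> R" using \<rho> VR by auto
  show ?thesis
  proof (rule that[of \<rho>])
    show "\<rho> > R" using \<rho> \<open>\<rho> \<noteq> R\<close> by simp
    show "V x \<le> r" if "norm x \<le> \<rho>" for x using Vle[of x "\<rho> *\<^sub>R e"] \<rho> \<open>R > 0\<close> that by (simp add: ne)
    show "V x = r" if "norm x = \<rho>" for x
      using Vle[of x "\<rho> *\<^sub>R e"] Vle[of "\<rho> *\<^sub>R e" x] \<rho> \<open>R > 0\<close> that by (simp add: ne)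
  qed
qed

section \<open>The space of continuous functions and the original data\<close>

lemma mspace_C_space:
  "mspace (C_space {a..b}) = {f. f \<in> extensional {a..b} \<and> continuous_on {a..b} (f :: real \<Rightarrow> 'a::euclidean_space)}"
proof -
  have "compactin (top_of_set {a..b}) (topspace (top_of_set {a..b}))" by (simp add: compactin_subtopology)
  then show ?thesis
    unfolding C_space_def by (subst compactin_mspace_cfunspace) auto
qed

lemma restrict_in_C_space:
  assumes "continuous_on {a..b} x"
  shows "restrict x {a..b} \<in> mspace (C_space {a..b})"
proof -
  have "continuous_on {a..b} (restrict x {a..b})" using assms by (rule continuous_on_eq) simp
  then show ?thesis by (simp add: mspace_C_space)
qed

lemma continuous_map_C_space_uniform_limit:
  fixes g :: "(real \<Rightarrow> 'a::euclidean_space) \<Rightarrow> 'b::topological_space"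
  assumes "a \<le> b" and g: "continuous_map (mtopology_of (C_space {a..b})) euclidean g"
    and X: "\<And>j. continuous_on {a..b} (X j)" and ul: "uniform_limit {a..b} X x sequentially"
  shows "(\<lambda>j. g (restrict (X j) {a..b})) \<longlonglongrightarrow> g (restrict x {a..b})"
proof -
  let ?C = "C_space {a..b} :: (real \<Rightarrow> 'a) metric"
  have "continuous_on {a..b} x" by (rule uniform_limit_theorem[OF _ ul]) (auto simp: X)
  then have xC: "restrict x {a..b} \<in> mspace ?C" by (rule restrict_in_C_space)
  interpret M: Metric_space "mspace ?C" "mdist ?C" by (rule Metric_space_mspace_mdist)
  have "limitin M.mtopology (\<lambda>j. restrict (X j) {a..b}) (restrict x {a..b}) sequentially"
    unfolding M.limitin_metric
  proof (intro conjI allI impI xC)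
    fix e :: real assume "e > 0"
    then have "e / 2 > 0" by simp
    then have "\<forall>\<^sub>F j in sequentially. \<forall>t\<in>{a..b}. dist (X j t) (x t) < e / 2"
      using ul unfolding uniform_limit_iff by blast
    then show "\<forall>\<^sub>F j in sequentially. restrict (X j) {a..b} \<in> mspace ?C \<and>
        mdist ?C (restrict (X j) {a..b}) (restrict x {a..b}) < e"
    proof eventually_elim
      case (elim j)
      have XC: "restrict (X j) {a..b} \<in> mspace ?C" using X by (rule restrict_in_C_space)
      \<comment> \<open>Pointwise strict bounds give only a weak bound for the supremum, hence e/2
        instead of e.\<close>
      have "mdist ?C (restrict (X j) {a..b}) (restrict x {a..b}) \<le> e / 2"
        using XC xC \<open>a \<le> b\<close> elim unfolding C_space_def
        by (subst cfunspace_mdist_le) (auto intro: less_imp_le)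
      with XC \<open>e > 0\<close> show ?case by simp
    qed
  qed
  then have "limitin euclidean (g \<circ> (\<lambda>j. restrict (X j) {a..b})) (g (restrict x {a..b})) sequentially"
    by (intro continuous_map_limit[OF g]) (simp add: mtopology_of_def)
  then show ?thesis by (simp add: o_def)
qed

theorem theorem6:
  fixes T R r :: real
    and F :: "real \<Rightarrow> real ^ 'n \<Rightarrow> (real ^ 'n) set"
    and V :: "real ^ 'n \<Rightarrow> real"
    and g :: "(real \<Rightarrow> real ^ 'n) \<Rightarrow> real ^ 'n"
  assumes "T > 0"
    and "caratheodory_map {0..T} F"
    and "norm_monotone V" and "coercive V" and "weakly_negatively_guiding {0..T} F V"
    and "R > 0"
    and "\<And>x. norm x \<ge> R \<Longrightarrow> gradient V x \<noteq> 0"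
    and "\<And>x t. norm x \<ge> R \<Longrightarrow> t \<in> {0..T} \<Longrightarrow> \<exists>y\<in>F t x. inner (gradient V x) y \<le> 0"
    and "r > (SUP x\<in>{x. norm x \<le> R}. V x)"
    and "continuous_map (mtopology_of (C_space {0..T})) euclidean g"
    and "\<And>B. Metric_space.mbounded (mspace (C_space {0..T})) (mdist (C_space {0..T})) B
              \<Longrightarrow> bounded (g ` B)"
    and "\<And>x. x \<in> AC_space {0..T} \<Longrightarrow> x ` {0..T} \<subseteq> V -` {..r} \<Longrightarrow> x 0 = g x
              \<Longrightarrow> \<exists>t\<in>{0<..T}. norm (g x) \<le> norm (x t)"
    and "\<And>x. x \<in> V -` {r} \<Longrightarrow> norm (g (const_fun {0..T} x)) \<le> norm x"
    and "\<And>x. x \<in> V -` {r} \<Longrightarrow> g (const_fun {0..T} x) \<noteq> x"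
  shows "\<exists>x. nonlocal_solution T F g x"
proof -
  let ?I = "{0..T}"
  \<comment> \<open>Points of the function space are normalised outside the interval, and the
    hypotheses on \<open>g\<close> speak only of such points. Restricting first gives a map on all
    functions that depends only on their values on the interval.\<close>
  define g' where "g' x = g (restrict x ?I)" for x
  have Vd: "V differentiable (at x)" for x
    using assms(5) by (simp add: weakly_negatively_guiding_def C1_function_def)
  then have "continuous_on UNIV V"
    by (auto intro!: differentiable_imp_continuous_on simp: differentiable_on_def)
  then obtain \<rho> where \<rho>: "\<rho> > R" "\<And>x. norm x = \<rho> \<Longrightarrow> V x = r" "\<And>x. norm x \<le> \<rho> \<Longrightarrow> V x \<le> r"
    using sublevel_ball[OF assms(3,4) _ assms(6,9)] by blast
  have const: "g' (\<lambda>t. z) = g (const_fun ?I z)" for z by (simp add: g'_def const_fun_def)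
  have AC: "restrict x ?I \<in> AC_space ?I" if "absolutely_continuous_on ?I x" for x :: "real \<Rightarrow> real ^ 'n"
    unfolding AC_space_def
    using restrict_in_C_space[OF absolutely_continuous_on_imp_continuous_on[OF that]] absolutely_continuous_on_cong[OF that, of "restrict x ?I"] by simp
  obtain x w m where m: "m integrable_on ?I" and x: "dominated_primitive T m x w"
    and w: "AE s in lebesgue_on ?I. w s \<in> F s (x s)" and x0: "x 0 = g' x"
  proof (rule nonlocal_problem_in_ball[OF assms(1,2,6) \<rho>(1), of g'])
    show "\<exists>y\<in>F t x. inner x y \<le> 0" if "t \<in> ?I" "R \<le> norm x" for t x
      using assms(8)[OF that(2,1)] inner_nonpos_of_monotone_gradient[OF assms(3) Vd assms(7)[OF that(2)]] by blast
    show "g' x = g' y" if "\<And>t. t \<in> ?I \<Longrightarrow> x t = y t" for x y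
      unfolding g'_def using that by (intro arg_cong[where f = g] restrict_ext) auto
    show "(\<lambda>j. g' (X j)) \<longlonglongrightarrow> g' x"
      if "\<And>j. continuous_on ?I (X j)" "uniform_limit ?I X x sequentially" for X x
      unfolding g'_def by (rule continuous_map_C_space_uniform_limit[OF _ assms(10) that]) (use assms(1) in auto)
    show "norm (g' (\<lambda>t. z)) \<le> \<rho>" if "norm z = \<rho>" for z
      unfolding const using assms(13)[of z] \<rho>(2)[OF that] that by simp
    show "g' (\<lambda>t. z) \<noteq> z" if "norm z = \<rho>" for z
      unfolding const using assms(14)[of z] \<rho>(2)[OF that] by simp
    show "\<exists>t\<in>{0<..T}. norm (g' x) \<le> norm (x t)"
      if ac: "absolutely_continuous_on ?I x" and le: "\<And>t. t \<in> ?I \<Longrightarrow> norm (x t) \<le> \<rho>" and x0: "x 0 = g' x" for x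
    proof -
      have "restrict x ?I \<in> AC_space ?I" by (rule AC[OF ac])
      moreover have "restrict x ?I ` ?I \<subseteq> V -` {..r}" using \<rho>(3) le by auto
      moreover have "restrict x ?I 0 = g (restrict x ?I)" using x0 assms(1) by (simp add: g'_def)
      ultimately show ?thesis using assms(12)[of "restrict x ?I"] by (auto simp: g'_def)
    qed
  qed blast
  have "nonlocal_solution T F g (restrict x ?I)"
    unfolding nonlocal_solution_def
  proof (intro conjI)
    show "restrict x ?I \<in> AC_space ?I"
      by (rule AC[OF dominated_primitive_absolutely_continuous[OF x m]])
    show "restrict x ?I 0 = g (restrict x ?I)" using x0 assms(1) by (simp add: g'_def)
    have "w integrable_on ?I"
      using dominated_primitive_integrable[OF x m] by (simp add: absolutely_integrable_on_def)
    then have "AE t in lebesgue_on ?I. ((\<lambda>t. integral {0..t} w) has_vector_derivative w t) (at t within ?I)"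
      by (rule AE_has_vector_derivative_integral)
    then show "AE t in lebesgue_on ?I.
        \<exists>v\<in>F t (restrict x ?I t). (restrict x ?I has_vector_derivative v) (at t within ?I)"
      using w AE_space
    proof eventually_elim
      case (elim t)
      then have t: "t \<in> ?I" by simp
      have "((\<lambda>t. x 0 + integral {0..t} w) has_vector_derivative w t) (at t within ?I)"
        using elim(1) by (auto intro!: derivative_eq_intros)
      then have "(restrict x ?I has_vector_derivative w t) (at t within ?I)"
        by (rule has_vector_derivative_transform[OF t, rotated])
          (simp add: dominated_primitiveD(3)[OF x, symmetric])
      then show ?case using elim(2) t by auto
    qed
  qed
  then show ?thesis by blast
qed

end
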